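(* Let $r\ge 1$ and let $F$ be an $r$-demicontinuous normed lattice with Lorentz completion $(F^{L},\|\cdot\|_{L})$. Then: (i) $F^{L}$ is an $r$-monotonically complete Banach lattice. (ii) The norm of $F$ has an $r^{2}$-demicontinuous extension to $F^{L}$ (i.e. there is a solid $r^2$-demicontinuous norm on $F^L$ extending the norm of $F$) which is equivalent to $\|\cdot\|_{L}$. (iii) The norm completion of $F$ is $r^{2}$-demicontinuous. (iv) If $T:F\to E$ is a contractive order continuous homomorphism into a demicontinuous normed lattice $E$, then there is a unique order continuous extension $T^{L}:F^{L}\to E^{L}$ of $T$. Moreover, $T^{L}$ is a contractive homomorphism. (v) If $G$ is a normed lattice which isomorphically contains $F$ as an order dense sublattice, then there is a unique injective order continuous homomorphism $J:G\to F^{L}$ which leaves $F$ in place (i.e. restricts to the inclusion $F\subset F^L$ on $F$). (vi) If $F$ is $r$-semicontinuous, then so is $F^{L}$. In particular, the Lorentz completion preserves topological semicontinuity.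
   Context: A normed lattice is a real vector lattice with a lattice (solid) norm; norm completeness is not assumed. Homomorphism means linear lattice homomorphism. "Directed" means upward directed; $P\uparrow f$ ($P\downarrow f$) means that $P$ is upward (downward) directed with supremum (infimum) $f$. $B_F$ is the closed unit ball of $F$ and $B_{F_+}=B_F\cap F_+$. A net $(f_p)$ in a vector lattice $H$ order converges to $f$ if there is $Q\subset H$ with $Q\downarrow 0$ such that for every $q\in Q$ there is $p_q$ with $|f_p-f|\le q$ whenever $p\ge p_q$. A linear operator is order continuous if it preserves order convergence of nets. The order adherence of a set in $H$ is the set of all order limits in $H$ of nets of its elements. A sublattice $E$ of $H$ is order dense if for every $0<h\in H$ there is $e\in E$ with $0<e\le h$. "$G$ isomorphically contains $F$ as an order dense sublattice" means that there is a lattice homomorphic embedding $F\to G$, bounded and bounded below in norm, whose image (identified with $F$) is order dense in $G$. The universal completion $F^u$ is the (essentially unique) universally complete vector lattice (order complete and such that every disjoint set of positive elements is order bounded) that contains $F$ as an order dense sublattice. $F$ is $r$-demicontinuous if whenever $P\subset B_{F_+}$ and $f\in F$ satisfy $P\uparrow f$, then $\|f\|\le r$; it is demicontinuous if it is $r$-demicontinuous for some $r\ge1$; a semicontinuous norm is a solid norm that is $1$-demicontinuous. $F$ is $r$-semicontinuous if there is a semicontinuous norm $\|\cdot\|'$ on $F$ with $\|\cdot\|\le\|\cdot\|'\le r\|\cdot\|$, and topologically semicontinuous if it has an equivalent semicontinuous norm. $F$ is $r$-monotonically complete if every directed subset of $B_{F_+}$ has a supremum in $F$ of norm at most $r$.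 Lorentz completion: let $B_F^L$ be the order adherence of $B_F$ in $F^u$; it is a convex solid set consisting of those $f\in F^u$ for which there is $P\subset B_{F_+}$ with $P\uparrow|f|$ in $F^u$. Put $F^L=\bigcup_{n\in\mathbb N} nB_F^L$ and $\|f\|_L=\inf\{s>0:\ \exists P\subset sB_{F_+},\ P\uparrow |f|\}$ for $f\in F^L$. When $F$ is demicontinuous, $\|\cdot\|_L$ is a solid norm on the ideal $F^L$ of $F^u$, and $F\subset F^L$; $(F^L,\|\cdot\|_L)$ is called the Lorentz completion of $F$. *)

theory Defs
  imports "HOL-Analysis.Analysis" "HOL-Library.Lattice_Algebras"
begin

class vector_lattice = ordered_real_vector + lattice_ab_group_add_abs

text \<open>
  A vector lattice is a linear sublattice H of an ambient type of class vector_lattice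
  (possibly the whole type, H = UNIV).  Lattice operations and \<open>\<bar>_\<bar>\<close> are those of the
  ambient type, but suprema and infima of infinite sets, and everything built on them,
  are taken relative to H.  Norms are explicit functions, constrained only on H.
\<close>

definition sublattice :: "'a::vector_lattice set \<Rightarrow> bool" where
  "sublattice H \<longleftrightarrow> subspace H \<and> (\<forall>x\<in>H. \<forall>y\<in>H. sup x y \<in> H \<and> inf x y \<in> H)"

definition is_sup_in :: "'a::order set \<Rightarrow> 'a set \<Rightarrow> 'a \<Rightarrow> bool" where
  "is_sup_in H P f \<longleftrightarrow>
     f \<in> H \<and> (\<forall>p\<in>P. p \<le> f) \<and> (\<forall>h\<in>H. (\<forall>p\<in>P. p \<le> h) \<longrightarrow> f \<le> h)"

definition is_inf_in :: "'a::order set \<Rightarrow> 'a set \<Rightarrow> 'a \<Rightarrow> bool" where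
  "is_inf_in H P f \<longleftrightarrow>
     f \<in> H \<and> (\<forall>p\<in>P. f \<le> p) \<and> (\<forall>h\<in>H. (\<forall>p\<in>P. h \<le> p) \<longrightarrow> h \<le> f)"

definition directed_up :: "'a::order set \<Rightarrow> bool" where
  "directed_up P \<longleftrightarrow> P \<noteq> {} \<and> (\<forall>x\<in>P. \<forall>y\<in>P. \<exists>z\<in>P. x \<le> z \<and> y \<le> z)"

definition directed_down :: "'a::order set \<Rightarrow> bool" where
  "directed_down P \<longleftrightarrow> P \<noteq> {} \<and> (\<forall>x\<in>P. \<forall>y\<in>P. \<exists>z\<in>P. z \<le> x \<and> z \<le> y)"

definition increases_to :: "'a::order set \<Rightarrow> 'a set \<Rightarrow> 'a \<Rightarrow> bool" where
  "increases_to H P f \<longleftrightarrow> P \<subseteq> H \<and> directed_up P \<and> is_sup_in H P f"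

definition decreases_to :: "'a::order set \<Rightarrow> 'a set \<Rightarrow> 'a \<Rightarrow> bool" where
  "decreases_to H P f \<longleftrightarrow> P \<subseteq> H \<and> directed_down P \<and> is_inf_in H P f"

definition order_dense_sublattice :: "'a::vector_lattice set \<Rightarrow> 'a set \<Rightarrow> bool" where
  "order_dense_sublattice E H \<longleftrightarrow>
     sublattice E \<and> E \<subseteq> H \<and> (\<forall>h\<in>H. 0 < h \<longrightarrow> (\<exists>e\<in>E. 0 < e \<and> e \<le> h))"

definition order_complete :: "'a::vector_lattice set \<Rightarrow> bool" where
  "order_complete H \<longleftrightarrow>
     (\<forall>P\<subseteq>H. P \<noteq> {} \<and> (\<exists>h\<in>H. \<forall>p\<in>P. p \<le> h) \<longrightarrow> (\<exists>f. is_sup_in H P f))"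

definition universally_complete :: "'a::vector_lattice set \<Rightarrow> bool" where
  "universally_complete H \<longleftrightarrow>
     sublattice H \<and> order_complete H \<and>
     (\<forall>D\<subseteq>H. (\<forall>d\<in>D. 0 \<le> d) \<and> (\<forall>d\<in>D. \<forall>d'\<in>D. d \<noteq> d' \<longrightarrow> inf d d' = 0)
        \<longrightarrow> (\<exists>h\<in>H. \<forall>d\<in>D. d \<le> h))"


subsection \<open>Operators\<close>

definition linear_on :: "'a::real_vector set \<Rightarrow> 'b::real_vector set \<Rightarrow> ('a \<Rightarrow> 'b) \<Rightarrow> bool" where
  "linear_on H K T \<longleftrightarrow>
     T ` H \<subseteq> K \<and> (\<forall>x\<in>H. \<forall>y\<in>H. T (x + y) = T x + T y) \<and> (\<forall>c. \<forall>x\<in>H. T (c *\<^sub>R x) = c *\<^sub>R T x)"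

definition lattice_hom ::
  "'a::vector_lattice set \<Rightarrow> 'b::vector_lattice set \<Rightarrow> ('a \<Rightarrow> 'b) \<Rightarrow> bool" where
  "lattice_hom H K T \<longleftrightarrow>
     linear_on H K T \<and>
     (\<forall>x\<in>H. \<forall>y\<in>H. T (sup x y) = sup (T x) (T y) \<and> T (inf x y) = inf (T x) (T y))"

definition contractive :: "'a set \<Rightarrow> ('a \<Rightarrow> real) \<Rightarrow> ('b \<Rightarrow> real) \<Rightarrow> ('a \<Rightarrow> 'b) \<Rightarrow> bool" where
  "contractive H N M T \<longleftrightarrow> (\<forall>x\<in>H. M (T x) \<le> N x)"


subsection \<open>Order convergence of nets\<close>

definition directed_index :: "'i set \<Rightarrow> ('i \<Rightarrow> 'i \<Rightarrow> bool) \<Rightarrow> bool" where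
  "directed_index A le \<longleftrightarrow>
     A \<noteq> {} \<and> (\<forall>i\<in>A. le i i) \<and>
     (\<forall>i\<in>A. \<forall>j\<in>A. \<forall>k\<in>A. le i j \<longrightarrow> le j k \<longrightarrow> le i k) \<and>
     (\<forall>i\<in>A. \<forall>j\<in>A. \<exists>k\<in>A. le i k \<and> le j k)"

definition order_converges ::
  "'a::vector_lattice set \<Rightarrow> 'i set \<Rightarrow> ('i \<Rightarrow> 'i \<Rightarrow> bool) \<Rightarrow> ('i \<Rightarrow> 'a) \<Rightarrow> 'a \<Rightarrow> bool" where
  "order_converges H A le x f \<longleftrightarrow>
     x ` A \<subseteq> H \<and> f \<in> H \<and>
     (\<exists>Q. decreases_to H Q 0 \<and>
        (\<forall>q\<in>Q. \<exists>i\<in>A. \<forall>j\<in>A. le i j \<longrightarrow> \<bar>x j - f\<bar> \<le> q))"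

text \<open>
  A definition cannot quantify over index types.  The next two quantify over nets
  indexed by subsets of \<open>'a \<times> 'a set\<close>; the lemmas \<open>order_continuousD\<close> and
  \<open>order_adherenceI\<close> below show that this already covers nets over every index type,
  because a net can be reindexed by pairs (value, tail containing it).
\<close>

definition order_continuous ::
  "'a::vector_lattice set \<Rightarrow> 'b::vector_lattice set \<Rightarrow> ('a \<Rightarrow> 'b) \<Rightarrow> bool" where
  "order_continuous H K T \<longleftrightarrow>
     linear_on H K T \<and>
     (\<forall>(A :: ('a \<times> 'a set) set) le x f. directed_index A le \<longrightarrow>
        order_converges H A le x f \<longrightarrow> order_converges K A le (\<lambda>i. T (x i)) (T f))"

definition order_adherence :: "'a::vector_lattice set \<Rightarrow> 'a set \<Rightarrow> 'a set" where
  "order_adherence H S =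
     {f \<in> H. \<exists>(A :: ('a \<times> 'a set) set) le x.
        directed_index A le \<and> x ` A \<subseteq> S \<and> order_converges H A le x f}"

definition tail :: "'i set \<Rightarrow> ('i \<Rightarrow> 'i \<Rightarrow> bool) \<Rightarrow> ('i \<Rightarrow> 'a) \<Rightarrow> 'i \<Rightarrow> 'a set" where
  "tail A le x i = x ` {j\<in>A. le i j}"

definition tail_index :: "'i set \<Rightarrow> ('i \<Rightarrow> 'i \<Rightarrow> bool) \<Rightarrow> ('i \<Rightarrow> 'a) \<Rightarrow> ('a \<times> 'a set) set" where
  "tail_index A le x = {(y, tail A le x i) |y i. i \<in> A \<and> y \<in> tail A le x i}"

definition tail_le :: "('a \<times> 'a set) \<Rightarrow> ('a \<times> 'a set) \<Rightarrow> bool" where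
  "tail_le s t \<longleftrightarrow> snd t \<subseteq> snd s"

lemma tail_index_mem:
  assumes "directed_index A le" "i \<in> A"
  shows "(x i, tail A le x i) \<in> tail_index A le x"
  using assms unfolding tail_index_def tail_def directed_index_def by blast

lemma tail_mono:
  assumes "directed_index A le" "i \<in> A" "j \<in> A" "le i j"
  shows "tail A le x j \<subseteq> tail A le x i"
  using assms unfolding tail_def directed_index_def by blast

lemma directed_tail_index:
  assumes A: "directed_index A le"
  shows "directed_index (tail_index A le x) tail_le"
proof -
  have "\<exists>u\<in>tail_index A le x. tail_le s u \<and> tail_le t u"
    if st: "s \<in> tail_index A le x" "t \<in> tail_index A le x" for s t
  proof -
    obtain i j where i: "i \<in> A" "snd s = tail A le x i" and j: "j \<in> A" "snd t = tail A le x j"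
      using st unfolding tail_index_def by auto
    then obtain k where k: "k \<in> A" "le i k" "le j k"
      using A unfolding directed_index_def by blast
    have "tail_le s (x k, tail A le x k)" "tail_le t (x k, tail A le x k)"
      using tail_mono[OF A i(1) k(1,2), of x] tail_mono[OF A j(1) k(1,3), of x] i j
      unfolding tail_le_def by auto
    then show ?thesis using tail_index_mem[OF A k(1)] by blast
  qed
  moreover have "tail_index A le x \<noteq> {}"
  proof -
    obtain i where "i \<in> A" using A unfolding directed_index_def by blast
    then show ?thesis using tail_index_mem[OF A] by blast
  qed
  ultimately show ?thesis
    unfolding directed_index_def by (auto simp: tail_le_def)
qed

lemma order_converges_tail_index:
  assumes A: "directed_index A le" and x: "x ` A \<subseteq> H"
  shows "order_converges K (tail_index A le x) tail_le (\<lambda>s. T (fst s)) f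
     \<longleftrightarrow> order_converges K A le (\<lambda>i. T (x i)) f"
proof -
  have img: "(\<lambda>s. T (fst s)) ` tail_index A le x = (\<lambda>i. T (x i)) ` A"
  proof
    show "(\<lambda>s. T (fst s)) ` tail_index A le x \<subseteq> (\<lambda>i. T (x i)) ` A"
      unfolding tail_index_def tail_def by auto
    show "(\<lambda>i. T (x i)) ` A \<subseteq> (\<lambda>s. T (fst s)) ` tail_index A le x"
      using tail_index_mem[OF A, of _ x] by (force simp: image_iff)
  qed
  have conv: "(\<exists>s\<in>tail_index A le x. \<forall>t\<in>tail_index A le x. tail_le s t \<longrightarrow> \<bar>T (fst t) - f\<bar> \<le> q)
      \<longleftrightarrow> (\<exists>i\<in>A. \<forall>j\<in>A. le i j \<longrightarrow> \<bar>T (x j) - f\<bar> \<le> q)" (is "?L \<longleftrightarrow> ?R") for q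
  proof
    assume ?L
    then obtain s where s: "s \<in> tail_index A le x"
        "\<forall>t\<in>tail_index A le x. tail_le s t \<longrightarrow> \<bar>T (fst t) - f\<bar> \<le> q" by blast
    then obtain i where i: "i \<in> A" "snd s = tail A le x i" unfolding tail_index_def by auto
    have "\<bar>T (x j) - f\<bar> \<le> q" if j: "j \<in> A" "le i j" for j
    proof -
      have "tail_le s (x j, tail A le x j)"
        using tail_mono[OF A i(1) j, of x] i(2) unfolding tail_le_def by simp
      then show ?thesis using s(2) tail_index_mem[OF A j(1), of x] by fastforce
    qed
    then show ?R using i(1) by blast
  next
    assume ?R
    then obtain i where i: "i \<in> A" "\<forall>j\<in>A. le i j \<longrightarrow> \<bar>T (x j) - f\<bar> \<le> q" by blast
    have "\<bar>T (fst t) - f\<bar> \<le> q"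
      if t: "t \<in> tail_index A le x" "tail_le (x i, tail A le x i) t" for t
    proof -
      have "fst t \<in> tail A le x i" using t unfolding tail_index_def tail_le_def by auto
      then show ?thesis using i(2) unfolding tail_def by auto
    qed
    then show ?L using tail_index_mem[OF A i(1)] by blast
  qed
  show ?thesis unfolding order_converges_def img conv ..
qed

lemma order_continuousD:
  fixes A :: "'i set"
  assumes T: "order_continuous H K T" and A: "directed_index A le"
    and x: "order_converges H A le x f"
  shows "order_converges K A le (\<lambda>i. T (x i)) (T f)"
proof -
  have xH: "x ` A \<subseteq> H" using x unfolding order_converges_def by blast
  have "order_converges H (tail_index A le x) tail_le fst f"
    using order_converges_tail_index[OF A xH, of H "\<lambda>y. y" f] x by simp
  then have "order_converges K (tail_index A le x) tail_le (\<lambda>s. T (fst s)) (T f)"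
    using T directed_tail_index[OF A, of x] unfolding order_continuous_def by blast
  then show ?thesis using order_converges_tail_index[OF A xH] by blast
qed

lemma order_adherenceI:
  fixes A :: "'i set"
  assumes A: "directed_index A le" and S: "x ` A \<subseteq> S" and x: "order_converges H A le x f"
  shows "f \<in> order_adherence H S"
proof -
  have xH: "x ` A \<subseteq> H" and f: "f \<in> H" using x unfolding order_converges_def by blast+
  have "order_converges H (tail_index A le x) tail_le fst f"
    using order_converges_tail_index[OF A xH, of H "\<lambda>y. y" f] x by simp
  moreover have "fst ` tail_index A le x \<subseteq> S"
    using S unfolding tail_index_def tail_def by auto
  ultimately show ?thesis
    using f directed_tail_index[OF A, of x] unfolding order_adherence_def by blast
qed


subsection \<open>Normed lattices\<close>

definition normed_lattice :: "'a::vector_lattice set \<Rightarrow> ('a \<Rightarrow> real) \<Rightarrow> bool" where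
  "normed_lattice H N \<longleftrightarrow>
     sublattice H \<and>
     (\<forall>x\<in>H. 0 \<le> N x) \<and> (\<forall>x\<in>H. N x = 0 \<longleftrightarrow> x = 0) \<and>
     (\<forall>c. \<forall>x\<in>H. N (c *\<^sub>R x) = \<bar>c\<bar> * N x) \<and>
     (\<forall>x\<in>H. \<forall>y\<in>H. N (x + y) \<le> N x + N y) \<and>
     (\<forall>x\<in>H. \<forall>y\<in>H. \<bar>x\<bar> \<le> \<bar>y\<bar> \<longrightarrow> N x \<le> N y)"

definition banach_lattice :: "'a::vector_lattice set \<Rightarrow> ('a \<Rightarrow> real) \<Rightarrow> bool" where
  "banach_lattice H N \<longleftrightarrow>
     normed_lattice H N \<and>
     (\<forall>s :: nat \<Rightarrow> 'a. range s \<subseteq> H \<and>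
          (\<forall>e>0. \<exists>k. \<forall>m\<ge>k. \<forall>n\<ge>k. N (s m - s n) < e) \<longrightarrow>
        (\<exists>l\<in>H. (\<lambda>n. N (s n - l)) \<longlonglongrightarrow> 0))"

definition equivalent_norms :: "'a set \<Rightarrow> ('a \<Rightarrow> real) \<Rightarrow> ('a \<Rightarrow> real) \<Rightarrow> bool" where
  "equivalent_norms H N M \<longleftrightarrow> (\<exists>c>0. \<exists>C>0. \<forall>x\<in>H. c * N x \<le> M x \<and> M x \<le> C * N x)"

definition pos_ball :: "'a::vector_lattice set \<Rightarrow> ('a \<Rightarrow> real) \<Rightarrow> real \<Rightarrow> 'a set" where
  "pos_ball H N s = {x\<in>H. 0 \<le> x \<and> N x \<le> s}"

definition demicontinuous_with ::
  "real \<Rightarrow> 'a::vector_lattice set \<Rightarrow> ('a \<Rightarrow> real) \<Rightarrow> bool" where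
  "demicontinuous_with r H N \<longleftrightarrow>
     (\<forall>P f. P \<subseteq> pos_ball H N 1 \<and> f \<in> H \<and> increases_to H P f \<longrightarrow> N f \<le> r)"

definition demicontinuous :: "'a::vector_lattice set \<Rightarrow> ('a \<Rightarrow> real) \<Rightarrow> bool" where
  "demicontinuous H N \<longleftrightarrow> (\<exists>r\<ge>1. demicontinuous_with r H N)"

definition semicontinuous_norm :: "'a::vector_lattice set \<Rightarrow> ('a \<Rightarrow> real) \<Rightarrow> bool" where
  "semicontinuous_norm H N \<longleftrightarrow> normed_lattice H N \<and> demicontinuous_with 1 H N"

definition semicontinuous_with ::
  "real \<Rightarrow> 'a::vector_lattice set \<Rightarrow> ('a \<Rightarrow> real) \<Rightarrow> bool" where
  "semicontinuous_with r H N \<longleftrightarrow>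
     (\<exists>M. semicontinuous_norm H M \<and> (\<forall>x\<in>H. N x \<le> M x \<and> M x \<le> r * N x))"

definition topologically_semicontinuous ::
  "'a::vector_lattice set \<Rightarrow> ('a \<Rightarrow> real) \<Rightarrow> bool" where
  "topologically_semicontinuous H N \<longleftrightarrow>
     (\<exists>M. semicontinuous_norm H M \<and> equivalent_norms H N M)"

definition monotonically_complete_with ::
  "real \<Rightarrow> 'a::vector_lattice set \<Rightarrow> ('a \<Rightarrow> real) \<Rightarrow> bool" where
  "monotonically_complete_with r H N \<longleftrightarrow>
     (\<forall>P. P \<subseteq> pos_ball H N 1 \<and> directed_up P \<longrightarrow> (\<exists>f. is_sup_in H P f \<and> N f \<le> r))"


subsection \<open>Embeddings and completions\<close>

text \<open>
  A vector lattice contained in another one up to identification is given by its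
  embedding: the universal completion \<open>F\<^sup>u\<close> is a type \<open>'u\<close> with \<open>\<iota> :: 'f \<Rightarrow> 'u\<close>,
  and the Lorentz completion of \<open>'f\<close> is a subset of \<open>'u\<close>.
\<close>

definition lattice_embedding :: "('a::vector_lattice \<Rightarrow> 'b::vector_lattice) \<Rightarrow> bool" where
  "lattice_embedding \<iota> \<longleftrightarrow> lattice_hom UNIV UNIV \<iota> \<and> inj \<iota>"

definition universal_completion :: "('f::vector_lattice \<Rightarrow> 'u::vector_lattice) \<Rightarrow> bool" where
  "universal_completion \<iota> \<longleftrightarrow>
     universally_complete (UNIV :: 'u set) \<and>
     lattice_embedding \<iota> \<and> order_dense_sublattice (range \<iota>) UNIV"

definition norm_completion ::
  "('f::vector_lattice \<Rightarrow> real) \<Rightarrow> ('f \<Rightarrow> 'c::vector_lattice) \<Rightarrow> ('c \<Rightarrow> real) \<Rightarrow> bool" where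
  "norm_completion N \<kappa> M \<longleftrightarrow>
     banach_lattice UNIV M \<and> lattice_embedding \<kappa> \<and> (\<forall>f. M (\<kappa> f) = N f) \<and>
     (\<forall>c. \<forall>e>0. \<exists>f. M (c - \<kappa> f) < e)"

definition isomorphic_order_dense_embedding ::
  "('f::vector_lattice \<Rightarrow> real) \<Rightarrow> ('f \<Rightarrow> 'g::vector_lattice) \<Rightarrow> ('g \<Rightarrow> real) \<Rightarrow> bool" where
  "isomorphic_order_dense_embedding N \<kappa> M \<longleftrightarrow>
     lattice_embedding \<kappa> \<and>
     (\<exists>c>0. \<exists>C>0. \<forall>f. c * N f \<le> M (\<kappa> f) \<and> M (\<kappa> f) \<le> C * N f) \<and>
     order_dense_sublattice (range \<kappa>) UNIV"

definition lorentz_ball ::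
  "('f::vector_lattice \<Rightarrow> real) \<Rightarrow> ('f \<Rightarrow> 'u::vector_lattice) \<Rightarrow> 'u set" where
  "lorentz_ball N \<iota> = order_adherence UNIV (\<iota> ` {f. N f \<le> 1})"

definition lorentz_space ::
  "('f::vector_lattice \<Rightarrow> real) \<Rightarrow> ('f \<Rightarrow> 'u::vector_lattice) \<Rightarrow> 'u set" where
  "lorentz_space N \<iota> = (\<Union>n::nat. (\<lambda>u. real n *\<^sub>R u) ` lorentz_ball N \<iota>)"

definition lorentz_norm ::
  "('f::vector_lattice \<Rightarrow> real) \<Rightarrow> ('f \<Rightarrow> 'u::vector_lattice) \<Rightarrow> 'u \<Rightarrow> real" where
  "lorentz_norm N \<iota> u =
     Inf {s. 0 < s \<and> (\<exists>P \<subseteq> pos_ball UNIV N s. increases_to UNIV (\<iota> ` P) \<bar>u\<bar>)}"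

definition order_continuous_extension ::
  "('f \<Rightarrow> 'u::vector_lattice) \<Rightarrow> 'u set \<Rightarrow> ('e \<Rightarrow> 'v::vector_lattice) \<Rightarrow> 'v set
     \<Rightarrow> ('f \<Rightarrow> 'e) \<Rightarrow> ('u \<Rightarrow> 'v) \<Rightarrow> bool" where
  "order_continuous_extension \<iota> H \<iota>' K T S \<longleftrightarrow>
     order_continuous H K S \<and> range \<iota> \<subseteq> H \<and> (\<forall>f. S (\<iota> f) = \<iota>' (T f))"

end

(*
  Write "approx s u" if |u| is the supremum in F^u of a directed set of positive elements of F of
  norm at most s.  Any directed family in F^u_+ can be replaced by the directed set of its
  minorants in F_+ without changing the supremum; this makes "approx" solid and additive and
  identifies the unit ball of the Lorentz completion with the order adherence of the unit ball
  of F.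

  The central point is that a norm bounded directed set in F_+ is order bounded in F^u: otherwise
  it would be infinite on some band, so that by demicontinuity all multiples of some g > 0 in F
  would be norm bounded.  This gives monotone completeness of F^L, hence its norm completeness,
  and it makes the formula w -> sup {T f | 0 <= f <= w} meaningful for extending T, both for (iv)
  and, with T the inclusion of F into F^u and w in G, for (v).

  The extended norm in (ii) is u -> inf {N f + r |v|_L : |u| <= |f| + |v|}.  For (iii) the norm
  completion of F embeds isometrically, for this norm, as an order dense sublattice of F^L, and
  for (vi) one takes the Lorentz norm of the equivalent semicontinuous norm.
*)
theory Submission
  imports Defs
begin

section \<open>Suprema in vector lattices\<close>

text \<open>The recurring device is truncation. If P increases to |u| in F^u and g in F satisfies
  |g| <= |u|, then the elements inf |g| p increase to |g|; they lie in F, and there demicontinuity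
  gives N g <= r s when P has norm at most s. The constants r come from this estimate: minorants of
  a directed set in the unit ball of F^L have norm at most r, whence r-monotone completeness.

  Two obstacles shape the statements. A truncation inf |v| p by an element v of F^u need not lie in
  F, so approximating sets are first sought anywhere in F^u and then replaced by their minorants.
  And the Lorentz norm is an infimum not known to be attained, so membership in a ball of radius s
  is used as "approx t for all t > s".

  In (ii) the weight r in front of |v|_L ensures that an element of F cannot be made smaller by
  covering part of it with some v outside F. The resulting norm lies between |.|_L and r |.|_L, so
  one factor r of its constant comes from this comparison and the other from the monotone
  completeness of F^L.\<close>

declare neg_inf_eq_sup [simp del] neg_sup_eq_inf [simp del]
  diff_inf_eq_sup [simp del] diff_sup_eq_inf [simp del]

section \<open>Identities and inequalities for sup, inf and absolute value\<close>

lemma sup_scaleR: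
  fixes x y :: "'a::vector_lattice"
  assumes "0 \<le> c"
  shows "c *\<^sub>R sup x y = sup (c *\<^sub>R x) (c *\<^sub>R y)"
proof (cases "c = 0")
  case False
  then have c: "0 < c" using assms by simp
  have "sup x y \<le> sup (c *\<^sub>R x) (c *\<^sub>R y) /\<^sub>R c"
    using c by (intro sup_least) (simp_all add: pos_le_divideR_eq)
  then have "c *\<^sub>R sup x y \<le> sup (c *\<^sub>R x) (c *\<^sub>R y)"
    using pos_le_divideR_eq[OF c] by blast
  moreover have "sup (c *\<^sub>R x) (c *\<^sub>R y) \<le> c *\<^sub>R sup x y"
    using assms by (intro sup_least scaleR_left_mono) simp_all
  ultimately show ?thesis by (rule antisym)
qed simp

lemma abs_scaleR_vector_lattice:
  fixes x :: "'a::vector_lattice"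
  shows "\<bar>c *\<^sub>R x\<bar> = \<bar>c\<bar> *\<^sub>R \<bar>x\<bar>"
proof (cases "0 \<le> c")
  case True
  then show ?thesis by (simp add: abs_lattice[of x] abs_lattice[of "c *\<^sub>R x"] sup_scaleR)
next
  case False
  then have "0 \<le> - c" by simp
  from sup_scaleR[OF this, of x "- x"] False show ?thesis
    by (simp add: abs_lattice[of x] abs_lattice[of "c *\<^sub>R x"] sup_commute)
qed

text \<open>Each of \<open>a\<close> and \<open>b\<close> lies below \<open>sup c d\<close> plus the
  error, so their supremum does, and the estimate is symmetric. It makes \<open>sup\<close>
  Lipschitz for every solid norm, which is how the lattice operations pass to the norm
  completion.\<close>

lemma abs_sup_diff_le:
  fixes a b c d :: "'a::vector_lattice"
  shows "\<bar>sup a b - sup c d\<bar> \<le> \<bar>a - c\<bar> + \<bar>b - d\<bar>"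
proof -
  have le: "sup a b \<le> sup c d + (\<bar>a - c\<bar> + \<bar>b - d\<bar>)" for a b c d :: 'a
  proof (rule sup_least)
    have "a - c \<le> \<bar>a - c\<bar> + \<bar>b - d\<bar>" "b - d \<le> \<bar>a - c\<bar> + \<bar>b - d\<bar>"
      using add_mono[OF abs_ge_self[of "a - c"] abs_ge_zero[of "b - d"]]
        add_mono[OF abs_ge_zero[of "a - c"] abs_ge_self[of "b - d"]] by simp_all
    then have "c + (a - c) \<le> sup c d + (\<bar>a - c\<bar> + \<bar>b - d\<bar>)"
      "d + (b - d) \<le> sup c d + (\<bar>a - c\<bar> + \<bar>b - d\<bar>)"
      by (simp_all only: add_mono[OF sup_ge1] add_mono[OF sup_ge2])
    then show "a \<le> sup c d + (\<bar>a - c\<bar> + \<bar>b - d\<bar>)" "b \<le> sup c d + (\<bar>a - c\<bar> + \<bar>b - d\<bar>)"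
      by simp_all
  qed
  show ?thesis
  proof (rule abs_leI)
    show "sup a b - sup c d \<le> \<bar>a - c\<bar> + \<bar>b - d\<bar>"
      using le[of a b c d] by (simp only: diff_le_eq add.commute)
    have "sup c d - sup a b \<le> \<bar>a - c\<bar> + \<bar>b - d\<bar>"
      using le[of c d a b] by (simp only: diff_le_eq add.commute abs_minus_commute)
    then show "- (sup a b - sup c d) \<le> \<bar>a - c\<bar> + \<bar>b - d\<bar>"
      by (simp only: minus_diff_eq)
  qed
qed

lemma inf_eq_add_diff_sup:
  fixes x y :: "'a::vector_lattice"
  shows "inf x y = x + y - sup x y"
  using add_eq_inf_sup[of x y] by (simp only: add_diff_cancel_left')

text \<open>The difference \<open>inf (x + y) z - inf x z\<close> is below \<open>y\<close> by
  translation and below \<open>z\<close> because \<open>inf x z\<close> is nonnegative. This makes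
  disjointness stable under sums.\<close>

lemma inf_add_le:
  fixes x y z :: "'a::vector_lattice"
  assumes "0 \<le> x" "0 \<le> y" "0 \<le> z"
  shows "inf (x + y) z \<le> inf x z + inf y z"
proof -
  have "inf (x + y) z - inf x z \<le> y"
  proof -
    have "inf (x + y) z \<le> inf (x + y) (z + y)"
      by (rule inf_mono) (use assms in simp_all)
    also have "\<dots> = inf x z + y" by (simp only: add_inf_distrib_right)
    finally show ?thesis by (simp only: diff_le_eq add.commute)
  qed
  moreover have "inf (x + y) z - inf x z \<le> z"
  proof -
    have "inf (x + y) z - inf x z \<le> inf (x + y) z - 0"
      by (rule diff_left_mono) (use assms in simp)
    then show ?thesis by (simp add: le_infI2)
  qed
  ultimately have "inf (x + y) z - inf x z \<le> inf y z" by simp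
  then show ?thesis by (simp only: diff_le_eq add.commute)
qed

lemma inf_eq_0_mono:
  fixes x y :: "'a::vector_lattice"
  assumes "inf x y = 0" "0 \<le> x'" "x' \<le> x" "0 \<le> y'" "y' \<le> y"
  shows "inf x' y' = 0"
  by (metis assms antisym inf_mono le_inf_iff)

lemma sup_eq_add_of_disjoint:
  fixes x y :: "'a::vector_lattice"
  assumes "inf x y = 0"
  shows "sup x y = x + y"
  using add_eq_inf_sup[of x y] assms by simp

text \<open>The modulus is both the sum and the supremum of the two parts, and the sum of two
  elements is their supremum plus their infimum.\<close>

lemma inf_pprt_eq_0:
  fixes x :: "'a::vector_lattice"
  shows "inf (pprt x) (pprt (- x)) = 0"
proof -
  have "sup (pprt x) (pprt (- x)) = sup \<bar>x\<bar> 0"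
    by (simp add: pprt_def abs_lattice ac_simps)
  also have "\<dots> = \<bar>x\<bar>" by (simp add: sup_absorb1)
  also have "\<dots> = pprt x + pprt (- x)" by (simp add: abs_prts pprt_neg)
  finally show ?thesis using add_eq_inf_sup[of "pprt x" "pprt (- x)"] by simp
qed

section \<open>Sublattices and suprema relative to them\<close>

lemma sublatticeD:
  assumes "sublattice H" "x \<in> H" "y \<in> H"
  shows "0 \<in> H" "x + y \<in> H" "x - y \<in> H" "- x \<in> H" "c *\<^sub>R x \<in> H" "sup x y \<in> H" "inf x y \<in> H"
    "\<bar>x\<bar> \<in> H" "pprt x \<in> H"
proof -
  have H: "subspace H" and l: "\<And>x y. x \<in> H \<Longrightarrow> y \<in> H \<Longrightarrow> sup x y \<in> H \<and> inf x y \<in> H"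
    using assms(1) unfolding sublattice_def by auto
  show 0: "0 \<in> H" by (rule subspace_0[OF H])
  show m: "- x \<in> H" by (rule subspace_neg[OF H assms(2)])
  show "x + y \<in> H" "x - y \<in> H" "c *\<^sub>R x \<in> H"
    using H assms(2,3) by (auto intro: subspace_add subspace_diff subspace_scale)
  show "sup x y \<in> H" "inf x y \<in> H" using l assms(2,3) by blast+
  show "\<bar>x\<bar> \<in> H" "pprt x \<in> H"
    unfolding abs_lattice pprt_def using l[OF assms(2) m] l[OF assms(2) 0] by blast+
qed

lemma sublattice_UNIV: "sublattice UNIV"
  unfolding sublattice_def by simp

lemma is_sup_inI:
  assumes "f \<in> H" "\<And>p. p \<in> P \<Longrightarrow> p \<le> f" "\<And>h. h \<in> H \<Longrightarrow> (\<And>p. p \<in> P \<Longrightarrow> p \<le> h) \<Longrightarrow> f \<le> h"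
  shows "is_sup_in H P f"
  using assms unfolding is_sup_in_def by blast

lemma is_sup_inD:
  assumes "is_sup_in H P f"
  shows "f \<in> H" "\<And>p. p \<in> P \<Longrightarrow> p \<le> f" "\<And>h. h \<in> H \<Longrightarrow> (\<And>p. p \<in> P \<Longrightarrow> p \<le> h) \<Longrightarrow> f \<le> h"
  using assms unfolding is_sup_in_def by blast+

lemma is_sup_in_unique: "is_sup_in H P f \<Longrightarrow> is_sup_in H P g \<Longrightarrow> f = g"
  unfolding is_sup_in_def by (blast intro: antisym)

text \<open>The identity \<open>x + p = sup x p + inf x p\<close> turns an upper bound
  \<open>h\<close> of the truncated set into the upper bound \<open>h + sup x f - x\<close> of
  \<open>P\<close>, which therefore dominates \<open>f\<close>. This is the infinite distributive
  law for suprema that exist in \<open>H\<close>.\<close>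

lemma is_sup_in_inf:
  fixes f x :: "'a::vector_lattice"
  assumes "sublattice H" "P \<subseteq> H" "is_sup_in H P f" "x \<in> H"
  shows "is_sup_in H (inf x ` P) (inf x f)"
proof -
  have f: "f \<in> H" "\<And>p. p \<in> P \<Longrightarrow> p \<le> f" "\<And>h. h \<in> H \<Longrightarrow> (\<And>p. p \<in> P \<Longrightarrow> p \<le> h) \<Longrightarrow> f \<le> h"
    using assms(3) unfolding is_sup_in_def by auto
  have "inf x f \<le> h" if h: "h \<in> H" "\<And>p. p \<in> P \<Longrightarrow> inf x p \<le> h" for h
  proof -
    have "f \<le> h + sup x f - x"
    proof (rule f(3))
      show "h + sup x f - x \<in> H" using assms h f by (simp add: sublatticeD)
      fix p assume p: "p \<in> P"
      have "x + p = sup x p + inf x p" by (rule add_eq_inf_sup)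
      also have "\<dots> \<le> sup x f + h"
        using h(2)[OF p] f(2)[OF p] by (intro add_mono sup_mono) auto
      finally show "p \<le> h + sup x f - x" by (simp only: le_diff_eq add.commute)
    qed
    then have "x + f - sup x f \<le> h" by (simp only: le_diff_eq diff_le_eq add.commute)
    then show ?thesis by (simp only: inf_eq_add_diff_sup)
  qed
  then show ?thesis
    unfolding is_sup_in_def using assms f by (auto simp: sublatticeD intro: le_infI2)
qed

text \<open>The two suprema are taken one after the other: for fixed \<open>q\<close> every
  \<open>p\<close> is below \<open>h - q\<close>, hence \<open>f\<close> is, and then every
  \<open>q\<close> is below \<open>h - f\<close>.\<close>

lemma is_sup_in_add:
  fixes f g :: "'a::vector_lattice"
  assumes "sublattice H" "P \<subseteq> H" "Q \<subseteq> H" "is_sup_in H P f" "is_sup_in H Q g"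
  shows "is_sup_in H {p + q |p q. p \<in> P \<and> q \<in> Q} (f + g)"
proof -
  have f: "f \<in> H" "\<And>p. p \<in> P \<Longrightarrow> p \<le> f" "\<And>h. h \<in> H \<Longrightarrow> (\<And>p. p \<in> P \<Longrightarrow> p \<le> h) \<Longrightarrow> f \<le> h"
    using assms(4) unfolding is_sup_in_def by auto
  have g: "g \<in> H" "\<And>p. p \<in> Q \<Longrightarrow> p \<le> g" "\<And>h. h \<in> H \<Longrightarrow> (\<And>p. p \<in> Q \<Longrightarrow> p \<le> h) \<Longrightarrow> g \<le> h"
    using assms(5) unfolding is_sup_in_def by auto
  have least: "f + g \<le> h" if h: "h \<in> H" "\<And>x. x \<in> {p + q |p q. p \<in> P \<and> q \<in> Q} \<Longrightarrow> x \<le> h" for h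
  proof -
    have h': "p + q \<le> h" if "p \<in> P" "q \<in> Q" for p q using h(2) that by blast
    have "g \<le> h - f"
    proof (rule g(3))
      show "h - f \<in> H" using assms h f by (simp add: sublatticeD)
      fix q assume q: "q \<in> Q"
      have "f \<le> h - q"
        using assms h(1) h' q by (intro f(3)) (auto simp: sublatticeD le_diff_eq)
      then show "q \<le> h - f" by (simp add: le_diff_eq add.commute)
    qed
    then show ?thesis by (simp add: le_diff_eq add.commute)
  qed
  have m: "f + g \<in> H" using assms(1) f(1) g(1) by (rule sublatticeD)
  have ub: "x \<le> f + g" if "x \<in> {p + q |p q. p \<in> P \<and> q \<in> Q}" for x
    using that f(2) g(2) by (auto intro: add_mono)
  show ?thesis using m ub least by (rule is_sup_inI)
qed

lemma is_sup_in_inf_inf: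
  fixes f g :: "'a::vector_lattice"
  assumes "sublattice H" "P \<subseteq> H" "Q \<subseteq> H" "is_sup_in H P f" "is_sup_in H Q g"
  shows "is_sup_in H {inf p q |p q. p \<in> P \<and> q \<in> Q} (inf f g)"
proof -
  have f: "f \<in> H" "\<And>p. p \<in> P \<Longrightarrow> p \<le> f" and g: "g \<in> H" "\<And>p. p \<in> Q \<Longrightarrow> p \<le> g"
    using assms(4,5) unfolding is_sup_in_def by auto
  have least: "inf f g \<le> h" if h: "h \<in> H" "\<And>x. x \<in> {inf p q |p q. p \<in> P \<and> q \<in> Q} \<Longrightarrow> x \<le> h" for h
  proof -
    have h': "inf p q \<le> h" if "p \<in> P" "q \<in> Q" for p q using h(2) that by blast
    have "inf f q \<le> h" if q: "q \<in> Q" for q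
      using is_sup_in_inf[OF assms(1,2,4), of q] h(1) h' q assms(3)
      unfolding is_sup_in_def by (auto simp: inf_commute)
    then show ?thesis
      using is_sup_in_inf[OF assms(1,3,5) f(1)] h(1) unfolding is_sup_in_def by auto
  qed
  have m: "inf f g \<in> H" using assms(1) f(1) g(1) by (rule sublatticeD)
  have ub: "x \<le> inf f g" if "x \<in> {inf p q |p q. p \<in> P \<and> q \<in> Q}" for x
    using that f(2) g(2) by (auto intro: le_infI1 le_infI2)
  show ?thesis using m ub least by (rule is_sup_inI)
qed

lemma is_sup_in_plus:
  fixes f x :: "'a::vector_lattice"
  assumes "sublattice H" "P \<subseteq> H" "is_sup_in H P f" "x \<in> H"
  shows "is_sup_in H ((+) x ` P) (x + f)"
proof -
  have "is_sup_in H {x} x" using assms(4) unfolding is_sup_in_def by auto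
  from is_sup_in_add[OF assms(1) _ assms(2) this assms(3)] assms(4)
  show ?thesis by (simp add: image_def Bex_def conj_commute)
qed

lemma is_sup_in_scaleR:
  fixes f :: "'a::vector_lattice"
  assumes "sublattice H" "is_sup_in H P f" "0 < c"
  shows "is_sup_in H ((*\<^sub>R) c ` P) (c *\<^sub>R f)"
proof -
  have f: "f \<in> H" "\<And>p. p \<in> P \<Longrightarrow> p \<le> f" "\<And>h. h \<in> H \<Longrightarrow> (\<And>p. p \<in> P \<Longrightarrow> p \<le> h) \<Longrightarrow> f \<le> h"
    using assms(2) unfolding is_sup_in_def by auto
  have "c *\<^sub>R f \<le> h" if h: "h \<in> H" "\<And>p. p \<in> P \<Longrightarrow> c *\<^sub>R p \<le> h" for h
  proof -
    have "f \<le> h /\<^sub>R c"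
      using assms h by (intro f(3)) (auto simp: sublatticeD pos_le_divideR_eq)
    then show ?thesis using assms(3) by (simp add: pos_le_divideR_eq)
  qed
  then show ?thesis
    unfolding is_sup_in_def using assms(1,3) f by (auto simp: sublatticeD intro: scaleR_left_mono)
qed

lemma is_sup_in_reflect:
  fixes f x :: "'a::vector_lattice"
  assumes "sublattice H" "x \<in> H" "P \<subseteq> H" "is_inf_in H P f"
  shows "is_sup_in H ((-) x ` P) (x - f)"
proof -
  have f: "f \<in> H" "\<And>p. p \<in> P \<Longrightarrow> f \<le> p" "\<And>h. h \<in> H \<Longrightarrow> (\<And>p. p \<in> P \<Longrightarrow> h \<le> p) \<Longrightarrow> h \<le> f"
    using assms(4) unfolding is_inf_in_def by auto
  have "x - f \<le> h" if h: "h \<in> H" "\<And>p. p \<in> P \<Longrightarrow> x - p \<le> h" for h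
  proof -
    have "x - h \<le> f"
      using assms h by (intro f(3)) (auto simp: sublatticeD diff_le_eq add.commute)
    then show ?thesis by (simp add: diff_le_eq add.commute)
  qed
  then show ?thesis
    unfolding is_sup_in_def using assms(1,2) f by (auto simp: sublatticeD intro: diff_left_mono)
qed

lemma decreases_to_zero_diff:
  fixes f :: "'a::vector_lattice"
  assumes "sublattice H" "increases_to H P f"
  shows "decreases_to H ((-) f ` P) 0"
proof -
  have P: "P \<subseteq> H" "directed_up P" and f: "f \<in> H" "\<And>p. p \<in> P \<Longrightarrow> p \<le> f"
    "\<And>h. h \<in> H \<Longrightarrow> (\<And>p. p \<in> P \<Longrightarrow> p \<le> h) \<Longrightarrow> f \<le> h"
    using assms(2) unfolding increases_to_def is_sup_in_def by auto
  have "h \<le> 0" if h: "h \<in> H" "\<And>p. p \<in> P \<Longrightarrow> h \<le> f - p" for h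
  proof -
    have "f \<le> f - h"
      using assms(1) f h by (intro f(3)) (auto simp: sublatticeD le_diff_eq add.commute)
    then show ?thesis by simp
  qed
  moreover have "directed_down ((-) f ` P)"
    using P(2) unfolding directed_up_def directed_down_def
    by simp
  ultimately show ?thesis
    unfolding decreases_to_def is_inf_in_def using assms(1) P f by (auto simp: sublatticeD)
qed

section \<open>Increasing sets under the vector lattice operations\<close>

lemma directed_up_add:
  fixes P Q :: "'a::vector_lattice set"
  assumes "directed_up P" "directed_up Q"
  shows "directed_up {p + q |p q. p \<in> P \<and> q \<in> Q}"
  unfolding directed_up_def
proof (intro conjI ballI)
  show "{p + q |p q. p \<in> P \<and> q \<in> Q} \<noteq> {}"
    using assms unfolding directed_up_def by blast
  fix x y assume "x \<in> {p + q |p q. p \<in> P \<and> q \<in> Q}" "y \<in> {p + q |p q. p \<in> P \<and> q \<in> Q}"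
  then obtain p q p' q' where x: "x = p + q" "y = p' + q'" "p \<in> P" "p' \<in> P" "q \<in> Q" "q' \<in> Q"
    by blast
  obtain p'' q'' where "p'' \<in> P" "p \<le> p''" "p' \<le> p''" "q'' \<in> Q" "q \<le> q''" "q' \<le> q''"
    using assms x unfolding directed_up_def by meson
  then show "\<exists>z\<in>{p + q |p q. p \<in> P \<and> q \<in> Q}. x \<le> z \<and> y \<le> z"
    unfolding x by (blast intro: add_mono)
qed

lemma directed_up_inf:
  fixes P Q :: "'a::lattice set"
  assumes "directed_up P" "directed_up Q"
  shows "directed_up {inf p q |p q. p \<in> P \<and> q \<in> Q}"
  unfolding directed_up_def
proof (intro conjI ballI)
  show "{inf p q |p q. p \<in> P \<and> q \<in> Q} \<noteq> {}"
    using assms unfolding directed_up_def by blast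
  fix x y assume "x \<in> {inf p q |p q. p \<in> P \<and> q \<in> Q}" "y \<in> {inf p q |p q. p \<in> P \<and> q \<in> Q}"
  then obtain p q p' q' where x: "x = inf p q" "y = inf p' q'" "p \<in> P" "p' \<in> P" "q \<in> Q" "q' \<in> Q"
    by blast
  obtain p'' q'' where "p'' \<in> P" "p \<le> p''" "p' \<le> p''" "q'' \<in> Q" "q \<le> q''" "q' \<le> q''"
    using assms x unfolding directed_up_def by meson
  then show "\<exists>z\<in>{inf p q |p q. p \<in> P \<and> q \<in> Q}. x \<le> z \<and> y \<le> z"
    unfolding x by (blast intro: inf_mono)
qed

lemma directed_up_image:
  assumes "directed_up P" "\<And>x y. x \<in> P \<Longrightarrow> y \<in> P \<Longrightarrow> x \<le> y \<Longrightarrow> T x \<le> T y"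
  shows "directed_up (T ` P)"
  unfolding directed_up_def
proof (intro conjI ballI)
  show "T ` P \<noteq> {}" using assms(1) unfolding directed_up_def by blast
  fix a b assume "a \<in> T ` P" "b \<in> T ` P"
  then obtain x y where xy: "a = T x" "b = T y" "x \<in> P" "y \<in> P" by blast
  then obtain z where "z \<in> P" "x \<le> z" "y \<le> z"
    using assms(1) unfolding directed_up_def by blast
  then show "\<exists>c\<in>T ` P. a \<le> c \<and> b \<le> c" using assms(2) xy by blast
qed

lemma increases_to_inf_const:
  fixes f :: "'a::vector_lattice"
  assumes "sublattice H" "increases_to H P f" "x \<in> H"
  shows "increases_to H (inf x ` P) (inf x f)"
  using assms is_sup_in_inf[OF assms(1) _ _ assms(3)]
  unfolding increases_to_def by (auto simp: sublatticeD intro!: directed_up_image intro: le_infI2)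

lemma increases_to_add:
  fixes f g :: "'a::vector_lattice"
  assumes "sublattice H" "increases_to H P f" "increases_to H Q g"
  shows "increases_to H {p + q |p q. p \<in> P \<and> q \<in> Q} (f + g)"
  using assms is_sup_in_add[OF assms(1)] directed_up_add
  unfolding increases_to_def by (auto simp: sublatticeD subset_iff)

lemma increases_to_inf:
  fixes f g :: "'a::vector_lattice"
  assumes "sublattice H" "increases_to H P f" "increases_to H Q g"
  shows "increases_to H {inf p q |p q. p \<in> P \<and> q \<in> Q} (inf f g)"
  using assms is_sup_in_inf_inf[OF assms(1)] directed_up_inf
  unfolding increases_to_def by (auto simp: sublatticeD subset_iff)

lemma increases_to_scaleR:
  fixes f :: "'a::vector_lattice"
  assumes "sublattice H" "increases_to H P f" "0 < c"
  shows "increases_to H ((*\<^sub>R) c ` P) (c *\<^sub>R f)"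
  using assms is_sup_in_scaleR[OF assms(1) _ assms(3)]
  unfolding increases_to_def
  by (auto simp: sublatticeD intro!: directed_up_image scaleR_left_mono)

lemma increases_to_singleton: "x \<in> H \<Longrightarrow> increases_to H {x} x"
  unfolding increases_to_def directed_up_def is_sup_in_def by auto

section \<open>Order ideals (\<open>solid_subspace\<close>), the Archimedean property and order
  density\<close>

definition solid_subspace :: "'a::vector_lattice set \<Rightarrow> bool" where
  "solid_subspace H \<longleftrightarrow> subspace H \<and> (\<forall>x\<in>H. \<forall>y. \<bar>y\<bar> \<le> \<bar>x\<bar> \<longrightarrow> y \<in> H)"

lemma sublattice_solid_subspace:
  assumes "solid_subspace H"
  shows "sublattice H"
proof -
  have H: "subspace H" and sol: "\<And>x y. x \<in> H \<Longrightarrow> \<bar>y\<bar> \<le> \<bar>x\<bar> \<Longrightarrow> y \<in> H"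
    using assms unfolding solid_subspace_def by auto
  have pos: "\<bar>x\<bar> \<in> H" if "x \<in> H" for x using sol[OF that, of "\<bar>x\<bar>"] by simp
  have s: "sup x y \<in> H" if xy: "x \<in> H" "y \<in> H" for x y
  proof (rule sol)
    show "\<bar>x\<bar> + \<bar>y\<bar> \<in> H" using pos[OF xy(1)] pos[OF xy(2)] H by (rule_tac subspace_add)
    show "\<bar>sup x y\<bar> \<le> \<bar>\<bar>x\<bar> + \<bar>y\<bar>\<bar>"
      using abs_sup_diff_le[of x y 0 0] by simp
  qed
  moreover have "inf x y \<in> H" if "x \<in> H" "y \<in> H" for x y
    unfolding inf_eq_add_diff_sup using s[OF that] that H
    by (intro subspace_add subspace_diff)
  ultimately show ?thesis using H unfolding sublattice_def by blast
qed

definition archimedean_on :: "'a::vector_lattice set \<Rightarrow> bool" where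
  "archimedean_on H \<longleftrightarrow>
     (\<forall>x\<in>H. \<forall>y\<in>H. 0 \<le> x \<longrightarrow> (\<forall>n::nat. real n *\<^sub>R x \<le> y) \<longrightarrow> x = 0)"

lemma archimedean_on_subset: "archimedean_on H \<Longrightarrow> K \<subseteq> H \<Longrightarrow> archimedean_on K"
  unfolding archimedean_on_def by blast

text \<open>Adding \<open>x\<close> maps the set of multiples of \<open>x\<close> into itself, so
  their supremum \<open>s\<close> satisfies \<open>s + x \<le> s\<close>.\<close>

lemma archimedean_on_order_complete:
  assumes "order_complete (UNIV :: 'a::vector_lattice set)"
  shows "archimedean_on (UNIV :: 'a set)"
  unfolding archimedean_on_def
proof (intro ballI impI)
  fix x y :: 'a assume x: "0 \<le> x" and y: "\<forall>n::nat. real n *\<^sub>R x \<le> y"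
  have "\<exists>h\<in>UNIV. \<forall>p\<in>range (\<lambda>n::nat. real n *\<^sub>R x). p \<le> h" using y by blast
  moreover have "range (\<lambda>n::nat. real n *\<^sub>R x) \<noteq> {}" by blast
  ultimately obtain s where s: "is_sup_in UNIV (range (\<lambda>n::nat. real n *\<^sub>R x)) s"
    using assms unfolding order_complete_def by blast
  have "real n *\<^sub>R x \<le> s - x" for n :: nat
  proof -
    have "real (Suc n) *\<^sub>R x \<le> s" using s unfolding is_sup_in_def by blast
    then show ?thesis by (simp add: le_diff_eq scaleR_add_left add.commute)
  qed
  then have "s \<le> s - x" using s unfolding is_sup_in_def by blast
  then show "x = 0" using x by (simp add: antisym)
qed

text \<open>An upper bound \<open>h\<close> not above \<open>w\<close> leaves a gap
  \<open>d = w - inf h w > 0\<close>, and order density puts some \<open>e > 0\<close> of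
  \<open>E\<close> below \<open>d\<close>. If \<open>n e\<close> is a minorant of \<open>w\<close>,
  it is below \<open>inf h w\<close>, so \<open>(n + 1) e\<close> is below \<open>w\<close>. Thus
  all multiples of \<open>e\<close> are below \<open>w\<close>, against the Archimedean
  property.\<close>

lemma order_dense_is_sup_in:
  fixes w :: "'a::vector_lattice"
  assumes H: "sublattice H" and "archimedean_on H" and E: "order_dense_sublattice E H"
    and w: "w \<in> H" "0 \<le> w"
  shows "is_sup_in H {e \<in> E. 0 \<le> e \<and> e \<le> w} w"
  unfolding is_sup_in_def
proof (intro conjI ballI impI)
  fix h assume h: "h \<in> H" and ub: "\<forall>p\<in>{e \<in> E. 0 \<le> e \<and> e \<le> w}. p \<le> h"
  define d where "d = w - inf h w"
  have d: "d \<in> H" "0 \<le> d" using H h w by (simp_all add: d_def sublatticeD)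
  have "d = 0"
  proof (rule ccontr)
    assume "d \<noteq> 0"
    then obtain e where e: "e \<in> E" "0 < e" "e \<le> d"
      using E d unfolding order_dense_sublattice_def by (metis order_le_less)
    have sE: "sublattice E" "E \<subseteq> H" using E unfolding order_dense_sublattice_def by auto
    have "real n *\<^sub>R e \<le> w" for n :: nat
    proof (induction n)
      case (Suc n)
      have "real n *\<^sub>R e \<in> E" using sE(1) e(1) by (simp add: sublatticeD)
      moreover have "0 \<le> real n *\<^sub>R e" using e(2) by (simp add: scaleR_nonneg_nonneg)
      ultimately have "real n *\<^sub>R e \<le> inf h w" using ub Suc by auto
      then have "real n *\<^sub>R e + e \<le> inf h w + d" using e(3) by (rule add_mono)
      then show ?case by (simp add: d_def scaleR_add_left add.commute)
    qed (use w in simp)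
    moreover have "e \<in> H" "0 \<le> e" using e sE(2) by auto
    ultimately have "e = 0" using assms(2) w(1) unfolding archimedean_on_def by blast
    then show False using e(2) by simp
  qed
  then show "w \<le> h" unfolding d_def by (metis eq_iff_diff_eq_0 inf.cobounded1)
qed (use w in auto)

section \<open>Lattice homomorphisms and order continuity\<close>

lemma linear_onD:
  assumes "linear_on H K T" "x \<in> H"
  shows "T x \<in> K" "y \<in> H \<Longrightarrow> T (x + y) = T x + T y" "T (c *\<^sub>R x) = c *\<^sub>R T x"
  using assms unfolding linear_on_def by auto

lemma linear_on_diff:
  assumes "linear_on H K T" "sublattice H" "x \<in> H" "y \<in> H"
  shows "T (x - y) = T x - T y"
proof -
  have "(- 1) *\<^sub>R y \<in> H" using sublatticeD(5)[OF assms(2,4,4)] .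
  then show ?thesis
    using linear_onD(2)[OF assms(1,3)] linear_onD(3)[OF assms(1,4), of "- 1"] by fastforce
qed

lemma lattice_homD:
  assumes "lattice_hom H K T" "x \<in> H" "y \<in> H"
  shows "T x \<in> K" "T (x + y) = T x + T y" "T (c *\<^sub>R x) = c *\<^sub>R T x"
    "T (sup x y) = sup (T x) (T y)" "T (inf x y) = inf (T x) (T y)"
  using assms linear_onD unfolding lattice_hom_def by blast+

lemma lattice_hom_mono:
  assumes "lattice_hom H K T" "x \<in> H" "y \<in> H" "x \<le> y"
  shows "T x \<le> T y"
  using lattice_homD(5)[OF assms(1-3)] assms(4) by (simp add: inf_absorb1 le_iff_inf)

lemma lattice_hom_diff:
  assumes "lattice_hom H K T" "sublattice H" "x \<in> H" "y \<in> H"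
  shows "T (x - y) = T x - T y"
  using assms linear_on_diff unfolding lattice_hom_def by blast

lemma lattice_hom_0:
  assumes "lattice_hom H K T" "sublattice H" "x \<in> H"
  shows "T 0 = 0"
  using lattice_hom_diff[OF assms(1,2,3,3)] by simp

lemma lattice_hom_abs:
  assumes "lattice_hom H K T" "sublattice H" "x \<in> H"
  shows "T \<bar>x\<bar> = \<bar>T x\<bar>"
proof -
  have m: "- x \<in> H" using assms by (simp add: sublatticeD)
  have "T (- x) = - T x" using lattice_homD(3)[OF assms(1,3,3), of "- 1"] by simp
  then show ?thesis using lattice_homD(4)[OF assms(1,3) m] by (simp add: abs_lattice)
qed

lemma lattice_hom_injI:
  assumes "lattice_hom UNIV K T" "\<And>x. 0 < x \<Longrightarrow> T x \<noteq> 0"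
  shows "inj T"
proof (rule injI)
  fix x y assume "T x = T y"
  then have "T \<bar>x - y\<bar> = 0"
    using assms(1) by (simp add: lattice_hom_abs[OF _ sublattice_UNIV] lattice_hom_diff[OF _ sublattice_UNIV])
  then have "\<not> 0 < \<bar>x - y\<bar>" using assms(2) by blast
  then show "x = y" by simp
qed

lemma lattice_embedding_le_iff:
  assumes "lattice_embedding \<iota>"
  shows "\<iota> x \<le> \<iota> y \<longleftrightarrow> x \<le> y"
proof -
  have h: "lattice_hom UNIV UNIV \<iota>" and i: "inj \<iota>"
    using assms unfolding lattice_embedding_def by auto
  have "\<iota> x \<le> \<iota> y \<longleftrightarrow> \<iota> (inf x y) = \<iota> x"
    using lattice_homD(5)[OF h] by (simp add: le_iff_inf)
  then show ?thesis using i by (simp add: inj_eq le_iff_inf)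
qed

lemma lattice_embeddingD:
  assumes "lattice_embedding \<iota>"
  shows "\<iota> (x + y) = \<iota> x + \<iota> y" "\<iota> (x - y) = \<iota> x - \<iota> y" "\<iota> (c *\<^sub>R x) = c *\<^sub>R \<iota> x"
    "\<iota> (sup x y) = sup (\<iota> x) (\<iota> y)" "\<iota> (inf x y) = inf (\<iota> x) (\<iota> y)" "\<iota> 0 = 0" "\<iota> \<bar>x\<bar> = \<bar>\<iota> x\<bar>"
    "0 \<le> \<iota> x \<longleftrightarrow> 0 \<le> x" "0 < \<iota> x \<longleftrightarrow> 0 < x"
proof -
  have h: "lattice_hom UNIV UNIV \<iota>" and i: "inj \<iota>"
    using assms unfolding lattice_embedding_def by auto
  show "\<iota> (x + y) = \<iota> x + \<iota> y" "\<iota> (c *\<^sub>R x) = c *\<^sub>R \<iota> x"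
    "\<iota> (sup x y) = sup (\<iota> x) (\<iota> y)" "\<iota> (inf x y) = inf (\<iota> x) (\<iota> y)"
    using lattice_homD[OF h] by simp_all
  show "\<iota> (x - y) = \<iota> x - \<iota> y" using lattice_hom_diff[OF h sublattice_UNIV] by simp
  show 0: "\<iota> 0 = 0" using lattice_hom_0[OF h sublattice_UNIV] by simp
  show "\<iota> \<bar>x\<bar> = \<bar>\<iota> x\<bar>" using lattice_hom_abs[OF h sublattice_UNIV] by simp
  show "0 \<le> \<iota> x \<longleftrightarrow> 0 \<le> x" "0 < \<iota> x \<longleftrightarrow> 0 < x"
    using lattice_embedding_le_iff[OF assms, of 0 x] lattice_embedding_le_iff[OF assms, of x 0] 0
    by (simp_all add: less_le_not_le)
qed

lemma directed_up_lattice_embedding_iff: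
  assumes "lattice_embedding \<iota>"
  shows "directed_up (\<iota> ` P) \<longleftrightarrow> directed_up P"
  unfolding directed_up_def by (simp add: lattice_embedding_le_iff[OF assms])

text \<open>If an upper bound \<open>h\<close> of the image failed to dominate
  \<open>\<kappa> f\<close>, the gap \<open>\<kappa> f - inf h (\<kappa> f)\<close> would dominate
  some \<open>\<kappa> e > 0\<close>, and \<open>f - e\<close> would be an upper bound of
  \<open>P\<close> in the source.\<close>

lemma increases_to_lattice_embedding:
  assumes \<kappa>: "lattice_embedding \<kappa>" and H: "sublattice H"
    and dense: "order_dense_sublattice (range \<kappa>) H" and P: "increases_to UNIV P f"
  shows "increases_to H (\<kappa> ` P) (\<kappa> f)"
proof -
  have f: "\<And>p. p \<in> P \<Longrightarrow> p \<le> f" "\<And>h. (\<And>p. p \<in> P \<Longrightarrow> p \<le> h) \<Longrightarrow> f \<le> h"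
    using P unfolding increases_to_def is_sup_in_def by auto
  have \<kappa>H: "\<kappa> x \<in> H" for x using dense unfolding order_dense_sublattice_def by auto
  have "\<kappa> f \<le> h" if h: "h \<in> H" "\<And>p. p \<in> P \<Longrightarrow> \<kappa> p \<le> h" for h
  proof (rule ccontr)
    define d where "d = \<kappa> f - inf h (\<kappa> f)"
    assume "\<not> \<kappa> f \<le> h"
    then have "d \<noteq> 0" unfolding d_def by (metis eq_iff_diff_eq_0 inf.cobounded1)
    moreover have "0 \<le> d" "d \<in> H" using H h(1) \<kappa>H by (simp_all add: d_def sublatticeD)
    ultimately obtain e where e: "0 < \<kappa> e" "\<kappa> e \<le> d"
      using dense unfolding order_dense_sublattice_def by (metis order_le_less imageE)
    have "f \<le> f - e"
    proof (rule f(2))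
      fix p assume p: "p \<in> P"
      have "\<kappa> p \<le> inf h (\<kappa> f)" using h(2)[OF p] f(1)[OF p] by (simp add: lattice_embedding_le_iff[OF \<kappa>])
      also have "\<dots> \<le> \<kappa> f - \<kappa> e" using e(2) by (simp add: d_def le_diff_eq add.commute)
      finally show "p \<le> f - e"
        by (simp add: lattice_embedding_le_iff[OF \<kappa>] flip: lattice_embeddingD(2)[OF \<kappa>])
    qed
    then have "e \<le> 0" by simp
    moreover have "0 < e" using e(1) lattice_embeddingD(9)[OF \<kappa>] by blast
    ultimately show False by (simp add: less_le_not_le)
  qed
  then have "is_sup_in H (\<kappa> ` P) (\<kappa> f)"
    using \<kappa>H f(1) unfolding is_sup_in_def by (auto simp: lattice_embedding_le_iff[OF \<kappa>])
  then show ?thesis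
    using P \<kappa>H unfolding increases_to_def by (auto simp: directed_up_lattice_embedding_iff[OF \<kappa>])
qed

text \<open>Upper bounds in the source map to upper bounds in \<open>H\<close>, and the embedding
  reflects the order. Through this direction a supremum found in F^u reaches the demicontinuity
  hypothesis, which speaks of suprema in F.\<close>

lemma increases_to_lattice_embeddingD:
  assumes "lattice_embedding \<kappa>" "range \<kappa> \<subseteq> H" "increases_to H (\<kappa> ` P) (\<kappa> f)"
  shows "increases_to UNIV P f"
proof -
  have "\<kappa> f \<le> \<kappa> h" if "\<forall>p\<in>P. p \<le> h" for h
  proof (rule is_sup_inD(3))
    show "is_sup_in H (\<kappa> ` P) (\<kappa> f)" using assms(3) unfolding increases_to_def by blast
  qed (use assms(2) that in \<open>auto simp: lattice_embedding_le_iff[OF assms(1)]\<close>)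
  then show ?thesis
    using assms(3) unfolding increases_to_def is_sup_in_def
    by (auto simp: lattice_embedding_le_iff[OF assms(1)] directed_up_lattice_embedding_iff[OF assms(1)])
qed

section \<open>Approximation by minorants from an order dense sublattice\<close>

definition minorants :: "('f::vector_lattice \<Rightarrow> 'w::vector_lattice) \<Rightarrow> 'w set \<Rightarrow> 'f set" where
  "minorants \<kappa> R = {g. 0 \<le> g \<and> (\<exists>\<rho>\<in>R. \<kappa> g \<le> \<rho>)}"

lemma directed_up_minorants:
  assumes \<kappa>: "lattice_embedding \<kappa>" and R: "directed_up R" "\<And>\<rho>. \<rho> \<in> R \<Longrightarrow> 0 \<le> \<rho>"
  shows "directed_up (minorants \<kappa> R)"
  unfolding directed_up_def
proof (intro conjI ballI)
  obtain \<rho> where "\<rho> \<in> R" using R(1) unfolding directed_up_def by blast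
  then have "0 \<in> minorants \<kappa> R"
    using R(2) unfolding minorants_def by (auto simp: lattice_embeddingD[OF \<kappa>])
  then show "minorants \<kappa> R \<noteq> {}" by blast
  fix x y assume "x \<in> minorants \<kappa> R" "y \<in> minorants \<kappa> R"
  then obtain a b where ab: "0 \<le> x" "0 \<le> y" "a \<in> R" "\<kappa> x \<le> a" "b \<in> R" "\<kappa> y \<le> b"
    unfolding minorants_def by blast
  then obtain c where c: "c \<in> R" "a \<le> c" "b \<le> c" using R(1) unfolding directed_up_def by blast
  have "\<kappa> (sup x y) \<le> c"
    using ab c by (auto simp: lattice_embeddingD[OF \<kappa>] intro: order_trans)
  then have "sup x y \<in> minorants \<kappa> R" using ab(1) c(1) unfolding minorants_def by (auto intro: le_supI1)
  then show "\<exists>z\<in>minorants \<kappa> R. x \<le> z \<and> y \<le> z" by (meson sup_ge1 sup_ge2)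
qed

text \<open>By order density each \<open>\<rho>\<close> is the supremum of its own minorants, so an
  upper bound of all minorants dominates every \<open>\<rho>\<close> and with it
  \<open>u\<close>.\<close>

lemma increases_to_minorants:
  assumes \<kappa>: "lattice_embedding \<kappa>" and H: "sublattice H" "archimedean_on H"
    and dense: "order_dense_sublattice (range \<kappa>) H"
    and R: "increases_to H R u" "\<And>\<rho>. \<rho> \<in> R \<Longrightarrow> 0 \<le> \<rho>"
  shows "increases_to H (\<kappa> ` minorants \<kappa> R) u"
proof -
  have RH: "R \<subseteq> H" "directed_up R" and u: "u \<in> H" "\<And>\<rho>. \<rho> \<in> R \<Longrightarrow> \<rho> \<le> u"
    "\<And>h. h \<in> H \<Longrightarrow> (\<And>\<rho>. \<rho> \<in> R \<Longrightarrow> \<rho> \<le> h) \<Longrightarrow> u \<le> h"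
    using R(1) unfolding increases_to_def is_sup_in_def by auto
  have "u \<le> h" if h: "h \<in> H" "\<And>g. g \<in> minorants \<kappa> R \<Longrightarrow> \<kappa> g \<le> h" for h
  proof (rule u(3)[OF h(1)])
    fix \<rho> assume \<rho>: "\<rho> \<in> R"
    have "is_sup_in H {e \<in> range \<kappa>. 0 \<le> e \<and> e \<le> \<rho>} \<rho>"
      using order_dense_is_sup_in[OF H dense] RH \<rho> R(2) by blast
    moreover have "e \<le> h" if e: "e \<in> {e \<in> range \<kappa>. 0 \<le> e \<and> e \<le> \<rho>}" for e
    proof -
      obtain g where g: "e = \<kappa> g" "0 \<le> \<kappa> g" "\<kappa> g \<le> \<rho>" using e by auto
      then have "g \<in> minorants \<kappa> R"
        using \<rho> unfolding minorants_def by (auto simp: lattice_embeddingD[OF \<kappa>])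
      then show ?thesis using h(2) g(1) by blast
    qed
    ultimately show "\<rho> \<le> h" using h(1) unfolding is_sup_in_def by blast
  qed
  moreover have "\<kappa> g \<le> u" if "g \<in> minorants \<kappa> R" for g
    using that u(2) unfolding minorants_def by (auto intro: order_trans)
  ultimately have "is_sup_in H (\<kappa> ` minorants \<kappa> R) u"
    using u(1) unfolding is_sup_in_def by blast
  moreover have "range \<kappa> \<subseteq> H" using dense unfolding order_dense_sublattice_def by auto
  moreover have "directed_up (\<kappa> ` minorants \<kappa> R)"
    using directed_up_minorants[OF \<kappa> RH(2) R(2)] by (simp add: directed_up_lattice_embedding_iff[OF \<kappa>])
  ultimately show ?thesis unfolding increases_to_def by blast
qed

lemma increases_to_minorants_singleton:
  assumes "lattice_embedding \<kappa>" "sublattice H" "archimedean_on H"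
    "order_dense_sublattice (range \<kappa>) H" "w \<in> H" "0 \<le> w"
  shows "increases_to H (\<kappa> ` minorants \<kappa> {w}) w"
  using increases_to_minorants[OF assms(1-4) increases_to_singleton[OF assms(5)]] assms(6) by simp

section \<open>Order limits and order continuous maps\<close>

lemma order_converges_increases_to:
  fixes f :: "'a::vector_lattice"
  assumes "sublattice H" "increases_to H P f"
  shows "directed_index P (\<le>)" "order_converges H P (\<le>) (\<lambda>x. x) f"
proof -
  show "directed_index P (\<le>)"
    using assms(2) unfolding increases_to_def directed_up_def directed_index_def
    by (auto intro: order_trans)
  \<comment> \<open>The set is its own index, and the regulating set is \<open>(-) f\<close> applied
    to \<open>P\<close>: beyond \<open>p\<close> the distance to \<open>f\<close> is at most
    \<open>f - p\<close>.\<close>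
  have "\<exists>i\<in>P. \<forall>j\<in>P. i \<le> j \<longrightarrow> \<bar>j - f\<bar> \<le> q" if q: "q \<in> (-) f ` P" for q
  proof -
    obtain p where p: "p \<in> P" "q = f - p" using q by blast
    have "\<bar>j - f\<bar> \<le> q" if j: "j \<in> P" "p \<le> j" for j
    proof -
      have "j \<le> f" using assms(2) j unfolding increases_to_def is_sup_in_def by blast
      then have "\<bar>j - f\<bar> = f - j" using abs_of_nonpos[of "j - f"] by simp
      then show ?thesis using j p by (simp add: diff_left_mono)
    qed
    then show ?thesis using p by blast
  qed
  then show "order_converges H P (\<le>) (\<lambda>x. x) f"
    using decreases_to_zero_diff[OF assms] assms(2)
    unfolding order_converges_def increases_to_def is_sup_in_def by auto
qed

lemma is_inf_in_greatest:
  assumes "decreases_to H Q f" "h \<in> H" "\<And>q. q \<in> Q \<Longrightarrow> h \<le> q"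
  shows "h \<le> f"
  using assms unfolding decreases_to_def is_inf_in_def by blast

lemma order_converges_cong:
  assumes "\<And>i. i \<in> A \<Longrightarrow> x i = y i"
  shows "order_converges H A le x f \<longleftrightarrow> order_converges H A le y f"
  using assms unfolding order_converges_def by simp

text \<open>At a common late index the distance of the limits is at most \<open>q + q'\<close>. The
  infimum is then taken over \<open>q\<close> with \<open>q'\<close> fixed, and afterwards over
  \<open>q'\<close>.\<close>

lemma order_converges_unique:
  assumes A: "directed_index A le" and H: "sublattice H"
    and f: "order_converges H A le x f" and g: "order_converges H A le x g"
  shows "f = g"
proof -
  obtain Q where Q: "decreases_to H Q 0" "\<And>q. q \<in> Q \<Longrightarrow> \<exists>i\<in>A. \<forall>j\<in>A. le i j \<longrightarrow> \<bar>x j - f\<bar> \<le> q"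
    using f unfolding order_converges_def by blast
  obtain Q' where Q': "decreases_to H Q' 0" "\<And>q. q \<in> Q' \<Longrightarrow> \<exists>i\<in>A. \<forall>j\<in>A. le i j \<longrightarrow> \<bar>x j - g\<bar> \<le> q"
    using g unfolding order_converges_def by blast
  have H': "\<bar>f - g\<bar> \<in> H" "Q \<subseteq> H" "Q' \<subseteq> H"
    using f g Q(1) Q'(1) H unfolding order_converges_def decreases_to_def by (auto simp: sublatticeD)
  have le: "\<bar>f - g\<bar> - q' \<le> q" if q: "q \<in> Q" "q' \<in> Q'" for q q'
  proof -
    obtain i i' where i: "i \<in> A" "\<forall>j\<in>A. le i j \<longrightarrow> \<bar>x j - f\<bar> \<le> q"
      "i' \<in> A" "\<forall>j\<in>A. le i' j \<longrightarrow> \<bar>x j - g\<bar> \<le> q'"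
      using Q(2)[OF q(1)] Q'(2)[OF q(2)] by blast
    obtain j where j: "j \<in> A" "le i j" "le i' j" using A i unfolding directed_index_def by blast
    have "\<bar>f - g\<bar> = \<bar>(x j - g) - (x j - f)\<bar>" by simp
    also have "\<dots> \<le> \<bar>x j - g\<bar> + \<bar>x j - f\<bar>" by (rule abs_triangle_ineq4)
    also have "\<dots> \<le> q' + q" using i j by (intro add_mono) auto
    finally show ?thesis by (simp add: diff_le_eq add.commute)
  qed
  have "\<bar>f - g\<bar> - q' \<le> 0" if q': "q' \<in> Q'" for q'
  proof (rule is_inf_in_greatest[OF Q(1)])
    show "\<bar>f - g\<bar> - q' \<in> H" using H H' q' by (auto simp: sublatticeD)
  qed (use le[OF _ q'] in blast)
  then have "\<bar>f - g\<bar> \<le> 0"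
    by (intro is_inf_in_greatest[OF Q'(1) H'(1)]) simp
  then show ?thesis by simp
qed

text \<open>A lattice homomorphism commutes with the modulus and is monotone, so the image of a
  regulating set regulates the image net as soon as its infimum is again 0.\<close>

lemma order_continuousI:
  assumes H: "sublattice H" and K: "sublattice K" and S: "lattice_hom H K S"
    and inf: "\<And>Q. decreases_to H Q 0 \<Longrightarrow> is_inf_in K (S ` Q) 0"
  shows "order_continuous H K S"
  unfolding order_continuous_def
proof (intro conjI allI impI)
  show "linear_on H K S" using S unfolding lattice_hom_def by blast
  fix A :: "('a \<times> 'a set) set" and le x f
  assume "order_converges H A le x f"
  then obtain Q where Q: "decreases_to H Q 0" "\<And>q. q \<in> Q \<Longrightarrow> \<exists>i\<in>A. \<forall>j\<in>A. le i j \<longrightarrow> \<bar>x j - f\<bar> \<le> q"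
    and x: "x ` A \<subseteq> H" "f \<in> H" unfolding order_converges_def by blast
  have QH: "Q \<subseteq> H" using Q(1) unfolding decreases_to_def by blast
  have SK: "S y \<in> K" if "y \<in> H" for y using lattice_homD(1)[OF S that that] .
  have "decreases_to K (S ` Q) 0"
  proof -
    have "\<exists>z\<in>S ` Q. z \<le> a \<and> z \<le> b" if ab: "a \<in> S ` Q" "b \<in> S ` Q" for a b
    proof -
      obtain q r where qr: "a = S q" "b = S r" "q \<in> Q" "r \<in> Q" using ab by blast
      then obtain z where z: "z \<in> Q" "z \<le> q" "z \<le> r"
        using Q(1) unfolding decreases_to_def directed_down_def by blast
      then have "S z \<le> a" "S z \<le> b"
        using lattice_hom_mono[OF S] qr QH by (auto simp: subset_iff)
      then show ?thesis using z(1) by blast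
    qed
    then have "directed_down (S ` Q)"
      using Q(1) unfolding decreases_to_def directed_down_def by auto
    then show ?thesis using inf[OF Q(1)] SK QH unfolding decreases_to_def by auto
  qed
  moreover have "\<exists>i\<in>A. \<forall>j\<in>A. le i j \<longrightarrow> \<bar>S (x j) - S f\<bar> \<le> S q" if q: "q \<in> Q" for q
  proof -
    obtain i where i: "i \<in> A" "\<forall>j\<in>A. le i j \<longrightarrow> \<bar>x j - f\<bar> \<le> q" using Q(2)[OF q] by blast
    have "\<bar>S (x j) - S f\<bar> \<le> S q" if j: "j \<in> A" "le i j" for j
    proof -
      have xj: "x j \<in> H" "x j - f \<in> H" "\<bar>x j - f\<bar> \<in> H" "q \<in> H"
        using x j(1) H q QH by (auto simp: sublatticeD)
      have "\<bar>S (x j) - S f\<bar> = S \<bar>x j - f\<bar>"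
        using lattice_hom_abs[OF S H xj(2)] lattice_hom_diff[OF S H xj(1) x(2)] by simp
      also have "\<dots> \<le> S q" using lattice_hom_mono[OF S xj(3,4)] i j by blast
      finally show ?thesis .
    qed
    then show ?thesis using i(1) by blast
  qed
  ultimately show "order_converges K A le (\<lambda>i. S (x i)) (S f)"
    unfolding order_converges_def using x SK by blast
qed

text \<open>Translates the net definition into the form with increasing sets that the extension
  argument uses: an upper bound \<open>h\<close> of the image satisfies
  \<open>S f - h \<le> q\<close> for every regulating \<open>q\<close>.\<close>

lemma order_continuous_is_sup_in:
  assumes H: "sublattice H" and K: "sublattice K" and S: "lattice_hom H K S" "order_continuous H K S"
    and P: "increases_to H P f"
  shows "is_sup_in K (S ` P) (S f)"
proof -
  note c = order_converges_increases_to[OF H P]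
  have PH: "P \<subseteq> H" "f \<in> H" "\<And>p. p \<in> P \<Longrightarrow> p \<le> f"
    using P unfolding increases_to_def is_sup_in_def by auto
  obtain Q where Q: "decreases_to K Q 0" "\<And>q. q \<in> Q \<Longrightarrow> \<exists>i\<in>P. \<forall>j\<in>P. i \<le> j \<longrightarrow> \<bar>S j - S f\<bar> \<le> q"
    using order_continuousD[OF S(2) c] unfolding order_converges_def by blast
  have SK: "S y \<in> K" if "y \<in> H" for y using lattice_homD(1)[OF S(1) that that] .
  show ?thesis
  proof (rule is_sup_inI)
    show "S f \<in> K" using SK PH by blast
    show "y \<le> S f" if "y \<in> S ` P" for y
      using that lattice_hom_mono[OF S(1)] PH by (auto simp: subset_iff)
    fix h assume h: "h \<in> K" "\<And>y. y \<in> S ` P \<Longrightarrow> y \<le> h"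
    have "S f - h \<le> q" if q: "q \<in> Q" for q
    proof -
      obtain i where i: "i \<in> P" "\<bar>S i - S f\<bar> \<le> q" using Q(2)[OF q] by auto
      have "S f - h \<le> S f - S i" using h(2) i(1) by (simp add: diff_left_mono)
      also have "\<dots> \<le> \<bar>S i - S f\<bar>" by (subst abs_minus_commute) (rule abs_ge_self)
      also note i(2)
      finally show ?thesis .
    qed
    then have "S f - h \<le> 0"
      using K h(1) SK[OF PH(2)] by (intro is_inf_in_greatest[OF Q(1)]) (simp_all add: sublatticeD)
    then show "S f \<le> h" by simp
  qed
qed

text \<open>A nonnegative element is the order limit of its minorants from the range of
  \<open>\<kappa>\<close>, where both maps agree. A general \<open>x\<close> is written as
  \<open>\<bar>x\<bar> - (\<bar>x\<bar> - x)\<close>.\<close>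

lemma order_continuous_unique:
  assumes \<kappa>: "lattice_embedding \<kappa>" and H: "sublattice H" "archimedean_on H"
    and dense: "order_dense_sublattice (range \<kappa>) H" and K: "sublattice K"
    and S: "order_continuous H K S" and S': "order_continuous H K S'"
    and eq: "\<And>f. S (\<kappa> f) = S' (\<kappa> f)" and x: "x \<in> H"
  shows "S x = S' x"
proof -
  have pos: "S w = S' w" if w: "w \<in> H" "0 \<le> w" for w
  proof -
    let ?P = "\<kappa> ` minorants \<kappa> {w}"
    note c = order_converges_increases_to[OF H(1) increases_to_minorants_singleton[OF \<kappa> H dense w]]
    have "order_converges K ?P (\<le>) S' (S w) \<longleftrightarrow> order_converges K ?P (\<le>) S (S w)"
      by (intro order_converges_cong) (auto simp: eq)
    then show ?thesis
      using order_converges_unique[OF c(1) K] order_continuousD[OF S c] order_continuousD[OF S' c]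
      by blast
  qed
  have lin: "linear_on H K S" "linear_on H K S'" using S S' unfolding order_continuous_def by auto
  have xH: "\<bar>x\<bar> \<in> H" "\<bar>x\<bar> - x \<in> H" using H(1) x by (simp_all add: sublatticeD)
  have "S (\<bar>x\<bar> - x) = S' (\<bar>x\<bar> - x)" using pos[OF xH(2)] abs_ge_self[of x] by simp
  moreover have "S \<bar>x\<bar> = S' \<bar>x\<bar>" using pos[OF xH(1)] by simp
  ultimately show ?thesis
    using linear_on_diff[OF lin(1) H(1) xH(1) x] linear_on_diff[OF lin(2) H(1) xH(1) x] by simp
qed

section \<open>Extension by suprema of minorants\<close>

lemma order_completeD:
  assumes "order_complete H" "P \<subseteq> H" "P \<noteq> {}" "h \<in> H" "\<And>p. p \<in> P \<Longrightarrow> p \<le> h"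
  shows "\<exists>f. is_sup_in H P f"
proof -
  have "\<exists>h\<in>H. \<forall>p\<in>P. p \<le> h" using assms(4,5) by (intro bexI ballI)
  then show ?thesis using assms(1-3) unfolding order_complete_def by simp
qed

lemma image_binary_op:
  assumes "\<And>p q. F (g p q) = h (F p) (F q)"
  shows "F ` {g p q |p q. p \<in> P \<and> q \<in> Q} = {h a b |a b. a \<in> F ` P \<and> b \<in> F ` Q}"
proof (intro subset_antisym subsetI)
  fix x assume "x \<in> F ` {g p q |p q. p \<in> P \<and> q \<in> Q}"
  then obtain p q where "x = h (F p) (F q)" "p \<in> P" "q \<in> Q" using assms by auto
  then show "x \<in> {h a b |a b. a \<in> F ` P \<and> b \<in> F ` Q}" by blast
next
  fix x assume "x \<in> {h a b |a b. a \<in> F ` P \<and> b \<in> F ` Q}"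
  then obtain p q where "x = F (g p q)" "p \<in> P" "q \<in> Q" using assms by auto
  then show "x \<in> F ` {g p q |p q. p \<in> P \<and> q \<in> Q}" by blast
qed

text \<open>Common setting of (iv), where \<open>H\<close> is F^L, and (v), where \<open>H\<close>
  is all of G. No norm occurs: the norm bounds enter through \<open>bounded\<close>, which each use
  derives from the order boundedness of norm bounded directed sets. Values are taken in a whole
  order complete lattice; that the image lies in a Lorentz space is proved afterwards.\<close>

locale dense_extension =
  fixes \<kappa> :: "'f::vector_lattice \<Rightarrow> 'w::vector_lattice" and H :: "'w set"
    and T :: "'f \<Rightarrow> 'v::vector_lattice"
  assumes \<kappa>: "lattice_embedding \<kappa>" and H: "sublattice H" "archimedean_on H"
    and dense: "order_dense_sublattice (range \<kappa>) H"
    and T: "lattice_hom UNIV UNIV T"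
    and T_sup: "\<And>P f. increases_to UNIV P f \<Longrightarrow> is_sup_in UNIV (T ` P) (T f)"
    and complete: "order_complete (UNIV :: 'v set)"
    and bounded: "\<And>w. w \<in> H \<Longrightarrow> 0 \<le> w \<Longrightarrow> \<exists>v. \<forall>f\<in>minorants \<kappa> {w}. T f \<le> v"
begin

definition pos_ext :: "'w \<Rightarrow> 'v" where
  "pos_ext w = (THE v. is_sup_in UNIV (T ` minorants \<kappa> {w}) v)"

text \<open>The standard linear extension of an additive map on the positive cone;
  \<open>ext_diff\<close> shows that every decomposition into nonnegative elements of
  \<open>H\<close> gives the same value.\<close>

definition ext :: "'w \<Rightarrow> 'v" where
  "ext w = pos_ext (pprt w) - pos_ext (pprt (- w))"

lemma range_subset: "range \<kappa> \<subseteq> H"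
  using dense unfolding order_dense_sublattice_def by auto

lemma T_mono: "x \<le> y \<Longrightarrow> T x \<le> T y"
  using lattice_hom_mono[OF T] by simp

lemma is_sup_in_pos_ext:
  assumes "w \<in> H" "0 \<le> w"
  shows "is_sup_in UNIV (T ` minorants \<kappa> {w}) (pos_ext w)"
proof -
  have "0 \<in> minorants \<kappa> {w}"
    using assms unfolding minorants_def by (simp add: lattice_embeddingD[OF \<kappa>])
  then have "T ` minorants \<kappa> {w} \<noteq> {}" by blast
  moreover obtain b where "\<And>t. t \<in> T ` minorants \<kappa> {w} \<Longrightarrow> t \<le> b" using bounded[OF assms] by blast
  ultimately obtain v where v: "is_sup_in UNIV (T ` minorants \<kappa> {w}) v"
    using order_completeD[OF complete subset_UNIV _ UNIV_I] by metis
  then show ?thesis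
    unfolding pos_ext_def by (rule theI) (rule is_sup_in_unique[OF _ v])
qed

text \<open>For a minorant \<open>f\<close> of \<open>w\<close>, the truncations
  \<open>inf f p\<close> increase to \<open>f\<close> already in the source, so \<open>T f\<close>
  is the supremum of their images and stays below any bound of \<open>T\<close> on \<open>P\<close>.
  Hence \<open>pos_ext w\<close> can be computed from any increasing approximation of
  \<open>w\<close>, such as the sums or infima of minorants used for additivity and for
  \<open>inf\<close>.\<close>

lemma is_sup_in_pos_ext_of_increases_to:
  assumes w: "w \<in> H" "0 \<le> w" and P: "\<And>p. p \<in> P \<Longrightarrow> 0 \<le> p" and inc: "increases_to H (\<kappa> ` P) w"
  shows "is_sup_in UNIV (T ` P) (pos_ext w)"
proof (rule is_sup_inI)
  note s = is_sup_in_pos_ext[OF w]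
  have \<kappa>P: "\<kappa> p \<le> w" if "p \<in> P" for p
    using inc that unfolding increases_to_def is_sup_in_def by blast
  then show "y \<le> pos_ext w" if "y \<in> T ` P" for y
    using that P is_sup_inD(2)[OF s] unfolding minorants_def by auto
  fix h assume h: "\<And>y. y \<in> T ` P \<Longrightarrow> y \<le> h"
  show "pos_ext w \<le> h"
  proof (rule is_sup_inD(3)[OF s])
    fix y assume "y \<in> T ` minorants \<kappa> {w}"
    then obtain f where f: "y = T f" "\<kappa> f \<le> w" unfolding minorants_def by blast
    have "increases_to H (inf (\<kappa> f) ` \<kappa> ` P) (inf (\<kappa> f) w)"
      using increases_to_inf_const[OF H(1) inc] range_subset by blast
    moreover have "inf (\<kappa> f) ` \<kappa> ` P = \<kappa> ` inf f ` P"
      by (simp add: image_image lattice_embeddingD[OF \<kappa>])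
    ultimately have "increases_to H (\<kappa> ` inf f ` P) (\<kappa> f)" using f(2) by (simp add: inf_absorb1)
    then have "is_sup_in UNIV (T ` inf f ` P) (T f)"
      by (intro T_sup increases_to_lattice_embeddingD[OF \<kappa> range_subset])
    moreover have "t \<le> h" if t: "t \<in> T ` inf f ` P" for t
    proof -
      obtain p where "p \<in> P" "t = T (inf f p)" using t by blast
      then show ?thesis using h[of "T p"] T_mono[of "inf f p" p] by (auto intro: order_trans)
    qed
    ultimately show "y \<le> h" unfolding f(1) by (rule_tac is_sup_inD(3)) auto
  qed simp
qed simp

lemma pos_ext_eqI:
  assumes "w \<in> H" "0 \<le> w" "\<And>p. p \<in> P \<Longrightarrow> 0 \<le> p" "increases_to H (\<kappa> ` P) w" "is_sup_in UNIV (T ` P) v"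
  shows "pos_ext w = v"
  using is_sup_in_pos_ext_of_increases_to[OF assms(1-4)] assms(5) by (rule is_sup_in_unique)

lemma minorants_nonneg: "p \<in> minorants \<kappa> R \<Longrightarrow> 0 \<le> p"
  unfolding minorants_def by blast

lemma increases_to_minorants_w:
  "w \<in> H \<Longrightarrow> 0 \<le> w \<Longrightarrow> increases_to H (\<kappa> ` minorants \<kappa> {w}) w"
  using increases_to_minorants_singleton[OF \<kappa> H dense] .

lemma pos_ext_embedding:
  assumes "0 \<le> f"
  shows "pos_ext (\<kappa> f) = T f"
proof (rule pos_ext_eqI[where P = "{f}"])
  show "\<kappa> f \<in> H" using range_subset by blast
  then show "increases_to H (\<kappa> ` {f}) (\<kappa> f)" by (simp add: increases_to_singleton)
qed (use assms in \<open>auto simp: lattice_embeddingD[OF \<kappa>] is_sup_in_def\<close>)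

lemma pos_ext_mono:
  assumes "v \<in> H" "w \<in> H" "0 \<le> v" "v \<le> w"
  shows "pos_ext v \<le> pos_ext w"
proof (rule is_sup_inD(3)[OF is_sup_in_pos_ext[OF assms(1,3)]])
  have "0 \<le> w" using assms(3,4) by (rule order_trans)
  then show "y \<le> pos_ext w" if "y \<in> T ` minorants \<kappa> {v}" for y
    using that is_sup_inD(2)[OF is_sup_in_pos_ext[OF assms(2)]] assms(4)
    unfolding minorants_def by (auto intro: order_trans)
qed simp

lemma pos_ext_add:
  assumes v: "v \<in> H" "0 \<le> v" and w: "w \<in> H" "0 \<le> w"
  shows "pos_ext (v + w) = pos_ext v + pos_ext w"
proof -
  let ?P = "{p + q |p q. p \<in> minorants \<kappa> {v} \<and> q \<in> minorants \<kappa> {w}}"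
  show ?thesis
  proof (rule pos_ext_eqI[where P = ?P])
    show "v + w \<in> H" using H(1) v(1) w(1) by (rule sublatticeD)
    show "0 \<le> p" if "p \<in> ?P" for p using that by (auto simp: minorants_def)
    have "\<kappa> ` ?P = {a + b |a b. a \<in> \<kappa> ` minorants \<kappa> {v} \<and> b \<in> \<kappa> ` minorants \<kappa> {w}}"
      by (rule image_binary_op) (rule lattice_embeddingD[OF \<kappa>])
    then show "increases_to H (\<kappa> ` ?P) (v + w)"
      using increases_to_add[OF H(1) increases_to_minorants_w[OF v] increases_to_minorants_w[OF w]]
      by simp
    have "T ` ?P = {a + b |a b. a \<in> T ` minorants \<kappa> {v} \<and> b \<in> T ` minorants \<kappa> {w}}"
      by (rule image_binary_op) (rule lattice_homD[OF T UNIV_I UNIV_I])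
    then show "is_sup_in UNIV (T ` ?P) (pos_ext v + pos_ext w)"
      using is_sup_in_add[OF sublattice_UNIV _ _ is_sup_in_pos_ext[OF v] is_sup_in_pos_ext[OF w]]
      by simp
  qed (use v w in simp)
qed

lemma pos_ext_inf:
  assumes v: "v \<in> H" "0 \<le> v" and w: "w \<in> H" "0 \<le> w"
  shows "pos_ext (inf v w) = inf (pos_ext v) (pos_ext w)"
proof -
  let ?P = "{inf p q |p q. p \<in> minorants \<kappa> {v} \<and> q \<in> minorants \<kappa> {w}}"
  show ?thesis
  proof (rule pos_ext_eqI[where P = ?P])
    show "inf v w \<in> H" using H(1) v(1) w(1) by (rule sublatticeD)
    show "0 \<le> p" if "p \<in> ?P" for p using that by (auto simp: minorants_def)
    have "\<kappa> ` ?P = {inf a b |a b. a \<in> \<kappa> ` minorants \<kappa> {v} \<and> b \<in> \<kappa> ` minorants \<kappa> {w}}"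
      by (rule image_binary_op) (rule lattice_embeddingD[OF \<kappa>])
    then show "increases_to H (\<kappa> ` ?P) (inf v w)"
      using increases_to_inf[OF H(1) increases_to_minorants_w[OF v] increases_to_minorants_w[OF w]]
      by simp
    have "T ` ?P = {inf a b |a b. a \<in> T ` minorants \<kappa> {v} \<and> b \<in> T ` minorants \<kappa> {w}}"
      by (rule image_binary_op) (rule lattice_homD[OF T UNIV_I UNIV_I])
    then show "is_sup_in UNIV (T ` ?P) (inf (pos_ext v) (pos_ext w))"
      using is_sup_in_inf_inf[OF sublattice_UNIV _ _ is_sup_in_pos_ext[OF v] is_sup_in_pos_ext[OF w]]
      by simp
  qed (use v w in simp)
qed

lemma pos_ext_0: "pos_ext 0 = 0"
  using pos_ext_embedding[of 0] lattice_hom_0[OF T sublattice_UNIV]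
  by (simp add: lattice_embeddingD[OF \<kappa>])

lemma pos_ext_scaleR:
  assumes w: "w \<in> H" "0 \<le> w" and c: "0 \<le> c"
  shows "pos_ext (c *\<^sub>R w) = c *\<^sub>R pos_ext w"
proof (cases "c = 0")
  case False
  then have c: "0 < c" using c by simp
  show ?thesis
  proof (rule pos_ext_eqI[where P = "(*\<^sub>R) c ` minorants \<kappa> {w}"])
    show "c *\<^sub>R w \<in> H" using H(1) w(1) by (simp add: sublatticeD)
    show "increases_to H (\<kappa> ` (*\<^sub>R) c ` minorants \<kappa> {w}) (c *\<^sub>R w)"
      using increases_to_scaleR[OF H(1) increases_to_minorants_w[OF w] c]
      by (simp add: image_image lattice_embeddingD[OF \<kappa>])
    show "is_sup_in UNIV (T ` (*\<^sub>R) c ` minorants \<kappa> {w}) (c *\<^sub>R pos_ext w)"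
      using is_sup_in_scaleR[OF sublattice_UNIV is_sup_in_pos_ext[OF w] c]
      by (simp add: image_image lattice_homD(3)[OF T])
  qed (use w c in \<open>auto simp: scaleR_nonneg_nonneg minorants_def\<close>)
qed (simp add: pos_ext_0)

text \<open>The identity \<open>pprt (a - b) + b = pprt (- (a - b)) + a\<close> has only nonnegative
  terms, so additivity on the cone applies to both sides.\<close>

lemma ext_diff:
  assumes a: "a \<in> H" "0 \<le> a" and b: "b \<in> H" "0 \<le> b"
  shows "ext (a - b) = pos_ext a - pos_ext b"
proof -
  have d: "a - b \<in> H" "- (a - b) \<in> H" using H(1) a b by (simp_all add: sublatticeD del: minus_diff_eq)
  have p: "pprt (a - b) \<in> H" "pprt (- (a - b)) \<in> H" using H(1) d by (simp_all add: sublatticeD del: minus_diff_eq)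
  have "a - b = pprt (a - b) - pprt (- (a - b))"
    using prts[of "a - b"] by (simp only: pprt_neg diff_minus_eq_add)
  then have "pprt (a - b) + b = pprt (- (a - b)) + a"
    by (metis add.commute diff_add_cancel diff_diff_eq2 diff_eq_eq)
  then have "pos_ext (pprt (a - b)) + pos_ext b = pos_ext (pprt (- (a - b))) + pos_ext a"
    using pos_ext_add[OF p(1) _ b] pos_ext_add[OF p(2) _ a] by simp
  then show ?thesis unfolding ext_def by (simp add: algebra_simps)
qed

lemma ext_eq_pos_ext: "w \<in> H \<Longrightarrow> 0 \<le> w \<Longrightarrow> ext w = pos_ext w"
  using ext_diff[of w 0] sublatticeD(1)[OF H(1)] pos_ext_0 by simp

lemma pprt_decomp:
  assumes "x \<in> H"
  shows "pprt x \<in> H" "pprt (- x) \<in> H" "0 \<le> pprt x" "0 \<le> pprt (- x)" "x = pprt x - pprt (- x)"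
  using assms H(1) sublatticeD(9)[OF H(1), of "- x" "- x"] prts[of x]
  by (simp_all add: sublatticeD pprt_neg)

lemma ext_add:
  assumes "x \<in> H" "y \<in> H"
  shows "ext (x + y) = ext x + ext y"
proof -
  note x = pprt_decomp[OF assms(1)] and y = pprt_decomp[OF assms(2)]
  have "x + y = (pprt x - pprt (- x)) + (pprt y - pprt (- y))" using x(5) y(5) by metis
  then have "x + y = (pprt x + pprt y) - (pprt (- x) + pprt (- y))"
    by (simp only: add_diff_add)
  then have "ext (x + y) = pos_ext (pprt x + pprt y) - pos_ext (pprt (- x) + pprt (- y))"
    using ext_diff[of "pprt x + pprt y" "pprt (- x) + pprt (- y)"] x(1-4) y(1-4) H(1)
    by (simp add: sublatticeD)
  then show ?thesis
    using pos_ext_add x(1-4) y(1-4) unfolding ext_def by (simp add: algebra_simps)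
qed

lemma ext_scaleR:
  assumes "x \<in> H"
  shows "ext (c *\<^sub>R x) = c *\<^sub>R ext x"
proof -
  note x = pprt_decomp[OF assms]
  have cx: "c *\<^sub>R x = c *\<^sub>R pprt x - c *\<^sub>R pprt (- x)" using x(5) by (metis scaleR_diff_right)
  show ?thesis
  proof (cases "0 \<le> c")
    case True
    then have "ext (c *\<^sub>R x) = c *\<^sub>R pos_ext (pprt x) - c *\<^sub>R pos_ext (pprt (- x))"
      unfolding cx using ext_diff[of "c *\<^sub>R pprt x" "c *\<^sub>R pprt (- x)"] x(1-4) H(1)
      by (simp add: sublatticeD scaleR_nonneg_nonneg pos_ext_scaleR)
    then show ?thesis unfolding ext_def by (simp add: scaleR_diff_right)
  next
    case False
    then have c: "0 \<le> - c" by simp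
    \<comment> \<open>A negative scalar exchanges the roles of the positive and the negative
      part.\<close>
    have "c *\<^sub>R x = (- c) *\<^sub>R pprt (- x) - (- c) *\<^sub>R pprt x" unfolding cx by simp
    then have "ext (c *\<^sub>R x) = (- c) *\<^sub>R pos_ext (pprt (- x)) - (- c) *\<^sub>R pos_ext (pprt x)"
      using ext_diff[of "(- c) *\<^sub>R pprt (- x)" "(- c) *\<^sub>R pprt x"] x(1-4) H(1)
        scaleR_nonneg_nonneg[OF c x(3)] scaleR_nonneg_nonneg[OF c x(4)]
        pos_ext_scaleR[OF x(1,3) c] pos_ext_scaleR[OF x(2,4) c]
        sublatticeD(5)[OF H(1) x(1,1), of "- c"] sublatticeD(5)[OF H(1) x(2,2), of "- c"]
      by metis
    then show ?thesis unfolding ext_def by (simp add: scaleR_diff_right)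
  qed
qed

text \<open>Adding \<open>w = \<bar>x\<bar> + \<bar>y\<bar>\<close> moves both elements into the
  positive cone, where \<open>pos_ext\<close> preserves infima; translations commute with
  \<open>inf\<close>, so the shift can be undone.\<close>

lemma ext_inf:
  assumes x: "x \<in> H" and y: "y \<in> H"
  shows "ext (inf x y) = inf (ext x) (ext y)"
proof -
  define w where "w = \<bar>x\<bar> + \<bar>y\<bar>"
  have w: "w \<in> H" "0 \<le> w" "x + w \<in> H" "y + w \<in> H" "inf x y \<in> H"
    using H(1) x y by (simp_all add: w_def sublatticeD)
  have "- x \<le> w" "- y \<le> w"
    using abs_ge_minus_self[of x] abs_ge_minus_self[of y] unfolding w_def
    by (auto intro: order_trans add_increasing2 add_increasing)
  then have p: "0 \<le> x + w" "0 \<le> y + w" by (simp_all add: minus_le_iff neg_le_iff_le le_minus_iff add.commute flip: diff_le_eq)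
  have e: "ext z + pos_ext w = pos_ext (z + w)" if "z \<in> H" "0 \<le> z + w" for z
    using ext_add[OF that(1) w(1)] ext_eq_pos_ext w(1,2) that H(1) by (simp add: sublatticeD)
  have "ext (inf x y) + pos_ext w = pos_ext (inf (x + w) (y + w))"
    using e[OF w(5)] p by (simp add: add_inf_distrib_right)
  also have "\<dots> = inf (ext x + pos_ext w) (ext y + pos_ext w)"
    using pos_ext_inf w(3,4) p e x y by simp
  also have "\<dots> = inf (ext x) (ext y) + pos_ext w" by (simp add: add_inf_distrib_right)
  finally show ?thesis by simp
qed

text \<open>Supremum and infimum of two elements add up to their sum, so preservation of
  \<open>sup\<close> follows from additivity and \<open>ext_inf\<close>. The codomain
  \<open>K\<close> is a parameter because the image is located only after the extension
  exists.\<close>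

lemma lattice_hom_ext:
  assumes K: "ext ` H \<subseteq> K"
  shows "lattice_hom H K ext"
proof -
  have "linear_on H K ext" using K ext_add ext_scaleR unfolding linear_on_def by blast
  moreover have "ext (sup x y) = sup (ext x) (ext y)" if "x \<in> H" "y \<in> H" for x y
  proof -
    have "sup x y \<in> H" "inf x y \<in> H" using H(1) that by (simp_all add: sublatticeD)
    then have "ext (sup x y) + ext (inf x y) = ext x + ext y"
      using ext_add[of "sup x y" "inf x y"] ext_add[OF that] add_eq_inf_sup[of x y] by simp
    then show ?thesis using add_eq_inf_sup[of "ext x" "ext y"] ext_inf[OF that] by simp
  qed
  ultimately show ?thesis using ext_inf unfolding lattice_hom_def by blast
qed

lemma ext_embedding: "ext (\<kappa> f) = T f"
proof -
  have "f = pprt f - pprt (- f)" using prts[of f] by (simp add: pprt_neg)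
  then have "ext (\<kappa> f) = ext (\<kappa> (pprt f) - \<kappa> (pprt (- f)))" by (metis lattice_embeddingD(2)[OF \<kappa>])
  also have "\<dots> = T (pprt f) - T (pprt (- f))"
    using range_subset by (subst ext_diff) (auto simp: lattice_embeddingD[OF \<kappa>] pos_ext_embedding)
  also have "\<dots> = T f"
    using \<open>f = _\<close> lattice_hom_diff[OF T sublattice_UNIV, of "pprt f" "pprt (- f)"] by simp
  finally show ?thesis .
qed

text \<open>The minorants of all of \<open>R\<close> together approximate \<open>u\<close>, and the
  image of each of them is below \<open>pos_ext \<rho>\<close> for some \<open>\<rho>\<close> in
  \<open>R\<close>.\<close>

lemma is_sup_in_pos_ext_image:
  assumes R: "increases_to H R u" "\<And>\<rho>. \<rho> \<in> R \<Longrightarrow> 0 \<le> \<rho>"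
  shows "is_sup_in UNIV (pos_ext ` R) (pos_ext u)"
proof (rule is_sup_inI)
  have RH: "R \<subseteq> H" "R \<noteq> {}" and u: "u \<in> H" "\<And>\<rho>. \<rho> \<in> R \<Longrightarrow> \<rho> \<le> u"
    using R(1) unfolding increases_to_def is_sup_in_def directed_up_def by auto
  then have u0: "0 \<le> u" using R(2) by (meson ex_in_conv order_trans)
  show "y \<le> pos_ext u" if "y \<in> pos_ext ` R" for y using that RH u R(2) pos_ext_mono by auto
  fix h assume h: "\<And>y. y \<in> pos_ext ` R \<Longrightarrow> y \<le> h"
  have "is_sup_in UNIV (T ` minorants \<kappa> R) (pos_ext u)"
    using increases_to_minorants[OF \<kappa> H dense R] minorants_nonneg
    by (intro is_sup_in_pos_ext_of_increases_to u u0) auto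
  moreover have "y \<le> h" if y: "y \<in> T ` minorants \<kappa> R" for y
  proof -
    obtain g \<rho> where g: "y = T g" "0 \<le> g" "\<rho> \<in> R" "\<kappa> g \<le> \<rho>" using y unfolding minorants_def by blast
    then have "y \<le> pos_ext \<rho>"
      using is_sup_inD(2)[OF is_sup_in_pos_ext[of \<rho>], of y] RH R(2) unfolding minorants_def by auto
    then show ?thesis using h g(3) by (auto intro: order_trans)
  qed
  ultimately show "pos_ext u \<le> h" by (rule_tac is_sup_inD(3)) auto
qed simp

text \<open>For a fixed \<open>q0\<close> in \<open>Q\<close> the elements \<open>q0 - q\<close>
  increase to \<open>q0\<close>. Continuity along increasing sets makes \<open>pos_ext q0\<close>
  the supremum of the \<open>pos_ext q0 - ext q\<close>, so no lower bound of the
  \<open>ext q\<close> can exceed 0.\<close>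

lemma is_inf_in_ext_image:
  assumes Q: "decreases_to H Q 0"
  shows "is_inf_in UNIV (ext ` Q) 0"
proof -
  have QH: "Q \<subseteq> H" "directed_down Q" and inf: "is_inf_in H Q 0" using Q unfolding decreases_to_def by auto
  have Q0: "\<And>q. q \<in> Q \<Longrightarrow> 0 \<le> q" using inf unfolding is_inf_in_def by blast
  obtain q0 where q0: "q0 \<in> Q" using QH(2) unfolding directed_down_def by blast
  have q0H: "q0 \<in> H" "0 \<le> q0" using q0 QH Q0 by auto
  \<comment> \<open>Cutting \<open>Q\<close> at \<open>q0\<close> makes \<open>q0 - q\<close>
    nonnegative, so that \<open>pos_ext\<close> applies; directedness keeps the infimum at
    0.\<close>
  let ?Q = "{q \<in> Q. q \<le> q0}"
  have "is_inf_in H ?Q 0"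
  proof -
    have "h \<le> 0" if h: "h \<in> H" "\<forall>q\<in>?Q. h \<le> q" for h
    proof (rule is_inf_in_greatest[OF Q h(1)])
      fix q assume "q \<in> Q"
      then obtain z where "z \<in> Q" "z \<le> q" "z \<le> q0" using q0 QH(2) unfolding directed_down_def by blast
      then show "h \<le> q" using h(2) by (auto intro: order_trans)
    qed
    then show ?thesis using inf unfolding is_inf_in_def by auto
  qed
  then have "is_sup_in H ((-) q0 ` ?Q) (q0 - 0)"
    using QH by (intro is_sup_in_reflect[OF H(1) q0H(1)]) auto
  moreover have "directed_up ((-) q0 ` ?Q)"
    unfolding directed_up_def
  proof (intro conjI ballI)
    show "(-) q0 ` ?Q \<noteq> {}" using q0 by blast
    fix x y assume "x \<in> (-) q0 ` ?Q" "y \<in> (-) q0 ` ?Q"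
    then obtain a b where ab: "x = q0 - a" "y = q0 - b" "a \<in> Q" "b \<in> Q" "a \<le> q0" by blast
    then obtain z where z: "z \<in> Q" "z \<le> a" "z \<le> b" using QH(2) unfolding directed_down_def by blast
    then have "q0 - z \<in> (-) q0 ` ?Q" using ab by (auto intro: order_trans)
    then show "\<exists>z\<in>(-) q0 ` ?Q. x \<le> z \<and> y \<le> z"
      using z ab by (meson diff_left_mono)
  qed
  moreover have "(-) q0 ` ?Q \<subseteq> H" using QH(1) q0H(1) H(1) by (auto simp: sublatticeD)
  ultimately have "increases_to H ((-) q0 ` ?Q) q0" unfolding increases_to_def by simp
  then have s: "is_sup_in UNIV (pos_ext ` (-) q0 ` ?Q) (pos_ext q0)"
    by (rule is_sup_in_pos_ext_image) auto
  have ext0: "ext 0 = 0" using ext_eq_pos_ext[of 0] sublatticeD(1)[OF H(1)] q0H pos_ext_0 by simp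
  have "h \<le> 0" if h: "\<forall>y\<in>ext ` Q. h \<le> y" for h
  proof -
    have "pos_ext q0 \<le> pos_ext q0 - h"
    proof (rule is_sup_inD(3)[OF s])
      fix y assume "y \<in> pos_ext ` (-) q0 ` ?Q"
      then obtain q where q: "y = pos_ext (q0 - q)" "q \<in> Q" "q \<le> q0" by blast
      then have "y = ext (q0 - q)"
        using QH q0H H(1) by (subst ext_eq_pos_ext) (auto simp: sublatticeD)
      also have "\<dots> = pos_ext q0 - ext q"
        using ext_diff[OF q0H] q QH Q0 ext_eq_pos_ext by (simp add: subset_iff)
      finally show "y \<le> pos_ext q0 - h" using h q(2) by (auto intro: diff_left_mono)
    qed simp
    then show ?thesis by simp
  qed
  moreover have "0 \<le> ext q" if "q \<in> Q" for q
    using pos_ext_mono[of 0 q] ext_eq_pos_ext pos_ext_0 QH Q0 that sublatticeD(1)[OF H(1) q0H(1,1)]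
    by (auto simp: subset_iff)
  ultimately show ?thesis unfolding is_inf_in_def by auto
qed

lemma order_continuous_ext:
  assumes K: "sublattice K" "ext ` H \<subseteq> K"
  shows "order_continuous H K ext"
proof (rule order_continuousI[OF H(1) K(1) lattice_hom_ext[OF K(2)]])
  fix Q assume Q: "decreases_to H Q 0"
  \<comment> \<open>An infimum in the whole codomain that belongs to \<open>K\<close> is also the
    infimum in \<open>K\<close>. That 0 belongs to \<open>K\<close> is read off from one value of
    \<open>ext\<close>.\<close>
  obtain q where "q \<in> Q" using Q unfolding decreases_to_def directed_down_def by blast
  then have "ext q \<in> K" using K(2) Q unfolding decreases_to_def by blast
  then have "0 \<in> K" using K(1) by (simp add: sublatticeD)
  then show "is_inf_in K (ext ` Q) 0" using is_inf_in_ext_image[OF Q] unfolding is_inf_in_def by blast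
qed

end

section \<open>Boundedness in universally complete vector lattices\<close>

lemma inf_scaleR_nat_eq_0:
  fixes x d :: "'a::vector_lattice"
  assumes "0 \<le> x" "0 \<le> d" "inf x d = 0"
  shows "inf x (real n *\<^sub>R d) = 0"
proof (induction n)
  case 0
  then show ?case using assms(1) by (simp add: inf_absorb2)
next
  case (Suc n)
  have nd: "0 \<le> real n *\<^sub>R d" using assms(2) by (simp add: scaleR_nonneg_nonneg)
  have "inf (real n *\<^sub>R d + d) x \<le> inf (real n *\<^sub>R d) x + inf d x"
    by (rule inf_add_le[OF nd assms(2,1)])
  then have "inf (real n *\<^sub>R d + d) x \<le> 0" using Suc assms(3) by (simp only: inf_commute[of _ x] add_0)
  moreover have "0 \<le> inf (real n *\<^sub>R d + d) x" using nd assms(1,2) by simp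
  ultimately have "inf (real n *\<^sub>R d + d) x = 0" by (rule antisym)
  then show ?case by (simp add: inf_commute scaleR_add_left add.commute)
qed

text \<open>The element \<open>s\<close> is the projection of \<open>b\<close> onto the band generated by \<open>d\<close>.\<close>

lemma band_projection_exists:
  fixes b d :: "'a::vector_lattice"
  assumes complete: "order_complete (UNIV :: 'a set)" and b: "0 \<le> b" and d: "0 \<le> d"
  obtains s where "0 \<le> s" "s \<le> b" "inf (b - s) d = 0" "\<And>x. 0 \<le> x \<Longrightarrow> inf x d = 0 \<Longrightarrow> inf x s = 0"
proof -
  let ?S = "range (\<lambda>n. inf b (real n *\<^sub>R d))"
  obtain s where s: "is_sup_in UNIV ?S s"
    using order_completeD[OF complete subset_UNIV _ UNIV_I, of ?S b] by (metis (mono_tags) empty_not_UNIV image_is_empty inf_le1 rangeE)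
  note sD = is_sup_inD[OF s]
  have s0: "0 \<le> s" using sD(2)[OF rangeI[of _ 0]] b by (simp add: inf_absorb2)
  have sb: "s \<le> b" by (rule sD(3)) auto
  define c where "c = inf (b - s) d"
  have c0: "0 \<le> c" using sb d unfolding c_def by simp
  \<comment> \<open>Adding the remaining overlap \<open>c\<close> to \<open>inf b (n d)\<close>
    stays below \<open>b\<close>, since \<open>c \<le> b - s\<close>, and below
    \<open>(n + 1) d\<close>, since \<open>c \<le> d\<close>. So \<open>s - c\<close> is again an
    upper bound, which forces \<open>c = 0\<close>.\<close>
  have "s \<le> s - c"
  proof (rule sD(3))
    fix p assume "p \<in> ?S"
    then obtain n where p: "p = inf b (real n *\<^sub>R d)" by blast
    have "p + c \<le> b"
    proof -
      have "p \<le> s" using sD(2) p by blast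
      moreover have "c \<le> b - s" unfolding c_def by simp
      ultimately have "p + c \<le> s + (b - s)" by (rule add_mono)
      then show ?thesis by simp
    qed
    moreover have "p + c \<le> real (Suc n) *\<^sub>R d"
    proof -
      have "p + c \<le> real n *\<^sub>R d + d" unfolding p c_def by (intro add_mono) auto
      then show ?thesis by (simp add: scaleR_add_left add.commute)
    qed
    ultimately have "p + c \<le> inf b (real (Suc n) *\<^sub>R d)" by simp
    also have "\<dots> \<le> s" using sD(2) by blast
    finally show "p \<le> s - c" by (simp add: le_diff_eq)
  qed simp
  then have "c = 0" using c0 by (simp add: antisym)
  moreover have "inf x s = 0" if x: "0 \<le> x" "inf x d = 0" for x
  proof (rule antisym)
    have "inf x (inf b (real n *\<^sub>R d)) \<le> 0" for n
      using inf_scaleR_nat_eq_0[OF x(1) d x(2), of n] by (metis inf.left_commute inf_le2)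
    then show "inf x s \<le> 0"
      using is_sup_inD(3)[OF is_sup_in_inf[OF sublattice_UNIV subset_UNIV s UNIV_I, of x]] by auto
  qed (use s0 x in simp)
  ultimately show thesis using that s0 sb unfolding c_def by blast
qed

text \<open>An upper bound \<open>h\<close> of the truncations that is not above \<open>n e\<close>
  leaves a gap \<open>k\<close> below \<open>n e\<close>, and \<open>k\<close> lies below the
  negative part of every \<open>\<rho> - n e\<close>. It is therefore disjoint from all the positive
  parts. The witness is \<open>inf k e\<close>: were it 0, then \<open>k\<close> would be disjoint
  from \<open>n e\<close> too, although \<open>k \<le> n e\<close>.\<close>

lemma disjoint_minorant_of_not_infinite:
  fixes R :: "'a::vector_lattice set"
  assumes R: "R \<noteq> {}" "\<And>\<rho>. \<rho> \<in> R \<Longrightarrow> 0 \<le> \<rho>" and e: "0 < e"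
    and n: "\<not> is_sup_in UNIV (inf (real n *\<^sub>R e) ` R) (real n *\<^sub>R e)"
  obtains d where "0 < d" "d \<le> e" "\<And>\<rho>. \<rho> \<in> R \<Longrightarrow> inf (pprt (\<rho> - real n *\<^sub>R e)) d = 0"
proof -
  let ?e = "real n *\<^sub>R e"
  have e0: "0 \<le> ?e" using e by (simp add: scaleR_nonneg_nonneg)
  obtain h where h: "\<And>\<rho>. \<rho> \<in> R \<Longrightarrow> inf ?e \<rho> \<le> h" "\<not> ?e \<le> h"
    using n unfolding is_sup_in_def by auto
  define k where "k = ?e - inf h ?e"
  have k0: "0 \<le> k" "k \<noteq> 0"
    using h(2) unfolding k_def by (simp only: diff_ge_0_iff_ge inf_le2, metis eq_iff_diff_eq_0 inf_le1)
  have k\<rho>: "k \<le> pprt (- (\<rho> - ?e))" if "\<rho> \<in> R" for \<rho>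
  proof -
    have "k \<le> ?e - inf ?e \<rho>" unfolding k_def using h(1)[OF that] by (intro diff_left_mono) simp
    also have "\<dots> = pprt (- (\<rho> - ?e))"
      by (simp add: diff_inf_eq_sup add_sup_distrib_left pprt_def sup_commute)
    finally show ?thesis .
  qed
  have dis: "inf (pprt (\<rho> - ?e)) (inf k e) = 0" if "\<rho> \<in> R" for \<rho>
  proof (rule inf_eq_0_mono[OF inf_pprt_eq_0[of "\<rho> - ?e"]])
    show "inf k e \<le> pprt (- (\<rho> - ?e))" using k\<rho>[OF that] by (rule le_infI1)
  qed (use k0 e in simp_all)
  have "inf k e \<noteq> 0"
  proof
    assume "inf k e = 0"
    then have "inf k ?e = 0" using inf_scaleR_nat_eq_0[OF k0(1), of e n] e by simp
    moreover have "k \<le> ?e"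
    proof -
      obtain \<rho> where "\<rho> \<in> R" using R(1) by blast
      then have "0 \<le> h" using h(1) R(2) e0 by (meson le_inf_iff order_trans)
      then show ?thesis unfolding k_def using e0 by (simp add: diff_le_eq)
    qed
    ultimately show False using k0(2) by (simp add: inf_absorb1)
  qed
  then have "0 < inf k e" using k0(1) e by (simp add: order_less_le)
  then show thesis using that[OF _ inf_le2 dis] by blast
qed

text \<open>
  A set without upper bound is infinite on some band: a maximal disjoint family of elements on
  whose bands \<open>R\<close> is bounded would otherwise be complete, and universal completeness glues the
  bounds.
\<close>

lemma universally_complete_bounded:
  fixes R :: "'a::vector_lattice set"
  assumes uc: "universally_complete (UNIV :: 'a set)"
    and R: "R \<noteq> {}" "\<And>\<rho>. \<rho> \<in> R \<Longrightarrow> 0 \<le> \<rho>"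
    and finite: "\<And>e. 0 < e \<Longrightarrow> \<exists>n. \<not> is_sup_in UNIV (inf (real n *\<^sub>R e) ` R) (real n *\<^sub>R e)"
  obtains w where "\<And>\<rho>. \<rho> \<in> R \<Longrightarrow> \<rho> \<le> w"
proof -
  have complete: "order_complete (UNIV :: 'a set)"
    using uc unfolding universally_complete_def by blast
  \<comment> \<open>\<open>A\<close> collects the elements on whose band some \<open>b\<close>
    bounds \<open>R\<close>: the excess of each \<open>\<rho>\<close> over \<open>b\<close> is
    disjoint from \<open>d\<close>.\<close>
  define A where "A = {d. 0 < d \<and> (\<exists>b\<ge>0. \<forall>\<rho>\<in>R. inf (pprt (\<rho> - b)) d = 0)}"
  have A_dense: "\<exists>d\<in>A. d \<le> e" if e: "0 < e" for e
  proof -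
    obtain n where n: "\<not> is_sup_in UNIV (inf (real n *\<^sub>R e) ` R) (real n *\<^sub>R e)"
      using finite[OF e] by blast
    obtain d where d: "0 < d" "d \<le> e" "\<And>\<rho>. \<rho> \<in> R \<Longrightarrow> inf (pprt (\<rho> - real n *\<^sub>R e)) d = 0"
      using disjoint_minorant_of_not_infinite[OF R e n] by blast
    have "0 \<le> real n *\<^sub>R e" using e by (simp add: scaleR_nonneg_nonneg)
    then have "d \<in> A" using d unfolding A_def by blast
    then show ?thesis using d(2) by blast
  qed
  define F where "F = {D. D \<subseteq> A \<and> (\<forall>d\<in>D. \<forall>d'\<in>D. d \<noteq> d' \<longrightarrow> inf d d' = 0)}"
  have "\<exists>M\<in>F. \<forall>X\<in>F. M \<subseteq> X \<longrightarrow> X = M"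
  proof (rule subset_Zorn')
    fix C assume C: "subset.chain F C"
    have "inf d d' = 0" if d: "d \<in> \<Union>C" "d' \<in> \<Union>C" "d \<noteq> d'" for d d'
    proof -
      obtain X Y where XY: "X \<in> C" "Y \<in> C" "d \<in> X" "d' \<in> Y" using d by blast
      then have "X \<subseteq> Y \<or> Y \<subseteq> X" using C unfolding subset.chain_def by blast
      then obtain Z where "Z \<in> C" "d \<in> Z" "d' \<in> Z" using XY by blast
      then show ?thesis using C d(3) unfolding subset.chain_def F_def by blast
    qed
    moreover have "\<Union>C \<subseteq> A" using C unfolding subset.chain_def F_def by blast
    ultimately show "\<Union>C \<in> F" unfolding F_def by blast
  qed
  then obtain D where D: "D \<in> F" "\<And>X. X \<in> F \<Longrightarrow> D \<subseteq> X \<Longrightarrow> X = D" by blast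
  have DA: "D \<subseteq> A" and disj: "\<And>d d'. d \<in> D \<Longrightarrow> d' \<in> D \<Longrightarrow> d \<noteq> d' \<Longrightarrow> inf d d' = 0"
    using D(1) unfolding F_def by auto
  \<comment> \<open>For a member \<open>d\<close> of the maximal disjoint family, \<open>b\<close>
    bounds \<open>R\<close> on the band of \<open>d\<close>, and \<open>s\<close> is the projection
    of \<open>b\<close> onto that band.\<close>
  define P where "P d b s \<longleftrightarrow> (\<forall>\<rho>\<in>R. inf (pprt (\<rho> - b)) d = 0) \<and> 0 \<le> s \<and> s \<le> b \<and>
      inf (b - s) d = 0 \<and> (\<forall>x. 0 \<le> x \<longrightarrow> inf x d = 0 \<longrightarrow> inf x s = 0)" for d b s :: 'a
  have "\<exists>b s. P d b s" if "d \<in> D" for d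
  proof -
    obtain b where b: "0 \<le> b" "\<forall>\<rho>\<in>R. inf (pprt (\<rho> - b)) d = 0" and d: "0 \<le> d"
      using \<open>d \<in> D\<close> DA unfolding A_def by auto
    obtain s where "0 \<le> s" "s \<le> b" "inf (b - s) d = 0" "\<And>x. 0 \<le> x \<Longrightarrow> inf x d = 0 \<Longrightarrow> inf x s = 0"
      using band_projection_exists[OF complete b(1) d] by blast
    then show ?thesis using b(2) unfolding P_def by blast
  qed
  then obtain b s where "\<And>d. d \<in> D \<Longrightarrow> P d (b d) (s d)" by metis
  then have b: "\<And>d \<rho>. d \<in> D \<Longrightarrow> \<rho> \<in> R \<Longrightarrow> inf (pprt (\<rho> - b d)) d = 0"
    and s: "\<And>d. d \<in> D \<Longrightarrow> 0 \<le> s d" "\<And>d. d \<in> D \<Longrightarrow> s d \<le> b d"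
      "\<And>d. d \<in> D \<Longrightarrow> inf (b d - s d) d = 0"
      "\<And>d x. d \<in> D \<Longrightarrow> 0 \<le> x \<Longrightarrow> inf x d = 0 \<Longrightarrow> inf x (s d) = 0"
    unfolding P_def by blast+
  have D0: "0 \<le> d" if "d \<in> D" for d using that DA unfolding A_def by auto
  \<comment> \<open>Disjointness passes from \<open>D\<close> to the projected bounds, in one
    argument and then in the other, so universal completeness supplies a common bound
    \<open>w\<close> for them.\<close>
  have "inf x y = 0" if xy: "x \<in> s ` D" "y \<in> s ` D" "x \<noteq> y" for x y
  proof -
    obtain d d' where d: "x = s d" "y = s d'" "d \<in> D" "d' \<in> D" "d \<noteq> d'" using xy by blast
    then have "inf d' (s d) = 0" using s(4)[OF d(3) D0[OF d(4)]] disj by blast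
    then have "inf (s d) d' = 0" by (simp add: inf_commute)
    then show ?thesis using s(4)[OF d(4) s(1)[OF d(3)]] d(1,2) by blast
  qed
  moreover have "\<forall>x\<in>s ` D. 0 \<le> x" using s(1) by blast
  ultimately obtain w where w: "\<And>d. d \<in> D \<Longrightarrow> s d \<le> w"
    using uc unfolding universally_complete_def by (metis imageI subset_UNIV)
  have "\<rho> \<le> w" if \<rho>: "\<rho> \<in> R" for \<rho>
  proof (rule ccontr)
    assume "\<not> \<rho> \<le> w"
    then have "pprt (\<rho> - w) \<noteq> 0" by (simp flip: le_zero_iff_zero_pprt)
    then have "0 < pprt (\<rho> - w)" by (simp add: order_less_le)
    then obtain a where a: "a \<in> A" "a \<le> pprt (\<rho> - w)" using A_dense by blast
    have a0: "0 < a" using a(1) unfolding A_def by blast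
    \<comment> \<open>The excess of \<open>\<rho>\<close> over \<open>s d\<close> is at most the
      excess over \<open>b d\<close> plus the remainder \<open>b d - s d\<close>, and both are
      disjoint from \<open>d\<close>. So \<open>a\<close> could be added to \<open>D\<close>,
      against maximality.\<close>
    have da: "inf a d = 0" if d: "d \<in> D" for d
    proof (rule antisym)
      have "\<rho> - s d = (\<rho> - b d) + (b d - s d)" by simp
      also have "\<dots> \<le> pprt (\<rho> - b d) + (b d - s d)" by (rule add_right_mono) (simp add: pprt_def)
      finally have "pprt (\<rho> - s d) \<le> pprt (\<rho> - b d) + (b d - s d)"
        using s(2)[OF d] by (simp add: pprt_def[of "\<rho> - s d"])
      moreover have "pprt (\<rho> - w) \<le> pprt (\<rho> - s d)"
        using w[OF d] by (intro pprt_mono diff_left_mono)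
      ultimately have "a \<le> pprt (\<rho> - b d) + (b d - s d)" using a(2) by (meson order_trans)
      then have "inf a d \<le> inf (pprt (\<rho> - b d) + (b d - s d)) d" by (rule inf_mono) simp
      also have "\<dots> \<le> inf (pprt (\<rho> - b d)) d + inf (b d - s d) d"
        using s(2)[OF d] D0[OF d] by (intro inf_add_le) simp_all
      also have "\<dots> = 0" using b[OF d \<rho>] s(3)[OF d] by simp
      finally show "inf a d \<le> 0" .
    qed (use a0 D0[OF d] in simp)
    then have "insert a D \<in> F"
      using a(1) DA disj unfolding F_def by (auto simp: inf_commute)
    then have "a \<in> D" using D(2) by blast
    then show False using da[of a] a0 by simp
  qed
  then show thesis using that by blast
qed

section \<open>Normed lattices\<close>

lemma normed_latticeD:
  assumes "normed_lattice H N" "x \<in> H" "y \<in> H"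
  shows "0 \<le> N x" "N x = 0 \<longleftrightarrow> x = 0" "N (c *\<^sub>R x) = \<bar>c\<bar> * N x" "N (x + y) \<le> N x + N y"
    "\<bar>x\<bar> \<le> \<bar>y\<bar> \<Longrightarrow> N x \<le> N y" "0 \<le> x \<Longrightarrow> x \<le> y \<Longrightarrow> N x \<le> N y" "N \<bar>x\<bar> = N x" "sublattice H"
proof -
  show s: "sublattice H" using assms(1) unfolding normed_lattice_def by blast
  show "0 \<le> N x" "N x = 0 \<longleftrightarrow> x = 0" "N (c *\<^sub>R x) = \<bar>c\<bar> * N x" "N (x + y) \<le> N x + N y"
    and mono: "\<bar>x\<bar> \<le> \<bar>y\<bar> \<Longrightarrow> N x \<le> N y"
    using assms unfolding normed_lattice_def by auto
  show "N x \<le> N y" if "0 \<le> x" "x \<le> y"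
    using mono that order_trans[OF that] by simp
  have "\<bar>x\<bar> \<in> H" using s assms(2) by (simp add: sublatticeD)
  then show "N \<bar>x\<bar> = N x"
    using assms(1,2) unfolding normed_lattice_def by (intro antisym) auto
qed

lemma archimedean_on_normed_lattice:
  assumes "normed_lattice H N"
  shows "archimedean_on H"
  unfolding archimedean_on_def
proof (intro ballI impI)
  fix x y assume x: "x \<in> H" "0 \<le> x" and y: "y \<in> H" "\<forall>n::nat. real n *\<^sub>R x \<le> y"
  have s: "sublattice H" using assms unfolding normed_lattice_def by blast
  have "real n * N x \<le> N y" for n :: nat
  proof -
    have n: "real n *\<^sub>R x \<in> H" using s x by (simp add: sublatticeD)
    have "N (real n *\<^sub>R x) \<le> N y"
      using normed_latticeD(6)[OF assms n y(1)] x y(2) by (simp add: scaleR_nonneg_nonneg)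
    then show ?thesis using normed_latticeD(3)[OF assms x(1,1), of "real n"] by simp
  qed
  then have "N x \<le> 0"
    by (metis linorder_not_le reals_Archimedean3)
  then show "x = 0" using normed_latticeD(1,2)[OF assms x(1,1)] by simp
qed

lemma demicontinuous_withD:
  assumes N: "normed_lattice H N" and r: "demicontinuous_with r H N" and s: "0 < s"
    and P: "P \<subseteq> pos_ball H N s" "increases_to H P f"
  shows "N f \<le> r * s"
proof -
  have H: "sublattice H" using N unfolding normed_lattice_def by blast
  have fH: "f \<in> H" using P(2) unfolding increases_to_def is_sup_in_def by blast
  have inc: "increases_to H ((*\<^sub>R) (inverse s) ` P) (inverse s *\<^sub>R f)"
    using s by (intro increases_to_scaleR[OF H P(2)]) simp
  have "inverse s *\<^sub>R p \<in> pos_ball H N 1" if "p \<in> P" for p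
  proof -
    have p: "p \<in> H" "0 \<le> p" "N p \<le> s" using that P(1) unfolding pos_ball_def by auto
    have "N (inverse s *\<^sub>R p) = inverse s * N p" using normed_latticeD(3)[OF N p(1,1)] s by simp
    also have "\<dots> \<le> 1" using p(3) s by (simp add: field_simps)
    finally show ?thesis
      using p(1,2) H s unfolding pos_ball_def by (simp add: sublatticeD scaleR_nonneg_nonneg)
  qed
  then have "N (inverse s *\<^sub>R f) \<le> r"
    using r inc sublatticeD(5)[OF H fH fH] unfolding demicontinuous_with_def by blast
  then have "inverse s * N f \<le> r" using normed_latticeD(3)[OF N fH fH, of "inverse s"] s by simp
  then show ?thesis using s by (simp add: field_simps)
qed

section \<open>The Lorentz completion\<close>

locale demicontinuous_lattice =
  fixes r :: real and N :: "'f::vector_lattice \<Rightarrow> real" and \<iota> :: "'f \<Rightarrow> 'u::vector_lattice"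
  assumes r: "1 \<le> r" and N: "normed_lattice UNIV N" and demi: "demicontinuous_with r UNIV N"
    and uc: "universal_completion \<iota>"
begin

lemma emb: "lattice_embedding \<iota>" and dense: "order_dense_sublattice (range \<iota>) UNIV"
  and uc_UNIV: "universally_complete (UNIV :: 'u set)"
  using uc unfolding universal_completion_def by auto

lemma complete: "order_complete (UNIV :: 'u set)"
  using uc_UNIV unfolding universally_complete_def by blast

lemma arch: "archimedean_on (UNIV :: 'u set)"
  by (rule archimedean_on_order_complete[OF complete])

lemmas ND = normed_latticeD[OF N UNIV_I UNIV_I]

definition approx :: "real \<Rightarrow> 'u \<Rightarrow> bool" where
  "approx s u \<longleftrightarrow> (\<exists>P\<subseteq>pos_ball UNIV N s. increases_to UNIV (\<iota> ` P) \<bar>u\<bar>)"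

lemma approx_mono: "approx s u \<Longrightarrow> s \<le> t \<Longrightarrow> approx t u"
  unfolding approx_def pos_ball_def by (auto intro: order_trans)

text \<open>The approximating set \<open>R\<close> may lie anywhere in F^u; what is measured is the
  norm of the elements of F below it. Most proofs of \<open>approx\<close> go through this form when
  the natural approximants leave F.\<close>

lemma approx_minorants:
  assumes "increases_to UNIV R \<bar>u\<bar>" "\<And>\<rho>. \<rho> \<in> R \<Longrightarrow> 0 \<le> \<rho>"
    and "\<And>\<rho> g. \<rho> \<in> R \<Longrightarrow> 0 \<le> g \<Longrightarrow> \<iota> g \<le> \<rho> \<Longrightarrow> N g \<le> s"
  shows "approx s u"
proof -
  have "increases_to UNIV (\<iota> ` minorants \<iota> R) \<bar>u\<bar>"
    by (rule increases_to_minorants[OF emb sublattice_UNIV arch dense assms(1,2)])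
  moreover have "minorants \<iota> R \<subseteq> pos_ball UNIV N s"
    using assms(3) unfolding minorants_def pos_ball_def by blast
  ultimately show ?thesis unfolding approx_def by blast
qed

text \<open>The truncations \<open>inf \<bar>v\<bar> (\<iota> p)\<close> increase to
  \<open>\<bar>v\<bar>\<close> but need not come from F; an element of F below one of them is below
  \<open>p\<close>, so solidity of \<open>N\<close> bounds it by \<open>s\<close>.\<close>

lemma approx_solid:
  assumes "approx s u" "\<bar>v\<bar> \<le> \<bar>u\<bar>"
  shows "approx s v"
proof -
  obtain P where P: "P \<subseteq> pos_ball UNIV N s" "increases_to UNIV (\<iota> ` P) \<bar>u\<bar>"
    using assms(1) unfolding approx_def by blast
  show ?thesis
  proof (rule approx_minorants[where R = "inf \<bar>v\<bar> ` \<iota> ` P"])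
    show "increases_to UNIV (inf \<bar>v\<bar> ` \<iota> ` P) \<bar>v\<bar>"
      using increases_to_inf_const[OF sublattice_UNIV P(2) UNIV_I, of "\<bar>v\<bar>"] assms(2)
      by (simp add: inf_absorb1)
    show "0 \<le> \<rho>" if "\<rho> \<in> inf \<bar>v\<bar> ` \<iota> ` P" for \<rho>
      using that P(1) unfolding pos_ball_def by (auto simp: lattice_embeddingD[OF emb])
    fix \<rho> g assume \<rho>: "\<rho> \<in> inf \<bar>v\<bar> ` \<iota> ` P" and g: "0 \<le> g" "\<iota> g \<le> \<rho>"
    obtain p where p: "p \<in> P" "\<rho> = inf \<bar>v\<bar> (\<iota> p)" using \<rho> by blast
    then have "g \<le> p" using g(2) by (simp add: lattice_embedding_le_iff[OF emb])
    then have "N g \<le> N p" by (rule ND(6)[OF g(1)])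
    also have "\<dots> \<le> s" using p P(1) unfolding pos_ball_def by blast
    finally show "N g \<le> s" .
  qed
qed

lemma approx_embedding: "N f \<le> s \<Longrightarrow> approx s (\<iota> f)"
  unfolding approx_def pos_ball_def
  by (intro exI[of _ "{\<bar>f\<bar>}"]) (simp add: ND(7) lattice_embeddingD[OF emb] increases_to_singleton)

lemma approx_0: "0 \<le> s \<Longrightarrow> approx s 0"
  using approx_embedding[of 0 s] ND(2)[of 0] by (simp add: lattice_embeddingD[OF emb])

lemma approx_add:
  assumes "approx s u" "approx t v"
  shows "approx (s + t) (u + v)"
proof -
  obtain P where P: "P \<subseteq> pos_ball UNIV N s" "increases_to UNIV (\<iota> ` P) \<bar>u\<bar>"
    using assms(1) unfolding approx_def by blast
  obtain Q where Q: "Q \<subseteq> pos_ball UNIV N t" "increases_to UNIV (\<iota> ` Q) \<bar>v\<bar>"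
    using assms(2) unfolding approx_def by blast
  let ?R = "{p + q |p q. p \<in> P \<and> q \<in> Q}"
  have "\<iota> ` ?R = {a + b |a b. a \<in> \<iota> ` P \<and> b \<in> \<iota> ` Q}"
    by (rule image_binary_op) (rule lattice_embeddingD[OF emb])
  then have "increases_to UNIV (\<iota> ` ?R) (\<bar>u\<bar> + \<bar>v\<bar>)"
    using increases_to_add[OF sublattice_UNIV P(2) Q(2)] by simp
  moreover have "?R \<subseteq> pos_ball UNIV N (s + t)"
  proof
    fix x assume "x \<in> ?R"
    then obtain p q where x: "x = p + q" "p \<in> P" "q \<in> Q" by blast
    then have "0 \<le> p" "0 \<le> q" "N p \<le> s" "N q \<le> t" using P(1) Q(1) unfolding pos_ball_def by auto
    then show "x \<in> pos_ball UNIV N (s + t)"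
      using ND(4)[of p q] unfolding x(1) pos_ball_def by simp
  qed
  ultimately have "approx (s + t) (\<bar>u\<bar> + \<bar>v\<bar>)"
    unfolding approx_def by (intro exI[of _ ?R]) simp
  then show ?thesis
    by (rule approx_solid) (simp add: abs_triangle_ineq)
qed

lemma approx_scaleR:
  assumes "approx s u" "0 \<le> s"
  shows "approx (\<bar>c\<bar> * s) (c *\<^sub>R u)"
proof (cases "c = 0")
  case False
  obtain P where P: "P \<subseteq> pos_ball UNIV N s" "increases_to UNIV (\<iota> ` P) \<bar>u\<bar>"
    using assms(1) unfolding approx_def by blast
  have "increases_to UNIV ((*\<^sub>R) \<bar>c\<bar> ` \<iota> ` P) (\<bar>c\<bar> *\<^sub>R \<bar>u\<bar>)"
    using False by (intro increases_to_scaleR[OF sublattice_UNIV P(2)]) simp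
  then have "increases_to UNIV (\<iota> ` (*\<^sub>R) \<bar>c\<bar> ` P) \<bar>c *\<^sub>R u\<bar>"
    by (simp add: image_image lattice_embeddingD[OF emb] abs_scaleR_vector_lattice)
  moreover have "(*\<^sub>R) \<bar>c\<bar> ` P \<subseteq> pos_ball UNIV N (\<bar>c\<bar> * s)"
    using P(1) unfolding pos_ball_def
    by (auto simp: ND(3) scaleR_nonneg_nonneg intro!: mult_left_mono)
  ultimately show ?thesis unfolding approx_def by blast
qed (use assms approx_0 in simp)

text \<open>Truncating at \<open>\<bar>g\<bar>\<close> stays inside F, and
  \<open>inf \<bar>g\<bar> p\<close> increases to \<open>\<bar>g\<bar>\<close> there, so
  demicontinuity applies at the price of a factor \<open>r\<close>.\<close>

lemma approx_le:
  assumes "approx s u" "0 < s" "\<bar>\<iota> g\<bar> \<le> \<bar>u\<bar>"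
  shows "N g \<le> r * s"
proof -
  obtain P where P: "P \<subseteq> pos_ball UNIV N s" "increases_to UNIV (\<iota> ` P) \<bar>u\<bar>"
    using assms(1) unfolding approx_def by blast
  have "increases_to UNIV (inf \<bar>\<iota> g\<bar> ` \<iota> ` P) \<bar>\<iota> g\<bar>"
    using increases_to_inf_const[OF sublattice_UNIV P(2) UNIV_I, of "\<bar>\<iota> g\<bar>"] assms(3)
    by (simp add: inf_absorb1)
  then have "increases_to UNIV (\<iota> ` inf \<bar>g\<bar> ` P) (\<iota> \<bar>g\<bar>)"
    by (simp add: image_image lattice_embeddingD[OF emb])
  then have "increases_to UNIV (inf \<bar>g\<bar> ` P) \<bar>g\<bar>"
    by (rule increases_to_lattice_embeddingD[OF emb subset_UNIV])
  moreover have "inf \<bar>g\<bar> ` P \<subseteq> pos_ball UNIV N s"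
  proof
    fix x assume "x \<in> inf \<bar>g\<bar> ` P"
    then obtain p where p: "x = inf \<bar>g\<bar> p" "p \<in> P" by blast
    then have "0 \<le> x" "N p \<le> s" using P(1) unfolding pos_ball_def by auto
    moreover have "N x \<le> N p" using ND(6)[OF \<open>0 \<le> x\<close>, of p] p by simp
    ultimately show "x \<in> pos_ball UNIV N s" unfolding pos_ball_def by simp
  qed
  ultimately have "N \<bar>g\<bar> \<le> r * s" using demicontinuous_withD[OF N demi assms(2)] by blast
  then show ?thesis by (simp add: ND(7))
qed

text \<open>
  If \<open>P\<close> were infinite on the band of some \<open>\<iota> g > 0\<close>, then \<open>N (n g) \<le> r s\<close> for all \<open>n\<close> by
  demicontinuity.
\<close>

lemma bounded_in_universal_completion:
  assumes s: "0 < s" and P: "directed_up P" "P \<subseteq> pos_ball UNIV N s"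
  obtains w where "\<And>p. p \<in> P \<Longrightarrow> \<iota> p \<le> w"
proof -
  have "\<exists>n. \<not> is_sup_in UNIV (inf (real n *\<^sub>R e) ` \<iota> ` P) (real n *\<^sub>R e)" if e: "0 < e" for e
  proof (rule ccontr)
    assume "\<not> ?thesis"
    then have inf: "is_sup_in UNIV (inf (real n *\<^sub>R e) ` \<iota> ` P) (real n *\<^sub>R e)" for n by blast
    obtain g where g: "0 < g" "\<iota> g \<le> e"
      using dense e unfolding order_dense_sublattice_def by (auto simp: lattice_embeddingD[OF emb])
    have "N (real n *\<^sub>R g) \<le> r * s" for n
    proof -
      have le: "\<iota> (real n *\<^sub>R g) \<le> real n *\<^sub>R e"
        using g(2) by (simp add: lattice_embeddingD[OF emb] scaleR_left_mono)
      \<comment> \<open>The element \<open>e\<close> lies in F^u, so the level \<open>n e\<close> is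
        replaced by the smaller level \<open>\<iota> (n g)\<close>. A second truncation at that
        level gives the elements \<open>inf (n g) p\<close> of F.\<close>
      have "is_sup_in UNIV (inf (\<iota> (real n *\<^sub>R g)) ` inf (real n *\<^sub>R e) ` \<iota> ` P) (\<iota> (real n *\<^sub>R g))"
        using is_sup_in_inf[OF sublattice_UNIV subset_UNIV inf UNIV_I, of "\<iota> (real n *\<^sub>R g)" n] le
        by (simp add: inf_absorb1)
      moreover have "inf (\<iota> (real n *\<^sub>R g)) (inf (real n *\<^sub>R e) (\<iota> p)) = \<iota> (inf (real n *\<^sub>R g) p)" for p
        using le by (simp add: lattice_embeddingD[OF emb] inf_absorb1 flip: inf_assoc)
      ultimately have "is_sup_in UNIV (\<iota> ` inf (real n *\<^sub>R g) ` P) (\<iota> (real n *\<^sub>R g))"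
        by (simp add: image_image)
      moreover have "directed_up (inf (real n *\<^sub>R g) ` P)"
        by (rule directed_up_image[OF P(1)]) (rule inf_mono; simp)
      ultimately have "increases_to UNIV (inf (real n *\<^sub>R g) ` P) (real n *\<^sub>R g)"
        by (intro increases_to_lattice_embeddingD[OF emb subset_UNIV])
          (simp add: increases_to_def directed_up_lattice_embedding_iff[OF emb])
      moreover have "inf (real n *\<^sub>R g) ` P \<subseteq> pos_ball UNIV N s"
      proof
        fix x assume "x \<in> inf (real n *\<^sub>R g) ` P"
        then obtain p where p: "x = inf (real n *\<^sub>R g) p" "p \<in> P" by blast
        moreover have "0 \<le> real n *\<^sub>R g" using g(1) by (simp add: scaleR_nonneg_nonneg)
        ultimately have x: "0 \<le> x" "N p \<le> s" using P(2) unfolding pos_ball_def by auto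
        moreover have "N x \<le> N p" using ND(6)[OF x(1), of p] p by simp
        ultimately show "x \<in> pos_ball UNIV N s" unfolding pos_ball_def by simp
      qed
      ultimately show ?thesis using demicontinuous_withD[OF N demi s] by blast
    qed
    then have "real n * N g \<le> r * s" for n by (simp add: ND(3))
    then have "N g \<le> 0" by (metis linorder_not_le reals_Archimedean3)
    then have "g = 0" using ND(1,2)[of g] by simp
    then show False using g(1) by simp
  qed
  moreover have "\<iota> ` P \<noteq> {}" using P(1) unfolding directed_up_def by blast
  moreover have "0 \<le> \<rho>" if "\<rho> \<in> \<iota> ` P" for \<rho>
    using that P(2) unfolding pos_ball_def by (auto simp: lattice_embeddingD[OF emb])
  ultimately obtain w where "\<And>\<rho>. \<rho> \<in> \<iota> ` P \<Longrightarrow> \<rho> \<le> w"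
    using universally_complete_bounded[OF uc_UNIV] by metis
  then show thesis using that by blast
qed

text \<open>By \<open>approx_le\<close> with \<open>t\<close> tending to \<open>s\<close>, every
  minorant of \<open>R\<close> has norm at most \<open>r * s\<close>. The minorants are thus a norm
  bounded directed set, hence order bounded in F^u, and \<open>R\<close> has a supremum there with
  the same minorants as approximating set. The hypothesis is stated for all \<open>t > s\<close>
  because a Lorentz norm of at most \<open>s\<close> provides no more.\<close>

lemma directed_sup_exists:
  assumes s: "0 < s" and R: "directed_up R" "\<And>\<rho>. \<rho> \<in> R \<Longrightarrow> 0 \<le> \<rho>"
    and ap: "\<And>\<rho> t. \<rho> \<in> R \<Longrightarrow> s < t \<Longrightarrow> approx t \<rho>"
  obtains u where "increases_to UNIV R u" "approx (r * s) u"
proof -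
  have le: "N g \<le> r * s" if "\<rho> \<in> R" "0 \<le> g" "\<iota> g \<le> \<rho>" for g \<rho>
  proof (rule field_le_epsilon)
    fix e :: real assume e: "0 < e"
    \<comment> \<open>Chosen so that \<open>r * t = r * s + e\<close>.\<close>
    define t where "t = s + e / r"
    have t: "s < t" "0 < t" "r * t = r * s + e" using e r s by (simp_all add: t_def field_simps add_pos_pos)
    have "N g \<le> r * t"
      using that R(2) by (intro approx_le[OF ap[OF that(1) t(1)] t(2)]) (simp add: lattice_embeddingD[OF emb])
    then show "N g \<le> r * s + e" using t(3) by simp
  qed
  have rs: "0 < r * s" using r s by simp
  have "minorants \<iota> R \<subseteq> pos_ball UNIV N (r * s)"
    using le unfolding minorants_def pos_ball_def by blast
  then obtain w where w: "\<And>g. g \<in> minorants \<iota> R \<Longrightarrow> \<iota> g \<le> w"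
    using bounded_in_universal_completion[OF rs directed_up_minorants[OF emb R]] by blast
  have "\<rho> \<le> w" if \<rho>: "\<rho> \<in> R" for \<rho>
  proof (rule is_sup_inD(3))
    show "is_sup_in UNIV (\<iota> ` minorants \<iota> {\<rho>}) \<rho>"
      using increases_to_minorants_singleton[OF emb sublattice_UNIV arch dense UNIV_I R(2)[OF \<rho>]]
      unfolding increases_to_def by blast
    show "x \<le> w" if "x \<in> \<iota> ` minorants \<iota> {\<rho>}" for x
      using that w \<rho> unfolding minorants_def by blast
  qed simp
  moreover have "R \<noteq> {}" using R(1) unfolding directed_up_def by blast
  ultimately obtain u where u: "is_sup_in UNIV R u"
    using order_completeD[OF complete subset_UNIV _ UNIV_I] by metis
  then have inc: "increases_to UNIV R u" using R(1) unfolding increases_to_def by blast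
  have "0 \<le> u" using \<open>R \<noteq> {}\<close> R(2) is_sup_inD(2)[OF u] by (meson ex_in_conv order_trans)
  then have "approx (r * s) u" using inc by (intro approx_minorants[OF _ R(2) le]) simp_all
  then show thesis using that inc by blast
qed

text \<open>For a regulating set \<open>Q\<close> of the net, the elements
  \<open>pprt (\<bar>u\<bar> - q)\<close> increase to \<open>\<bar>u\<bar>\<close>, and each lies
  below \<open>\<bar>x i\<bar>\<close> for some term \<open>x i = \<iota> f\<close> of the net.
  Every minorant in F is then below \<open>\<bar>f\<bar>\<close> and has norm at most 1.\<close>

lemma order_adherence_imp_approx:
  assumes "u \<in> order_adherence UNIV (\<iota> ` {f. N f \<le> 1})"
  shows "approx 1 u"
proof -
  obtain A :: "('u \<times> 'u set) set" and le x where A: "x ` A \<subseteq> \<iota> ` {f. N f \<le> 1}" "order_converges UNIV A le x u"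
      "directed_index A le"
    using assms unfolding order_adherence_def by blast
  then obtain Q where Q: "decreases_to UNIV Q 0" "\<And>q. q \<in> Q \<Longrightarrow> \<exists>i\<in>A. \<forall>j\<in>A. le i j \<longrightarrow> \<bar>x j - u\<bar> \<le> q"
    unfolding order_converges_def by blast
  let ?R = "(\<lambda>q. pprt (\<bar>u\<bar> - q)) ` Q"
  have Q0: "0 \<le> q" if "q \<in> Q" for q using Q(1) that unfolding decreases_to_def is_inf_in_def by blast
  show ?thesis
  proof (rule approx_minorants[where R = ?R])
    have "\<bar>u\<bar> \<le> h" if h: "\<And>q. q \<in> Q \<Longrightarrow> pprt (\<bar>u\<bar> - q) \<le> h" for h
    proof -
      have "\<bar>u\<bar> - h \<le> 0"
      proof (rule is_inf_in_greatest[OF Q(1)])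
        fix q assume "q \<in> Q"
        then have "\<bar>u\<bar> - q \<le> h" using h by (auto simp: pprt_def)
        then show "\<bar>u\<bar> - h \<le> q" by (simp add: diff_le_eq add.commute)
      qed simp
      then show ?thesis by simp
    qed
    moreover have "pprt (\<bar>u\<bar> - q) \<le> \<bar>u\<bar>" if "q \<in> Q" for q
      using Q0[OF that] by (simp add: pprt_def diff_le_eq)
    ultimately have "is_sup_in UNIV ?R \<bar>u\<bar>"
      unfolding is_sup_in_def by blast
    moreover have "directed_up ?R"
      unfolding directed_up_def
    proof (intro conjI ballI)
      show "?R \<noteq> {}" using Q(1) unfolding decreases_to_def directed_down_def by blast
      fix a b assume "a \<in> ?R" "b \<in> ?R"
      then obtain q q' where q: "a = pprt (\<bar>u\<bar> - q)" "b = pprt (\<bar>u\<bar> - q')" "q \<in> Q" "q' \<in> Q" by blast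
      then obtain z where z: "z \<in> Q" "z \<le> q" "z \<le> q'"
        using Q(1) unfolding decreases_to_def directed_down_def by blast
      then have "a \<le> pprt (\<bar>u\<bar> - z)" "b \<le> pprt (\<bar>u\<bar> - z)"
        unfolding q by (auto intro: pprt_mono diff_left_mono)
      then show "\<exists>c\<in>?R. a \<le> c \<and> b \<le> c" using z(1) by blast
    qed
    ultimately show "increases_to UNIV ?R \<bar>u\<bar>" unfolding increases_to_def by simp
    fix \<rho> g assume g: "\<rho> \<in> ?R" "0 \<le> g" "\<iota> g \<le> \<rho>"
    then obtain q where q: "q \<in> Q" "\<rho> = pprt (\<bar>u\<bar> - q)" by blast
    obtain i where i: "i \<in> A" "\<bar>x i - u\<bar> \<le> q"
      using Q(2)[OF q(1)] A(3) unfolding directed_index_def by blast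
    obtain f where f: "x i = \<iota> f" "N f \<le> 1" using A(1) i(1) by blast
    have "\<bar>u\<bar> \<le> \<bar>x i\<bar> + \<bar>x i - u\<bar>"
      using abs_triangle_ineq4[of "x i" "x i - u"] by simp
    also have "\<dots> \<le> \<bar>x i\<bar> + q" using i(2) by simp
    finally have "\<rho> \<le> \<bar>x i\<bar>" unfolding q(2) by (simp add: pprt_def diff_le_eq)
    then have "\<iota> g \<le> \<iota> \<bar>f\<bar>" using g(3) f(1) by (simp add: lattice_embeddingD[OF emb])
    then have "g \<le> \<bar>f\<bar>" by (simp add: lattice_embedding_le_iff[OF emb])
    then have "N g \<le> N f" using g(2) by (intro ND(5)) simp
    then show "N g \<le> 1" using f(2) by simp
  qed auto
qed

text \<open>A set increasing to \<open>\<bar>u\<bar>\<close> has lost the signs of \<open>u\<close>,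
  and the parts of \<open>u\<close> need not lie in F. The net is therefore indexed by pairs
  \<open>(a, b)\<close> of minorants of the positive and the negative part with \<open>a + b\<close>
  below some \<open>p\<close>; its terms \<open>a - b\<close> have norm at most 1 because
  \<open>\<bar>a - b\<bar> \<le> p\<close>.\<close>

lemma approx_imp_order_adherence:
  assumes "approx 1 u"
  shows "u \<in> order_adherence UNIV (\<iota> ` {f. N f \<le> 1})"
proof -
  obtain P where P: "P \<subseteq> pos_ball UNIV N 1" "increases_to UNIV (\<iota> ` P) \<bar>u\<bar>"
    using assms unfolding approx_def by blast
  have P0: "0 \<le> p" "N p \<le> 1" if "p \<in> P" for p using P(1) that unfolding pos_ball_def by auto
  have Pdir: "directed_up P" and Psup: "is_sup_in UNIV (\<iota> ` P) \<bar>u\<bar>"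
    using P(2) unfolding increases_to_def by (auto simp: directed_up_lattice_embedding_iff[OF emb])
  define v w where "v = pprt u" and "w = pprt (- u)"
  have v0: "0 \<le> v" "0 \<le> w" and vw: "inf v w = 0" "u = v - w" "\<bar>u\<bar> = v + w"
    using inf_pprt_eq_0[of u] prts[of u] abs_prts[of u] by (simp_all add: v_def w_def pprt_neg)
  define A where "A = {(a, b). 0 \<le> a \<and> 0 \<le> b \<and> \<iota> a \<le> v \<and> \<iota> b \<le> w \<and> (\<exists>p\<in>P. a + b \<le> p)}"
  define le :: "'f \<times> 'f \<Rightarrow> 'f \<times> 'f \<Rightarrow> bool" where "le = (\<lambda>(a, b) (c, d). a \<le> c \<and> b \<le> d)"
  \<comment> \<open>Minorants of the two parts of \<open>u\<close> are disjoint, so their sum is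
    their supremum. This makes the index set directed: a supremum of elements below \<open>z\<close>
    stays below \<open>z\<close>, a sum need not.\<close>
  have sum_sup: "a + b = sup a b" if "0 \<le> a" "0 \<le> b" "\<iota> a \<le> v" "\<iota> b \<le> w" for a b
  proof -
    have "inf (\<iota> a) (\<iota> b) = 0"
      using inf_eq_0_mono[OF vw(1)] that by (simp add: lattice_embeddingD[OF emb])
    then have "\<iota> (sup a b) = \<iota> (a + b)"
      using sup_eq_add_of_disjoint by (simp add: lattice_embeddingD[OF emb])
    then show ?thesis using emb unfolding lattice_embedding_def by (simp add: inj_eq)
  qed
  have A_dir: "\<exists>k\<in>A. le i k \<and> le j k" if ij: "i \<in> A" "j \<in> A" for i j
  proof -
    obtain a b p where i: "i = (a, b)" "0 \<le> a" "0 \<le> b" "\<iota> a \<le> v" "\<iota> b \<le> w" "p \<in> P" "a + b \<le> p"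
      using ij(1) unfolding A_def by blast
    obtain c d q where j: "j = (c, d)" "0 \<le> c" "0 \<le> d" "\<iota> c \<le> v" "\<iota> d \<le> w" "q \<in> P" "c + d \<le> q"
      using ij(2) unfolding A_def by blast
    obtain z where z: "z \<in> P" "p \<le> z" "q \<le> z" using Pdir i j unfolding directed_up_def by blast
    have ac: "0 \<le> sup a c" "0 \<le> sup b d" "\<iota> (sup a c) \<le> v" "\<iota> (sup b d) \<le> w"
      using i j by (auto simp: lattice_embeddingD[OF emb] intro: le_supI1)
    have "sup (sup a c) (sup b d) \<le> z"
    proof -
      have "a \<le> p" "b \<le> p" "c \<le> q" "d \<le> q"
        using i j by (auto intro: order_trans[of a "a + b"] order_trans[of b "a + b"]
            order_trans[of c "c + d"] order_trans[of d "c + d"])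
      then show ?thesis using z(2,3) by (auto intro: order_trans)
    qed
    then have "sup a c + sup b d \<le> z" using sum_sup[OF ac] by simp
    then have "(sup a c, sup b d) \<in> A" using ac z(1) unfolding A_def by blast
    then show ?thesis unfolding i(1) j(1) le_def by (intro bexI[of _ "(sup a c, sup b d)"]) auto
  qed
  have A_ne: "(0, 0) \<in> A"
  proof -
    obtain p where "p \<in> P" using Pdir unfolding directed_up_def by blast
    then show ?thesis using P0 v0 unfolding A_def by (auto simp: lattice_embeddingD[OF emb])
  qed
  have index: "directed_index A le"
    using A_ne A_dir unfolding directed_index_def by (fastforce simp: le_def intro: order_trans)
  let ?B = "(\<lambda>(a, b). \<iota> a + \<iota> b) ` A"
  \<comment> \<open>Each \<open>y = \<iota> p\<close> equals \<open>inf (v + w) y\<close>, which is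
    at most \<open>inf v y + inf w y\<close>; both summands are suprema of minorants, and these
    minorants form index pairs.\<close>
  have sup: "\<bar>u\<bar> \<le> h" if h: "\<And>a b. (a, b) \<in> A \<Longrightarrow> \<iota> a + \<iota> b \<le> h" for h
  proof (rule is_sup_inD(3)[OF Psup UNIV_I])
    fix y assume "y \<in> \<iota> ` P"
    then obtain p where p: "p \<in> P" "y = \<iota> p" by blast
    have y0: "0 \<le> y" using p P0 by (simp add: lattice_embeddingD[OF emb])
    let ?M = "\<lambda>z. \<iota> ` minorants \<iota> {z}"
    have m: "is_sup_in UNIV (?M z) z" if "0 \<le> z" for z
      using increases_to_minorants_singleton[OF emb sublattice_UNIV arch dense UNIV_I that]
      unfolding increases_to_def by blast
    have "inf v y + inf w y \<le> h"
    proof (rule is_sup_inD(3)[OF is_sup_in_add[OF sublattice_UNIV subset_UNIV subset_UNIV m m]])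
      fix x assume "x \<in> {a + b |a b. a \<in> ?M (inf v y) \<and> b \<in> ?M (inf w y)}"
      then obtain a b where ab: "x = \<iota> a + \<iota> b" "0 \<le> a" "0 \<le> b" "\<iota> a \<le> v" "\<iota> b \<le> w"
          "\<iota> a \<le> \<iota> p" "\<iota> b \<le> \<iota> p" unfolding minorants_def p(2) by auto
      then have "a + b \<le> p" using sum_sup[OF ab(2-5)] by (simp add: lattice_embedding_le_iff[OF emb])
      then have "(a, b) \<in> A" using ab p(1) unfolding A_def by blast
      then show "x \<le> h" using h ab(1) by blast
    qed (use v0 y0 in simp_all)
    moreover have "inf (v + w) y = y"
      using is_sup_inD(2)[OF Psup, of y] p vw(3) by (simp add: inf_absorb2)
    ultimately show "y \<le> h" using inf_add_le[OF v0 y0] by simp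
  qed
  have "is_sup_in UNIV ?B \<bar>u\<bar>"
  proof (rule is_sup_inI)
    show "y \<le> \<bar>u\<bar>" if "y \<in> ?B" for y using that unfolding A_def vw(3) by (auto intro: add_mono)
    show "\<bar>u\<bar> \<le> h" if "\<And>y. y \<in> ?B \<Longrightarrow> y \<le> h" for h
      by (rule sup) (use that in force)
  qed simp
  moreover have "directed_up ?B"
    unfolding directed_up_def
  proof (intro conjI ballI)
    show "?B \<noteq> {}" using A_ne by blast
    fix x y assume "x \<in> ?B" "y \<in> ?B"
    then obtain i j where ij: "i \<in> A" "j \<in> A" "x = (\<lambda>(a, b). \<iota> a + \<iota> b) i" "y = (\<lambda>(a, b). \<iota> a + \<iota> b) j" by blast
    obtain k where k: "k \<in> A" "le i k" "le j k" using A_dir[OF ij(1,2)] by blast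
    then have "x \<le> (\<lambda>(a, b). \<iota> a + \<iota> b) k" "y \<le> (\<lambda>(a, b). \<iota> a + \<iota> b) k"
      unfolding ij le_def by (auto split: prod.splits intro!: add_mono simp: lattice_embedding_le_iff[OF emb])
    then show "\<exists>z\<in>?B. x \<le> z \<and> y \<le> z" using k(1) by blast
  qed
  ultimately have dec: "decreases_to UNIV ((-) \<bar>u\<bar> ` ?B) 0"
    by (intro decreases_to_zero_diff[OF sublattice_UNIV]) (simp add: increases_to_def)
  \<comment> \<open>The distance of \<open>c - d\<close> from \<open>u\<close> is at most the sum of
    the errors on the two parts, and these errors decrease along the index.\<close>
  have near: "\<bar>\<iota> (c - d) - u\<bar> \<le> \<bar>u\<bar> - (\<iota> a + \<iota> b)" if "(a, b) \<in> A" "(c, d) \<in> A" "le (a, b) (c, d)" for a b c d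
  proof -
    have cd: "\<iota> a \<le> \<iota> c" "\<iota> b \<le> \<iota> d" "\<iota> c \<le> v" "\<iota> d \<le> w"
      using that by (auto simp: le_def A_def lattice_embedding_le_iff[OF emb])
    have "\<bar>\<iota> (c - d) - u\<bar> = \<bar>(w - \<iota> d) - (v - \<iota> c)\<bar>"
      unfolding vw(2) by (simp add: lattice_embeddingD[OF emb] algebra_simps)
    also have "\<dots> \<le> \<bar>w - \<iota> d\<bar> + \<bar>v - \<iota> c\<bar>" by (rule abs_triangle_ineq4)
    also have "\<dots> = (w - \<iota> d) + (v - \<iota> c)" using cd by simp
    also have "\<dots> \<le> (w - \<iota> b) + (v - \<iota> a)" using cd by (intro add_mono diff_left_mono)
    finally show ?thesis unfolding vw(3) by (simp add: algebra_simps)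
  qed
  have "order_converges UNIV A le (\<lambda>(a, b). \<iota> (a - b)) u"
    unfolding order_converges_def
  proof (intro conjI exI[of _ "(-) \<bar>u\<bar> ` ?B"] dec ballI)
    fix q assume "q \<in> (-) \<bar>u\<bar> ` ?B"
    then obtain a b where "(a, b) \<in> A" "q = \<bar>u\<bar> - (\<iota> a + \<iota> b)" by auto
    then show "\<exists>i\<in>A. \<forall>j\<in>A. le i j \<longrightarrow> \<bar>(case j of (a, b) \<Rightarrow> \<iota> (a - b)) - u\<bar> \<le> q"
      using near by (intro bexI[of _ "(a, b)"]) auto
  qed auto
  moreover have "(\<lambda>(a, b). \<iota> (a - b)) ` A \<subseteq> \<iota> ` {f. N f \<le> 1}"
  proof clarify
    fix a b assume "(a, b) \<in> A"
    then obtain p where p: "p \<in> P" "a + b \<le> p" "0 \<le> a" "0 \<le> b" unfolding A_def by blast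
    have "\<bar>a - b\<bar> \<le> \<bar>a\<bar> + \<bar>b\<bar>" by (rule abs_triangle_ineq4)
    also have "\<dots> \<le> p" using p by simp
    finally have "N (a - b) \<le> N p" using P0(1)[OF p(1)] by (intro ND(5)) simp
    then have "N (a - b) \<le> 1" using P0(2)[OF p(1)] by simp
    then show "\<iota> (a - b) \<in> \<iota> ` {f. N f \<le> 1}" by blast
  qed
  ultimately show ?thesis using index by (intro order_adherenceI)
qed

lemma lorentz_ball_eq: "lorentz_ball N \<iota> = {u. approx 1 u}"
  unfolding lorentz_ball_def using order_adherence_imp_approx approx_imp_order_adherence by blast

lemma lorentz_space_iff: "u \<in> lorentz_space N \<iota> \<longleftrightarrow> (\<exists>s>0. approx s u)"
proof
  assume "u \<in> lorentz_space N \<iota>"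
  then obtain n :: nat and v where v: "u = real n *\<^sub>R v" "approx 1 v"
    unfolding lorentz_space_def lorentz_ball_eq by blast
  then have "approx (real n) u" using approx_scaleR[OF v(2), of "real n"] by simp
  \<comment> \<open>The union includes \<open>n = 0\<close>, while the radius must be
    positive.\<close>
  then have "approx (real n + 1) u" by (rule approx_mono) simp
  then show "\<exists>s>0. approx s u" by (intro exI[of _ "real n + 1"]) simp
next
  assume "\<exists>s>0. approx s u"
  then obtain s where s: "0 < s" "approx s u" by blast
  obtain n :: nat where n: "s \<le> real n" using real_arch_simple by blast
  have n0: "0 < real n" using s n by simp
  have "approx (\<bar>inverse (real n)\<bar> * s) (inverse (real n) *\<^sub>R u)"
    using s by (intro approx_scaleR) simp_all
  then have "approx 1 (inverse (real n) *\<^sub>R u)"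
    using n n0 by (elim approx_mono) (simp add: field_simps)
  then show "u \<in> lorentz_space N \<iota>"
    unfolding lorentz_space_def lorentz_ball_eq
    using n0 by (intro UN_I[of n] image_eqI[of _ _ "inverse (real n) *\<^sub>R u"]) simp_all
qed

end

section \<open>Monotone completeness\<close>

text \<open>One inequality for scalars is enough: the converse follows by applying it to
  \<open>inverse c\<close>, and the value at 0 by taking \<open>c = 0\<close>.\<close>

lemma normed_latticeI:
  assumes H: "sublattice H" and nonneg: "\<And>x. x \<in> H \<Longrightarrow> 0 \<le> N x"
    and zero: "\<And>x. x \<in> H \<Longrightarrow> N x = 0 \<Longrightarrow> x = 0"
    and scale: "\<And>c x. x \<in> H \<Longrightarrow> N (c *\<^sub>R x) \<le> \<bar>c\<bar> * N x"
    and triangle: "\<And>x y. x \<in> H \<Longrightarrow> y \<in> H \<Longrightarrow> N (x + y) \<le> N x + N y"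
    and solid: "\<And>x y. x \<in> H \<Longrightarrow> y \<in> H \<Longrightarrow> \<bar>x\<bar> \<le> \<bar>y\<bar> \<Longrightarrow> N x \<le> N y"
  shows "normed_lattice H N"
proof -
  have sc: "N (c *\<^sub>R x) = \<bar>c\<bar> * N x" if x: "x \<in> H" for c x
  proof (cases "c = 0")
    case True
    have "N (0 *\<^sub>R x) \<le> 0" "0 \<le> N (0 *\<^sub>R x)"
      using scale[OF x, of 0] nonneg[of "0 *\<^sub>R x"] sublatticeD(5)[OF H x x, of 0] by simp_all
    then show ?thesis using True by simp
  next
    case False
    have "N x = N (inverse c *\<^sub>R (c *\<^sub>R x))" using False by simp
    also have "\<dots> \<le> \<bar>inverse c\<bar> * N (c *\<^sub>R x)" by (rule scale[OF sublatticeD(5)[OF H x x]])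
    finally have "\<bar>c\<bar> * N x \<le> N (c *\<^sub>R x)" using False by (simp add: field_simps)
    then show ?thesis using scale[OF x, of c] by simp
  qed
  have "N x = 0 \<longleftrightarrow> x = 0" if "x \<in> H" for x
    using zero[OF that] sc[OF that, of 0] by auto
  then show ?thesis
    unfolding normed_lattice_def using H nonneg sc triangle solid by blast
qed

lemma normed_lattice_diff_commute:
  assumes "normed_lattice H N" "x \<in> H" "y \<in> H"
  shows "N (x - y) = N (y - x)"
proof -
  have "y - x \<in> H" using normed_latticeD(8)[OF assms] assms(2,3) by (simp add: sublatticeD)
  from normed_latticeD(3)[OF assms(1) this this, of "- 1"] show ?thesis by simp
qed

lemma normed_lattice_diff_triangle:
  assumes "normed_lattice H N" "x \<in> H" "y \<in> H" "z \<in> H"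
  shows "N (x - z) \<le> N (x - y) + N (y - z)"
proof -
  have "x - y \<in> H" "y - z \<in> H" using normed_latticeD(8)[OF assms(1-3)] assms(2-4) by (simp_all add: sublatticeD)
  from normed_latticeD(4)[OF assms(1) this] show ?thesis by simp
qed

lemma normed_lattice_sum:
  assumes N: "normed_lattice H N" and x: "\<And>i. i \<in> A \<Longrightarrow> x i \<in> H" and A: "finite A"
  shows "sum x A \<in> H \<and> N (sum x A) \<le> (\<Sum>i\<in>A. N (x i))"
  using A x
proof (induction A)
  case empty
  have s: "sublattice H" using N unfolding normed_lattice_def by blast
  then have "0 \<in> H" unfolding sublattice_def by (blast intro: subspace_0)
  then show ?case using normed_latticeD(2)[OF N, of 0 0] by simp
next
  case (insert a A)
  have s: "sublattice H" using N unfolding normed_lattice_def by blast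
  have "x a \<in> H" "sum x A \<in> H" "N (sum x A) \<le> (\<Sum>i\<in>A. N (x i))" using insert by auto
  then show ?case
    using insert(1,2) normed_latticeD(4)[OF N, of "x a" "sum x A"] s by (simp add: sublatticeD)
qed

lemma normed_lattice_sup_diff:
  assumes N: "normed_lattice H N" and abcd: "a \<in> H" "b \<in> H" "c \<in> H" "d \<in> H"
  shows "N (sup a b - sup c d) \<le> N (a - c) + N (b - d)"
proof -
  have s: "sublattice H" using N unfolding normed_lattice_def by blast
  have H: "sup a b - sup c d \<in> H" "a - c \<in> H" "b - d \<in> H" "\<bar>a - c\<bar> \<in> H" "\<bar>b - d\<bar> \<in> H" "\<bar>a - c\<bar> + \<bar>b - d\<bar> \<in> H"
    using s abcd by (simp_all add: sublatticeD)
  have "N (sup a b - sup c d) \<le> N (\<bar>a - c\<bar> + \<bar>b - d\<bar>)"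
    using abs_sup_diff_le[of a b c d] by (intro normed_latticeD(5)[OF N H(1,6)]) simp
  also have "\<dots> \<le> N \<bar>a - c\<bar> + N \<bar>b - d\<bar>" by (rule normed_latticeD(4)[OF N H(4,5)])
  also have "\<dots> = N (a - c) + N (b - d)"
    using normed_latticeD(7)[OF N H(2,2)] normed_latticeD(7)[OF N H(3,3)] by simp
  finally show ?thesis .
qed

section \<open>From monotone completeness to norm completeness\<close>

lemma monotonically_complete_withD:
  assumes N: "normed_lattice H N" and mc: "monotonically_complete_with r H N" and s: "0 < s"
    and P: "P \<subseteq> pos_ball H N s" "directed_up P"
  obtains f where "is_sup_in H P f" "N f \<le> r * s"
proof -
  have H: "sublattice H" using N unfolding normed_lattice_def by blast
  have "inverse s *\<^sub>R p \<in> pos_ball H N 1" if "p \<in> P" for p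
  proof -
    have p: "p \<in> H" "0 \<le> p" "N p \<le> s" using that P(1) unfolding pos_ball_def by auto
    have "N (inverse s *\<^sub>R p) = inverse s * N p" using normed_latticeD(3)[OF N p(1,1)] s by simp
    also have "\<dots> \<le> 1" using p(3) s by (simp add: field_simps)
    finally show ?thesis
      using p(1,2) H s unfolding pos_ball_def by (simp add: sublatticeD scaleR_nonneg_nonneg)
  qed
  moreover have "directed_up ((*\<^sub>R) (inverse s) ` P)"
    using s by (intro directed_up_image[OF P(2)] scaleR_left_mono) simp_all
  ultimately obtain f where f: "is_sup_in H ((*\<^sub>R) (inverse s) ` P) f" "N f \<le> r"
    using mc unfolding monotonically_complete_with_def by blast
  have fH: "f \<in> H" using is_sup_inD(1)[OF f(1)] .
  have "is_sup_in H ((*\<^sub>R) s ` (*\<^sub>R) (inverse s) ` P) (s *\<^sub>R f)"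
    by (rule is_sup_in_scaleR[OF H f(1) s])
  then have "is_sup_in H P (s *\<^sub>R f)" using s by (simp add: image_image)
  moreover have "N (s *\<^sub>R f) \<le> r * s"
    using normed_latticeD(3)[OF N fH fH, of s] s f(2) by (simp add: mult.commute mult_right_mono)
  ultimately show thesis using that by blast
qed

lemma monotonically_complete_demicontinuous:
  assumes "monotonically_complete_with r H N"
  shows "demicontinuous_with r H N"
  unfolding demicontinuous_with_def
proof (intro allI impI)
  fix P f assume P: "P \<subseteq> pos_ball H N 1 \<and> f \<in> H \<and> increases_to H P f"
  then obtain g where "is_sup_in H P g" "N g \<le> r"
    using assms unfolding monotonically_complete_with_def increases_to_def by blast
  moreover have "is_sup_in H P f" using P unfolding increases_to_def by blast
  ultimately show "N f \<le> r" using is_sup_in_unique by blast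
qed

text \<open>Monotone completeness is applied to every tail separately: the sums starting at
  \<open>n\<close> have norm at most \<open>2 * (1/2) ^ n\<close>, the geometric bound, so they have
  a supremum \<open>b n\<close> of norm at most \<open>r\<close> times that. Since
  \<open>S n + b n\<close> is always the supremum of all partial sums, \<open>b 0\<close> is the sum
  and \<open>b n\<close> its error.\<close>

lemma monotonically_complete_series:
  assumes N: "normed_lattice H N" and mc: "monotonically_complete_with r H N"
    and y: "\<And>i. y i \<in> H" "\<And>i. 0 \<le> y i" "\<And>i. N (y i) \<le> (1/2) ^ i"
  obtains a where "a \<in> H" "\<And>n. N (a - (\<Sum>i<n. y i)) \<le> r * (2 * (1/2) ^ n)"
proof -
  have H: "sublattice H" using N unfolding normed_lattice_def by blast
  define S where "S n = (\<Sum>i<n. y i)" for n :: nat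
  have SH: "S n \<in> H" for n unfolding S_def using normed_lattice_sum[OF N, of "{..<n}" y] y(1) by simp
  have mono: "S m \<le> S n" if "m \<le> n" for m n
    unfolding S_def using that y(2) by (intro sum_mono2) auto
  have "\<exists>b. is_sup_in H (range (\<lambda>m. S (n + m) - S n)) b \<and> N b \<le> r * (2 * (1/2) ^ n)" for n
  proof -
    have "S (n + m) - S n \<in> pos_ball H N (2 * (1/2) ^ n)" for m
    proof -
      have eq: "S (n + m) - S n = (\<Sum>i<m. y (n + i))"
        by (induction m) (simp_all add: S_def algebra_simps)
      have "N (S (n + m) - S n) \<le> (\<Sum>i<m. N (y (n + i)))"
        unfolding eq using normed_lattice_sum[OF N, of "{..<m}" "\<lambda>i. y (n + i)"] y(1) by simp
      also have "\<dots> \<le> (\<Sum>i<m. (1/2) ^ (n + i))" by (intro sum_mono y(3))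
      also have "\<dots> = (1/2) ^ n * (\<Sum>i<m. (1/2) ^ i)" by (simp add: power_add sum_distrib_left)
      also have "\<dots> \<le> (1/2) ^ n * 2"
        by (intro mult_left_mono) (simp_all add: geometric_sum)
      finally show ?thesis
        using SH H mono[of n "n + m"] unfolding pos_ball_def by (simp add: sublatticeD)
    qed
    then have "range (\<lambda>m. S (n + m) - S n) \<subseteq> pos_ball H N (2 * (1/2) ^ n)" by blast
    moreover have "directed_up (range (\<lambda>m. S (n + m) - S n))"
      unfolding directed_up_def
    proof (intro conjI ballI)
      fix u v assume "u \<in> range (\<lambda>m. S (n + m) - S n)" "v \<in> range (\<lambda>m. S (n + m) - S n)"
      then obtain k l where "u = S (n + k) - S n" "v = S (n + l) - S n" by blast
      then have "u \<le> S (n + (k + l)) - S n" "v \<le> S (n + (k + l)) - S n"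
        by (auto intro!: diff_right_mono mono)
      then show "\<exists>z\<in>range (\<lambda>m. S (n + m) - S n). u \<le> z \<and> v \<le> z" by blast
    qed blast
    moreover have "(0::real) < 2 * (1/2) ^ n" by simp
    ultimately show ?thesis using monotonically_complete_withD[OF N mc] by metis
  qed
  then obtain b where b: "\<And>n. is_sup_in H (range (\<lambda>m. S (n + m) - S n)) (b n)"
    "\<And>n. N (b n) \<le> r * (2 * (1/2) ^ n)" by metis
  have sup: "is_sup_in H (range S) (S n + b n)" for n
  proof -
    have s: "is_sup_in H ((+) (S n) ` range (\<lambda>m. S (n + m) - S n)) (S n + b n)"
      using H SH b(1) by (intro is_sup_in_plus) (auto simp: sublatticeD)
    show ?thesis
    proof (rule is_sup_inI)
      show "S n + b n \<in> H" by (rule is_sup_inD(1)[OF s])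
      fix p assume "p \<in> range S"
      then obtain m where "p = S m" by blast
      then have "p \<le> S (n + m)" using mono by simp
      also have "\<dots> \<le> S n + b n" using is_sup_inD(2)[OF s, of "S (n + m)"] by (auto simp: image_iff)
      finally show "p \<le> S n + b n" .
    next
      fix h assume "h \<in> H" "\<And>p. p \<in> range S \<Longrightarrow> p \<le> h"
      then show "S n + b n \<le> h" by (intro is_sup_inD(3)[OF s]) auto
    qed
  qed
  have b0: "b 0 = S n + b n" for n
    using is_sup_in_unique[OF sup[of 0] sup[of n]] by (simp add: S_def)
  show thesis
  proof
    show "b 0 \<in> H" using is_sup_inD(1)[OF b(1)] .
    show "N (b 0 - (\<Sum>i<n. y i)) \<le> r * (2 * (1/2) ^ n)" for n
      using b(2)[of n] unfolding b0[of n] S_def by simp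
  qed
qed

text \<open>A Cauchy sequence is thinned until its increments have norm at most
  \<open>(1/2) ^ n\<close>. Their positive and negative parts form two series of nonnegative terms,
  each of which has a sum by monotone completeness.\<close>

lemma monotonically_complete_banach_lattice:
  assumes N: "normed_lattice H N" and r: "1 \<le> r" and mc: "monotonically_complete_with r H N"
  shows "banach_lattice H N"
  unfolding banach_lattice_def
proof (intro conjI allI impI N)
  have H: "sublattice H" using N unfolding normed_lattice_def by blast
  fix s :: "nat \<Rightarrow> 'a"
  assume s: "range s \<subseteq> H \<and> (\<forall>e>0. \<exists>k. \<forall>m\<ge>k. \<forall>n\<ge>k. N (s m - s n) < e)"
  then have sH: "s n \<in> H" for n by blast
  have "\<exists>k. \<forall>m\<ge>k. \<forall>n\<ge>k. N (s m - s n) < (1/2) ^ j" for j :: nat using s by simp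
  then obtain K where K: "\<And>j m n. K j \<le> m \<Longrightarrow> K j \<le> n \<Longrightarrow> N (s m - s n) < (1/2) ^ j" by metis
  \<comment> \<open>Summing the thresholds makes \<open>k\<close> monotone while keeping
    \<open>K n \<le> k n\<close>.\<close>
  define k where "k n = (\<Sum>i\<le>n. K i)" for n :: nat
  have kK: "K n \<le> k n" for n unfolding k_def by (cases n) auto
  have kS: "k n \<le> k (Suc n)" for n unfolding k_def by simp
  define x where "x n = s (k (Suc n)) - s (k n)" for n
  have x: "x n \<in> H" "N (x n) \<le> (1/2) ^ n" for n
    using H sH K[OF order_trans[OF kK kS] kK, of n] unfolding x_def by (auto simp: sublatticeD less_imp_le)
  have xs: "(\<Sum>i<n. x i) = s (k n) - s (k 0)" for n
    unfolding x_def by (induction n) simp_all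
  have part: "pprt (x n) \<in> H" "pprt (- x n) \<in> H" "N (pprt (x n)) \<le> (1/2) ^ n" "N (pprt (- x n)) \<le> (1/2) ^ n" for n
  proof -
    have m: "- x n \<in> H" by (rule sublatticeD(4)[OF H x(1) x(1)])
    show p: "pprt (x n) \<in> H" "pprt (- x n) \<in> H"
      by (rule sublatticeD(9)[OF H x(1) x(1)], rule sublatticeD(9)[OF H m m])
    have "pprt (x n) \<le> \<bar>x n\<bar>" "pprt (- x n) \<le> \<bar>x n\<bar>"
      using abs_ge_self[of "x n"] abs_ge_minus_self[of "x n"] by (simp_all add: pprt_def)
    then have "N (pprt (x n)) \<le> N (x n)" "N (pprt (- x n)) \<le> N (x n)"
      using normed_latticeD(5)[OF N] p x by simp_all
    then show "N (pprt (x n)) \<le> (1/2) ^ n" "N (pprt (- x n)) \<le> (1/2) ^ n"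
      using x(2)[of n] by linarith+
  qed
  obtain a where a: "a \<in> H" "\<And>n. N (a - (\<Sum>i<n. pprt (x i))) \<le> r * (2 * (1/2) ^ n)"
    using monotonically_complete_series[OF N mc part(1) zero_le_pprt part(3)] by blast
  obtain b where b: "b \<in> H" "\<And>n. N (b - (\<Sum>i<n. pprt (- x i))) \<le> r * (2 * (1/2) ^ n)"
    using monotonically_complete_series[OF N mc part(2) zero_le_pprt part(4)] by blast
  define l where "l = s (k 0) + (a - b)"
  have l: "l \<in> H" using H sH a b by (simp add: l_def sublatticeD)
  \<comment> \<open>Each of the two series contributes an error of \<open>2 * r * (1/2) ^ n\<close>,
    and the Cauchy estimate between \<open>s m\<close> and \<open>s (k n)\<close> contributes
    \<open>(1/2) ^ n\<close>.\<close>
  have est: "N (s m - l) \<le> (1 + 4 * r) * (1/2) ^ n" if m: "k n \<le> m" for m n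
  proof -
    let ?A = "a - (\<Sum>i<n. pprt (x i))" and ?B = "b - (\<Sum>i<n. pprt (- x i))"
    have AB: "?A \<in> H" "?B \<in> H"
      using normed_lattice_sum[OF N, of "{..<n}" "\<lambda>i. pprt (x i)"]
        normed_lattice_sum[OF N, of "{..<n}" "\<lambda>i. pprt (- x i)"] part H a(1) b(1)
      by (auto simp: sublatticeD)
    have "s (k n) - l = (\<Sum>i<n. x i) - a + b" unfolding xs l_def by simp
    also have "(\<Sum>i<n. x i) = (\<Sum>i<n. pprt (x i)) - (\<Sum>i<n. pprt (- x i))"
      unfolding sum_subtractf[symmetric] pprt_neg by (intro sum.cong refl) (simp flip: prts)
    finally have "s (k n) - l = ?B - ?A" by (simp add: algebra_simps)
    then have "N (s (k n) - l) \<le> N (?B - 0) + N (0 - ?A)"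
      using normed_lattice_diff_triangle[OF N AB(2) sublatticeD(1)[OF H AB] AB(1)] by simp
    also have "N (0 - ?A) = N ?A"
      using normed_lattice_diff_commute[OF N sublatticeD(1)[OF H AB] AB(1)] by simp
    finally have "N (s (k n) - l) \<le> 4 * r * (1/2) ^ n" using a(2)[of n] b(2)[of n] by simp
    moreover have "N (s m - s (k n)) \<le> (1/2) ^ n"
      using K[of n m "k n"] kK[of n] m by simp
    ultimately show ?thesis
      using normed_lattice_diff_triangle[OF N sH sH l, of m "k n"] by (simp add: algebra_simps)
  qed
  have "(\<lambda>n. N (s n - l)) \<longlonglongrightarrow> 0"
  proof (rule LIMSEQ_I)
    fix e :: real assume e: "0 < e"
    have C: "0 < 1 + 4 * r" using r by simp
    obtain n where n: "(1/2 :: real) ^ n < e / (1 + 4 * r)"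
      using real_arch_pow_inv[of "e / (1 + 4 * r)" "1/2"] e C by auto
    then have "(1 + 4 * r) * (1/2) ^ n < e" using C by (simp add: field_simps)
    then have "norm (N (s m - l) - 0) < e" if "k n \<le> m" for m
      using est[OF that] normed_latticeD(1)[OF N, of "s m - l" l] H sH l by (simp add: sublatticeD)
    then show "\<exists>no. \<forall>m\<ge>no. norm (N (s m - l) - 0) < e" by blast
  qed
  then show "\<exists>l\<in>H. (\<lambda>n. N (s n - l)) \<longlonglongrightarrow> 0" using l by blast
qed

context demicontinuous_lattice
begin

section \<open>The Lorentz space with its norm as a Banach lattice\<close>

abbreviation FL :: "'u set" where "FL \<equiv> lorentz_space N \<iota>"
abbreviation NL :: "'u \<Rightarrow> real" where "NL \<equiv> lorentz_norm N \<iota>"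

lemma lorentz_norm_Inf: "NL u = Inf {s. 0 < s \<and> approx s u}"
  unfolding lorentz_norm_def approx_def ..

lemma lorentz_norm_le: "0 < s \<Longrightarrow> approx s u \<Longrightarrow> NL u \<le> s"
  unfolding lorentz_norm_Inf by (rule cInf_lower) (auto intro: bdd_belowI[of _ 0])

lemma approx_of_lorentz_norm_less:
  assumes "u \<in> FL" "NL u < t"
  shows "approx t u"
proof -
  have "{s. 0 < s \<and> approx s u} \<noteq> {}" using assms(1) unfolding lorentz_space_iff by blast
  then obtain s where "0 < s" "approx s u" "s < t"
    using cInf_lessD[of "{s. 0 < s \<and> approx s u}" t] assms(2) unfolding lorentz_norm_Inf by blast
  then show ?thesis by (auto intro: approx_mono)
qed

lemma lorentz_norm_nonneg: "u \<in> FL \<Longrightarrow> 0 \<le> NL u"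
  unfolding lorentz_norm_Inf lorentz_space_iff by (rule cInf_greatest) auto

lemma solid_subspace_FL: "solid_subspace FL"
  unfolding solid_subspace_def
proof (intro conjI ballI allI impI)
  show "subspace FL"
  proof (rule subspaceI)
    show "0 \<in> FL" unfolding lorentz_space_iff using approx_0[of 1] by (intro exI[of _ 1]) simp
    show "u + v \<in> FL" if "u \<in> FL" "v \<in> FL" for u v
      using that approx_add unfolding lorentz_space_iff by (meson add_pos_pos)
    show "c *\<^sub>R u \<in> FL" if "u \<in> FL" for c u
    proof -
      obtain s where s: "0 < s" "approx s u" using \<open>u \<in> FL\<close> unfolding lorentz_space_iff by blast
      have "approx (\<bar>c\<bar> * s + 1) (c *\<^sub>R u)"
        using s(1) by (intro approx_mono[OF approx_scaleR[OF s(2)]]) simp_all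
      moreover have "0 < \<bar>c\<bar> * s + 1" using s(1) by (simp add: add_nonneg_pos)
      ultimately show ?thesis unfolding lorentz_space_iff by blast
    qed
  qed
  show "v \<in> FL" if "u \<in> FL" "\<bar>v\<bar> \<le> \<bar>u\<bar>" for u v
    using that approx_solid unfolding lorentz_space_iff by blast
qed

lemma sublattice_FL: "sublattice FL"
  by (rule sublattice_solid_subspace[OF solid_subspace_FL])

lemma embedding_in_FL: "\<iota> f \<in> FL"
proof -
  have "approx (N f + 1) (\<iota> f)" by (rule approx_embedding) simp
  moreover have "0 < N f + 1" using ND(1)[of f] by simp
  ultimately show ?thesis unfolding lorentz_space_iff by blast
qed

lemma norm_le_lorentz_norm:
  assumes "u \<in> FL" "\<bar>\<iota> g\<bar> \<le> \<bar>u\<bar>"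
  shows "N g \<le> r * NL u"
proof -
  have "N g / r \<le> t" if "NL u < t" for t
  proof -
    have t: "0 < t" using lorentz_norm_nonneg[OF assms(1)] that by simp
    show ?thesis
      using approx_le[OF approx_of_lorentz_norm_less[OF assms(1) that] t assms(2)] r
      by (simp add: field_simps)
  qed
  then have "N g / r \<le> NL u" by (rule dense_ge)
  then show ?thesis using r by (simp add: field_simps)
qed

lemma lorentz_norm_embedding_le: "NL (\<iota> f) \<le> N f"
proof (rule dense_ge)
  fix t assume "N f < t"
  then show "NL (\<iota> f) \<le> t" using ND(1)[of f] by (intro lorentz_norm_le approx_embedding) simp_all
qed

lemma normed_lattice_FL: "normed_lattice FL NL"
proof (rule normed_latticeI[OF sublattice_FL])
  show "0 \<le> NL x" if "x \<in> FL" for x using lorentz_norm_nonneg[OF that] .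
  \<comment> \<open>Definiteness comes from order density: a nonzero \<open>x\<close> dominates some
    \<open>\<iota> g > 0\<close>, and \<open>N g\<close> is at most \<open>r * NL x\<close>.\<close>
  show "x = 0" if x: "x \<in> FL" "NL x = 0" for x
  proof (rule ccontr)
    assume "x \<noteq> 0"
    then obtain g where g: "0 < \<iota> g" "\<iota> g \<le> \<bar>x\<bar>"
      using dense unfolding order_dense_sublattice_def by (metis UNIV_I imageE zero_less_abs_iff)
    then have "N g \<le> 0" using norm_le_lorentz_norm[OF x(1), of g] x(2) by simp
    then have "g = 0" using ND(1,2)[of g] by simp
    then show False using g(1) by (simp add: lattice_embeddingD[OF emb])
  qed
  show "NL (c *\<^sub>R x) \<le> \<bar>c\<bar> * NL x" if x: "x \<in> FL" for c x
  proof (cases "c = 0")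
    case True
    have "NL 0 \<le> 0" by (rule dense_ge) (simp add: lorentz_norm_le approx_0)
    then show ?thesis using True by simp
  next
    case False
    have "NL (c *\<^sub>R x) / \<bar>c\<bar> \<le> t" if "NL x < t" for t
    proof -
      have t: "0 < t" using lorentz_norm_nonneg[OF x] that by simp
      have "NL (c *\<^sub>R x) \<le> \<bar>c\<bar> * t"
        using False t approx_scaleR[OF approx_of_lorentz_norm_less[OF x that], of c]
        by (intro lorentz_norm_le) simp_all
      then show ?thesis using False by (simp add: field_simps)
    qed
    then have "NL (c *\<^sub>R x) / \<bar>c\<bar> \<le> NL x" by (rule dense_ge)
    then show ?thesis using False by (simp add: field_simps)
  qed
  show "NL (x + y) \<le> NL x + NL y" if xy: "x \<in> FL" "y \<in> FL" for x y
  proof (rule field_le_epsilon)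
    fix e :: real assume e: "0 < e"
    have "approx ((NL x + e / 2) + (NL y + e / 2)) (x + y)"
      using e xy by (intro approx_add approx_of_lorentz_norm_less) simp_all
    then have "NL (x + y) \<le> (NL x + e / 2) + (NL y + e / 2)"
      using lorentz_norm_nonneg[OF xy(1)] lorentz_norm_nonneg[OF xy(2)] e by (intro lorentz_norm_le) simp_all
    then show "NL (x + y) \<le> NL x + NL y + e" by simp
  qed
  show "NL x \<le> NL y" if xy: "x \<in> FL" "y \<in> FL" "\<bar>x\<bar> \<le> \<bar>y\<bar>" for x y
  proof (rule dense_ge)
    fix t assume t: "NL y < t"
    show "NL x \<le> t"
      using lorentz_norm_nonneg[OF xy(2)] t approx_solid[OF approx_of_lorentz_norm_less[OF xy(2) t] xy(3)]
      by (intro lorentz_norm_le) simp_all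
  qed
qed

lemmas LD = normed_latticeD[OF normed_lattice_FL]

lemma monotonically_complete_FL: "monotonically_complete_with r FL NL"
  unfolding monotonically_complete_with_def
proof (intro allI impI)
  fix R assume R: "R \<subseteq> pos_ball FL NL 1 \<and> directed_up R"
  then have R': "\<And>\<rho>. \<rho> \<in> R \<Longrightarrow> \<rho> \<in> FL \<and> 0 \<le> \<rho> \<and> NL \<rho> \<le> 1" unfolding pos_ball_def by auto
  obtain u where u: "increases_to UNIV R u" "approx (r * 1) u"
  proof (rule directed_sup_exists[of 1 R])
    show "approx t \<rho>" if "\<rho> \<in> R" "1 < t" for \<rho> t
      using R'[OF that(1)] that(2) by (intro approx_of_lorentz_norm_less) auto
  qed (use R R' in auto)
  have "u \<in> FL" using u(2) r unfolding lorentz_space_iff by (intro exI[of _ r]) simp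
  moreover have "is_sup_in UNIV R u" using u(1) unfolding increases_to_def by blast
  ultimately have "is_sup_in FL R u" unfolding is_sup_in_def by blast
  moreover have "NL u \<le> r" using u(2) r by (intro lorentz_norm_le) simp_all
  ultimately show "\<exists>f. is_sup_in FL R f \<and> NL f \<le> r" by blast
qed

lemma banach_lattice_FL: "banach_lattice FL NL"
  by (rule monotonically_complete_banach_lattice[OF normed_lattice_FL r monotonically_complete_FL])

text \<open>A solid infimal convolution of \<open>N\<close> and \<open>r * NL\<close>. The weight
  \<open>r\<close> is the factor with which \<open>norm_le_lorentz_norm\<close> bounds
  \<open>N\<close> by \<open>NL\<close> on elements of F.\<close>

definition extended_norm :: "'u \<Rightarrow> real" where
  "extended_norm u = Inf {N f + r * NL v |f v. v \<in> FL \<and> \<bar>u\<bar> \<le> \<bar>\<iota> f\<bar> + \<bar>v\<bar>}"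

lemma extended_norm_le:
  assumes "v \<in> FL" "\<bar>u\<bar> \<le> \<bar>\<iota> f\<bar> + \<bar>v\<bar>"
  shows "extended_norm u \<le> N f + r * NL v"
  unfolding extended_norm_def
proof (rule cInf_lower)
  show "bdd_below {N f + r * NL v |f v. v \<in> FL \<and> \<bar>u\<bar> \<le> \<bar>\<iota> f\<bar> + \<bar>v\<bar>}"
    using ND(1) lorentz_norm_nonneg r by (intro bdd_belowI[of _ 0]) auto
qed (use assms in blast)

lemma extended_norm_greatest:
  assumes "u \<in> FL" "\<And>f v. v \<in> FL \<Longrightarrow> \<bar>u\<bar> \<le> \<bar>\<iota> f\<bar> + \<bar>v\<bar> \<Longrightarrow> c \<le> N f + r * NL v"
  shows "c \<le> extended_norm u"
  unfolding extended_norm_def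
proof (rule cInf_greatest)
  have "N 0 + r * NL u \<in> {N f + r * NL v |f v. v \<in> FL \<and> \<bar>u\<bar> \<le> \<bar>\<iota> f\<bar> + \<bar>v\<bar>}"
    using assms(1) by (intro CollectI exI[of _ 0] exI[of _ u]) (simp add: lattice_embeddingD[OF emb])
  then show "{N f + r * NL v |f v. v \<in> FL \<and> \<bar>u\<bar> \<le> \<bar>\<iota> f\<bar> + \<bar>v\<bar>} \<noteq> {}" by blast
qed (use assms(2) in blast)

lemma extended_norm_le_lorentz_norm: "u \<in> FL \<Longrightarrow> extended_norm u \<le> r * NL u"
  using extended_norm_le[of u u 0] ND(2)[of 0] by (simp add: lattice_embeddingD[OF emb])

lemma lorentz_norm_le_extended_norm:
  assumes u: "u \<in> FL"
  shows "NL u \<le> extended_norm u"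
proof (rule extended_norm_greatest[OF u])
  fix f v assume v: "v \<in> FL" "\<bar>u\<bar> \<le> \<bar>\<iota> f\<bar> + \<bar>v\<bar>"
  have a: "\<bar>\<iota> f\<bar> \<in> FL" "\<bar>v\<bar> \<in> FL" "\<bar>\<iota> f\<bar> + \<bar>v\<bar> \<in> FL"
    using sublattice_FL embedding_in_FL v(1) by (simp_all add: sublatticeD)
  have "NL u \<le> NL (\<bar>\<iota> f\<bar> + \<bar>v\<bar>)" using v(2) by (intro LD(5)[OF u a(3)]) simp
  also have "\<dots> \<le> NL \<bar>\<iota> f\<bar> + NL \<bar>v\<bar>" by (rule LD(4)[OF a(1,2)])
  also have "\<dots> = NL (\<iota> f) + NL v"
    using LD(7)[OF embedding_in_FL embedding_in_FL] LD(7)[OF v(1) v(1)] by simp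
  also have "\<dots> \<le> N f + r * NL v"
    using lorentz_norm_embedding_le[of f] mult_right_mono[OF r lorentz_norm_nonneg[OF v(1)]] by simp
  finally show "NL u \<le> N f + r * NL v" .
qed

text \<open>That covering \<open>f\<close> by some \<open>g\<close> and \<open>v\<close> does not
  lower the norm is seen inside F: the part \<open>h\<close> of \<open>\<bar>f\<bar>\<close> not
  covered by \<open>\<bar>g\<bar>\<close> belongs to F and lies below \<open>\<bar>v\<bar>\<close>,
  so \<open>N h \<le> r * NL v\<close>.\<close>

lemma extended_norm_embedding: "extended_norm (\<iota> f) = N f"
proof (rule antisym)
  have "0 \<in> FL" by (rule sublatticeD(1)[OF sublattice_FL embedding_in_FL embedding_in_FL])
  then have "NL 0 = 0" using LD(2)[of 0 0] by simp
  then show "extended_norm (\<iota> f) \<le> N f"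
    using extended_norm_le[of 0 "\<iota> f" f] sublatticeD(1)[OF sublattice_FL embedding_in_FL embedding_in_FL] by simp
  show "N f \<le> extended_norm (\<iota> f)"
  proof (rule extended_norm_greatest[OF embedding_in_FL])
    fix g v assume v: "v \<in> FL" "\<bar>\<iota> f\<bar> \<le> \<bar>\<iota> g\<bar> + \<bar>v\<bar>"
    define h where "h = pprt (\<bar>f\<bar> - \<bar>g\<bar>)"
    have h0: "0 \<le> h" unfolding h_def by simp
    have "\<bar>f\<bar> \<le> \<bar>g\<bar> + h" unfolding h_def using sup_ge1[of "\<bar>f\<bar> - \<bar>g\<bar>" 0] by (simp only: pprt_def diff_le_eq add.commute)
    then have "N \<bar>f\<bar> \<le> N (\<bar>g\<bar> + h)" by (rule ND(6)[rotated]) simp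
    also have "\<dots> \<le> N \<bar>g\<bar> + N h" by (rule ND(4))
    finally have "N f \<le> N g + N h" by (simp add: ND(7))
    moreover have "N h \<le> r * NL v"
    proof (rule norm_le_lorentz_norm[OF v(1)])
      have "\<iota> h = sup (\<bar>\<iota> f\<bar> - \<bar>\<iota> g\<bar>) 0" unfolding h_def pprt_def by (simp add: lattice_embeddingD[OF emb])
      also have "\<dots> \<le> \<bar>v\<bar>" using v(2) by (simp add: diff_le_eq add.commute)
      finally show "\<bar>\<iota> h\<bar> \<le> \<bar>v\<bar>" using h0 by (simp add: lattice_embeddingD[OF emb])
    qed
    ultimately show "N f \<le> N g + r * NL v" by simp
  qed
qed

lemma normed_lattice_extended_norm: "normed_lattice FL extended_norm"
proof (rule normed_latticeI[OF sublattice_FL])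
  show nn: "0 \<le> extended_norm x" if "x \<in> FL" for x
    using lorentz_norm_nonneg[OF that] lorentz_norm_le_extended_norm[OF that] by simp
  show "x = 0" if x: "x \<in> FL" "extended_norm x = 0" for x
  proof -
    have "NL x = 0" using lorentz_norm_nonneg[OF x(1)] lorentz_norm_le_extended_norm[OF x(1)] x(2) by simp
    then show ?thesis using LD(2)[OF x(1) x(1)] by simp
  qed
  show "extended_norm (c *\<^sub>R x) \<le> \<bar>c\<bar> * extended_norm x" if x: "x \<in> FL" for c x
  proof (cases "c = 0")
    case True
    have "extended_norm (\<iota> 0) = N 0" by (rule extended_norm_embedding)
    then show ?thesis using True ND(2)[of 0] by (simp add: lattice_embeddingD[OF emb])
  next
    case False
    have "extended_norm (c *\<^sub>R x) / \<bar>c\<bar> \<le> extended_norm x"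
    proof (rule extended_norm_greatest[OF x])
      fix f v assume v: "v \<in> FL" "\<bar>x\<bar> \<le> \<bar>\<iota> f\<bar> + \<bar>v\<bar>"
      have cv: "c *\<^sub>R v \<in> FL" by (rule sublatticeD(5)[OF sublattice_FL v(1) v(1)])
      have "\<bar>c *\<^sub>R x\<bar> = \<bar>c\<bar> *\<^sub>R \<bar>x\<bar>" by (rule abs_scaleR_vector_lattice)
      also have "\<dots> \<le> \<bar>c\<bar> *\<^sub>R (\<bar>\<iota> f\<bar> + \<bar>v\<bar>)" by (rule scaleR_left_mono[OF v(2)]) simp
      also have "\<dots> = \<bar>\<iota> (c *\<^sub>R f)\<bar> + \<bar>c *\<^sub>R v\<bar>"
        by (simp add: lattice_embeddingD[OF emb] abs_scaleR_vector_lattice scaleR_add_right)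
      finally have "extended_norm (c *\<^sub>R x) \<le> N (c *\<^sub>R f) + r * NL (c *\<^sub>R v)"
        by (rule extended_norm_le[OF cv])
      also have "\<dots> = \<bar>c\<bar> * (N f + r * NL v)"
        using ND(3)[of c f] LD(3)[OF v(1) v(1), of c] by (simp add: algebra_simps)
      finally show "extended_norm (c *\<^sub>R x) / \<bar>c\<bar> \<le> N f + r * NL v"
        using False by (simp add: field_simps)
    qed
    then show ?thesis using False by (simp add: field_simps)
  qed
  show "extended_norm (x + y) \<le> extended_norm x + extended_norm y" if xy: "x \<in> FL" "y \<in> FL" for x y
  proof -
    \<comment> \<open>The two infima are separated by fixing a decomposition of \<open>x\<close> and
      then one of \<open>y\<close>; the absolute values make the combined cover valid.\<close>
    have "extended_norm (x + y) - extended_norm y \<le> extended_norm x"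
    proof (rule extended_norm_greatest[OF xy(1)])
      fix f v assume v: "v \<in> FL" "\<bar>x\<bar> \<le> \<bar>\<iota> f\<bar> + \<bar>v\<bar>"
      have "extended_norm (x + y) - (N f + r * NL v) \<le> extended_norm y"
      proof (rule extended_norm_greatest[OF xy(2)])
        fix g w assume w: "w \<in> FL" "\<bar>y\<bar> \<le> \<bar>\<iota> g\<bar> + \<bar>w\<bar>"
        have avw: "\<bar>v\<bar> \<in> FL" "\<bar>w\<bar> \<in> FL" "\<bar>v\<bar> + \<bar>w\<bar> \<in> FL"
          using sublattice_FL v w by (simp_all add: sublatticeD)
        have "\<bar>x + y\<bar> \<le> \<bar>x\<bar> + \<bar>y\<bar>" by (rule abs_triangle_ineq)
        also have "\<dots> \<le> (\<bar>\<iota> f\<bar> + \<bar>v\<bar>) + (\<bar>\<iota> g\<bar> + \<bar>w\<bar>)" by (rule add_mono[OF v(2) w(2)])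
        also have "\<dots> = \<bar>\<iota> (\<bar>f\<bar> + \<bar>g\<bar>)\<bar> + \<bar>\<bar>v\<bar> + \<bar>w\<bar>\<bar>"
          by (simp add: lattice_embeddingD[OF emb] algebra_simps)
        finally have "extended_norm (x + y) \<le> N (\<bar>f\<bar> + \<bar>g\<bar>) + r * NL (\<bar>v\<bar> + \<bar>w\<bar>)"
          by (rule extended_norm_le[OF avw(3)])
        moreover have "N (\<bar>f\<bar> + \<bar>g\<bar>) \<le> N f + N g" using ND(4)[of "\<bar>f\<bar>" "\<bar>g\<bar>"] by (simp add: ND(7))
        moreover have "r * NL (\<bar>v\<bar> + \<bar>w\<bar>) \<le> r * (NL v + NL w)"
          using LD(4)[OF avw(1,2)] LD(7)[OF v(1) v(1)] LD(7)[OF w(1) w(1)] r by (intro mult_left_mono) simp_all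
        ultimately show "extended_norm (x + y) - (N f + r * NL v) \<le> N g + r * NL w"
          by (simp add: algebra_simps)
      qed
      then show "extended_norm (x + y) - extended_norm y \<le> N f + r * NL v" by simp
    qed
    then show ?thesis by simp
  qed
  show "extended_norm x \<le> extended_norm y" if xy: "x \<in> FL" "y \<in> FL" "\<bar>x\<bar> \<le> \<bar>y\<bar>" for x y
    using xy(3) by (intro extended_norm_greatest[OF xy(2)] extended_norm_le) (auto intro: order_trans)
qed

text \<open>The unit ball of this norm lies in that of \<open>NL\<close>, whose demicontinuity
  constant is \<open>r\<close>; returning from \<open>NL\<close> costs the second factor
  \<open>r\<close>.\<close>

lemma demicontinuous_extended_norm: "demicontinuous_with (r\<^sup>2) FL extended_norm"
  unfolding demicontinuous_with_def
proof (intro allI impI, elim conjE)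
  fix P f assume P: "P \<subseteq> pos_ball FL extended_norm 1" "f \<in> FL" "increases_to FL P f"
  have "P \<subseteq> pos_ball FL NL 1"
    using P(1) lorentz_norm_le_extended_norm unfolding pos_ball_def by fastforce
  then have "NL f \<le> r"
    using monotonically_complete_demicontinuous[OF monotonically_complete_FL] P(2,3)
    unfolding demicontinuous_with_def by blast
  then have "r * NL f \<le> r * r" using r by (intro mult_left_mono) simp_all
  then show "extended_norm f \<le> r\<^sup>2"
    using extended_norm_le_lorentz_norm[OF P(2)] by (simp add: power2_eq_square)
qed

lemma equivalent_extended_norm: "equivalent_norms FL extended_norm NL"
  unfolding equivalent_norms_def
  using extended_norm_le_lorentz_norm lorentz_norm_le_extended_norm r
  by (intro exI[of _ "1 / r"] exI[of _ 1] conjI ballI) (simp_all add: field_simps)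

end

section \<open>The norm completion\<close>

locale completed_demicontinuous_lattice = demicontinuous_lattice r N \<iota>
  for r :: real and N :: "'f::vector_lattice \<Rightarrow> real" and \<iota> :: "'f \<Rightarrow> 'u::vector_lattice" +
  fixes \<kappa> :: "'f \<Rightarrow> 'c::vector_lattice" and M :: "'c \<Rightarrow> real"
  assumes completion: "norm_completion N \<kappa> M"
begin

lemma \<kappa>: "lattice_embedding \<kappa>" and M_norm: "normed_lattice UNIV M"
  and M_\<kappa>: "M (\<kappa> f) = N f" and dense_range: "0 < e \<Longrightarrow> \<exists>f. M (c - \<kappa> f) < e"
  using completion unfolding norm_completion_def banach_lattice_def by auto

lemmas MD = normed_latticeD[OF M_norm UNIV_I UNIV_I]

text \<open>The graph of the isometric embedding of the completion into the Lorentz completion.\<close>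

definition rel :: "'c \<Rightarrow> 'u \<Rightarrow> bool" where
  "rel c u \<longleftrightarrow> u \<in> FL \<and> (\<forall>e>0. \<exists>g. M (c - \<kappa> g) < e \<and> NL (u - \<iota> g) < e)"

text \<open>Elements of F approximating \<open>c\<close> form a Cauchy sequence, their images are
  Cauchy for \<open>NL\<close> because \<open>NL (\<iota> f) \<le> N f\<close>, and F^L is norm
  complete.\<close>

lemma rel_total: "\<exists>u. rel c u"
proof -
  have "\<exists>f. M (c - \<kappa> f) < inverse (real (Suc n))" for n by (rule dense_range) simp
  then obtain g where g: "\<And>n. M (c - \<kappa> (g n)) < inverse (real (Suc n))" by metis
  have cauchy: "NL (\<iota> (g m) - \<iota> (g n)) < e" if e: "0 < e" and k: "inverse (real (Suc k)) < e / 2" "k \<le> m" "k \<le> n" for e k m n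
  proof -
    have small: "M (c - \<kappa> (g j)) < e / 2" if "k \<le> j" for j
    proof -
      have "inverse (real (Suc j)) \<le> inverse (real (Suc k))" using that by (intro le_imp_inverse_le) simp_all
      then show ?thesis using g[of j] k(1) by linarith
    qed
    have "NL (\<iota> (g m) - \<iota> (g n)) \<le> N (g m - g n)"
      using lorentz_norm_embedding_le[of "g m - g n"] by (simp add: lattice_embeddingD[OF emb])
    also have "\<dots> = M (\<kappa> (g m) - \<kappa> (g n))"
      using M_\<kappa>[of "g m - g n"] by (simp add: lattice_embeddingD[OF \<kappa>])
    also have "\<dots> \<le> M (\<kappa> (g m) - c) + M (c - \<kappa> (g n))"
      by (rule normed_lattice_diff_triangle[OF M_norm]) simp_all
    also have "\<dots> < e"
      using small[OF k(2)] small[OF k(3)] normed_lattice_diff_commute[OF M_norm, of c "\<kappa> (g m)"] by simp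
    finally show ?thesis .
  qed
  have "\<exists>k. \<forall>m\<ge>k. \<forall>n\<ge>k. NL (\<iota> (g m) - \<iota> (g n)) < e" if e: "0 < e" for e
    using cauchy[OF e] reals_Archimedean[of "e / 2"] e by (metis half_gt_zero)
  then obtain u where u: "u \<in> FL" "(\<lambda>n. NL (\<iota> (g n) - u)) \<longlonglongrightarrow> 0"
    using banach_lattice_FL[unfolded banach_lattice_def, THEN conjunct2, rule_format, of "\<lambda>n. \<iota> (g n)"]
      embedding_in_FL by blast
  have "\<exists>g. M (c - \<kappa> g) < e \<and> NL (u - \<iota> g) < e" if e: "0 < e" for e
  proof -
    obtain k where k: "inverse (real (Suc k)) < e" using reals_Archimedean[OF e] by blast
    obtain n0 where n0: "\<And>n. n0 \<le> n \<Longrightarrow> norm (NL (\<iota> (g n) - u) - 0) < e"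
      using LIMSEQ_D[OF u(2) e] by blast
    define n where "n = max k n0"
    have "inverse (real (Suc n)) \<le> inverse (real (Suc k))"
      unfolding n_def by (intro le_imp_inverse_le) simp_all
    then have "M (c - \<kappa> (g n)) < e" using g[of n] k by linarith
    moreover have "NL (u - \<iota> (g n)) < e"
      using n0[of n] normed_lattice_diff_commute[OF normed_lattice_FL u(1) embedding_in_FL, of "g n"]
      unfolding n_def by simp
    ultimately show ?thesis by blast
  qed
  then show ?thesis using u(1) unfolding rel_def by blast
qed

lemma rel_\<kappa>: "rel (\<kappa> f) (\<iota> f)"
  unfolding rel_def using embedding_in_FL MD(2)[of 0] LD(2)[OF sublatticeD(1)[OF sublattice_FL embedding_in_FL embedding_in_FL] embedding_in_FL]
  by (intro conjI allI impI exI[of _ f]) simp_all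

lemma rel_scaleR:
  assumes "rel c u"
  shows "rel (a *\<^sub>R c) (a *\<^sub>R u)"
  unfolding rel_def
proof (intro conjI allI impI)
  have u: "u \<in> FL" using assms unfolding rel_def by blast
  show "a *\<^sub>R u \<in> FL" by (rule sublatticeD(5)[OF sublattice_FL u u])
  fix e :: real assume e: "0 < e"
  then have "0 < e / (\<bar>a\<bar> + 1)" by (simp add: add_nonneg_pos)
  then obtain g where g: "M (c - \<kappa> g) < e / (\<bar>a\<bar> + 1)" "NL (u - \<iota> g) < e / (\<bar>a\<bar> + 1)"
    using assms unfolding rel_def by blast
  have ug: "u - \<iota> g \<in> FL" by (rule sublatticeD(3)[OF sublattice_FL u embedding_in_FL])
  have bound: "\<bar>a\<bar> * x < e" if "x < e / (\<bar>a\<bar> + 1)" "0 \<le> x" for x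
  proof -
    have "\<bar>a\<bar> * x \<le> (\<bar>a\<bar> + 1) * x" using that(2) by (intro mult_right_mono) simp_all
    also have "\<dots> < e" using that(1) by (simp add: field_simps add_nonneg_pos)
    finally show ?thesis .
  qed
  have "M (a *\<^sub>R c - \<kappa> (a *\<^sub>R g)) = \<bar>a\<bar> * M (c - \<kappa> g)"
    using MD(3)[of a "c - \<kappa> g"] by (simp add: lattice_embeddingD[OF \<kappa>] scaleR_diff_right)
  moreover have "NL (a *\<^sub>R u - \<iota> (a *\<^sub>R g)) = \<bar>a\<bar> * NL (u - \<iota> g)"
    using LD(3)[OF ug ug, of a] by (simp add: lattice_embeddingD[OF emb] scaleR_diff_right)
  ultimately show "\<exists>g. M (a *\<^sub>R c - \<kappa> g) < e \<and> NL (a *\<^sub>R u - \<iota> g) < e"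
    using bound g MD(1) lorentz_norm_nonneg[OF ug] by (intro exI[of _ "a *\<^sub>R g"]) simp
qed

text \<open>One argument for addition and supremum: an operation with a Lipschitz estimate on both
  sides that restricts to the same operation on F respects the relation.\<close>

lemma rel_binary:
  assumes c: "rel c u" and c': "rel c' u'"
    and uH: "\<And>x y. x \<in> FL \<Longrightarrow> y \<in> FL \<Longrightarrow> opu x y \<in> FL"
    and M: "\<And>a b c d. M (opc a b - opc c d) \<le> M (a - c) + M (b - d)"
    and NL: "\<And>a b c d. a \<in> FL \<Longrightarrow> b \<in> FL \<Longrightarrow> c \<in> FL \<Longrightarrow> d \<in> FL \<Longrightarrow>
      NL (opu a b - opu c d) \<le> NL (a - c) + NL (b - d)"
    and hom: "\<And>f g. opc (\<kappa> f) (\<kappa> g) = \<kappa> (opf f g)" "\<And>f g. opu (\<iota> f) (\<iota> g) = \<iota> (opf f g)"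
  shows "rel (opc c c') (opu u u')"
  unfolding rel_def
proof (intro conjI allI impI)
  have u: "u \<in> FL" "u' \<in> FL" using c c' unfolding rel_def by auto
  then show "opu u u' \<in> FL" by (rule uH)
  fix e :: real assume "0 < e"
  then have "0 < e / 2" by simp
  then obtain g g' where g: "M (c - \<kappa> g) < e / 2" "NL (u - \<iota> g) < e / 2"
    "M (c' - \<kappa> g') < e / 2" "NL (u' - \<iota> g') < e / 2"
    using c c' unfolding rel_def by meson
  have "M (opc c c' - \<kappa> (opf g g')) < e" using M[of c c' "\<kappa> g" "\<kappa> g'"] g(1,3) unfolding hom by simp
  moreover have "NL (opu u u' - \<iota> (opf g g')) < e"
    using NL[OF u embedding_in_FL embedding_in_FL, of g g'] g(2,4) unfolding hom by simp
  ultimately show "\<exists>g. M (opc c c' - \<kappa> g) < e \<and> NL (opu u u' - \<iota> g) < e" by blast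
qed

lemma rel_add:
  assumes "rel c u" "rel c' u'"
  shows "rel (c + c') (u + u')"
proof (rule rel_binary[OF assms])
  show "M (a + b - (c + d)) \<le> M (a - c) + M (b - d)" for a b c d
    using MD(4)[of "a - c" "b - d"] by (simp add: algebra_simps)
  show "NL (a + b - (c + d)) \<le> NL (a - c) + NL (b - d)"
    if "a \<in> FL" "b \<in> FL" "c \<in> FL" "d \<in> FL" for a b c d
    using LD(4)[OF sublatticeD(3)[OF sublattice_FL that(1,3)] sublatticeD(3)[OF sublattice_FL that(2,4)]]
    by (simp add: algebra_simps)
  show "\<kappa> f + \<kappa> g = \<kappa> (f + g)" "\<iota> f + \<iota> g = \<iota> (f + g)" for f g
    by (simp_all add: lattice_embeddingD[OF \<kappa>] lattice_embeddingD[OF emb])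
qed (rule sublatticeD[OF sublattice_FL])

lemma rel_sup:
  assumes "rel c u" "rel c' u'"
  shows "rel (sup c c') (sup u u')"
proof (rule rel_binary[OF assms])
  show "M (sup a b - sup c d) \<le> M (a - c) + M (b - d)" for a b c d
    by (rule normed_lattice_sup_diff[OF M_norm]) simp_all
  show "NL (sup a b - sup c d) \<le> NL (a - c) + NL (b - d)"
    if "a \<in> FL" "b \<in> FL" "c \<in> FL" "d \<in> FL" for a b c d
    by (rule normed_lattice_sup_diff[OF normed_lattice_FL that])
  show "sup (\<kappa> f) (\<kappa> g) = \<kappa> (sup f g)" "sup (\<iota> f) (\<iota> g) = \<iota> (sup f g)" for f g
    by (simp_all add: lattice_embeddingD[OF \<kappa>] lattice_embeddingD[OF emb])
qed (rule sublatticeD[OF sublattice_FL])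

lemma rel_0:
  assumes "rel 0 u"
  shows "u = 0"
proof -
  have u: "u \<in> FL" using assms unfolding rel_def by blast
  have zero: "0 \<in> FL" by (rule sublatticeD(1)[OF sublattice_FL u u])
  have "NL u \<le> 0"
  proof (rule field_le_epsilon)
    fix e :: real assume "0 < e"
    then have "0 < e / 2" by simp
    then obtain g where g: "M (0 - \<kappa> g) < e / 2" "NL (u - \<iota> g) < e / 2"
      using assms unfolding rel_def by blast
    have "NL (\<iota> g) < e / 2"
      using lorentz_norm_embedding_le[of g] M_\<kappa>[of g] g(1) normed_lattice_diff_commute[OF M_norm, of 0 "\<kappa> g"] by simp
    then show "NL u \<le> 0 + e"
      using normed_lattice_diff_triangle[OF normed_lattice_FL u embedding_in_FL zero, of g] g(2) by simp
  qed
  then show ?thesis using LD(2)[OF u u] lorentz_norm_nonneg[OF u] by simp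
qed

lemma rel_unique:
  assumes "rel c u" "rel c u'"
  shows "u = u'"
  using rel_add[OF assms(1) rel_scaleR[OF assms(2), of "- 1"]] rel_0[of "u - u'"] by simp

text \<open>The extended norm agrees with \<open>N\<close> on F and is controlled by
  \<open>NL\<close>, so both sides are close to \<open>N g\<close> for an approximating
  \<open>g\<close>. \<open>NL\<close> itself would not do, since on F it may be smaller than
  \<open>N\<close>.\<close>

lemma rel_norm:
  assumes "rel c u"
  shows "extended_norm u = M c"
proof -
  have u: "u \<in> FL" using assms unfolding rel_def by blast
  have near: "\<bar>extended_norm u - M c\<bar> \<le> e" if e: "0 < e" for e
  proof -
    \<comment> \<open>Passing from \<open>NL\<close> to the extended norm costs a factor
      \<open>r\<close>, which turns this error into \<open>e / 2\<close>; for \<open>M\<close> it is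
      at most \<open>e / 2\<close> because \<open>r \<ge> 1\<close>.\<close>
    have "0 < e / (2 * r)" using e r by simp
    then obtain g where g: "M (c - \<kappa> g) < e / (2 * r)" "NL (u - \<iota> g) < e / (2 * r)"
      using assms unfolding rel_def by blast
    have er: "e / (2 * r) \<le> e / 2" using e r by (simp add: field_simps)
    have ug: "u - \<iota> g \<in> FL" by (rule sublatticeD(3)[OF sublattice_FL u embedding_in_FL])
    have "extended_norm (u - \<iota> g) \<le> r * NL (u - \<iota> g)" by (rule extended_norm_le_lorentz_norm[OF ug])
    also have "\<dots> \<le> e / 2" using g(2) r by (simp add: field_simps)
    finally have 1: "extended_norm (u - \<iota> g) \<le> e / 2" .
    have 2: "M (c - \<kappa> g) \<le> e / 2" using g(1) er by simp
    have z: "0 \<in> FL" by (rule sublatticeD(1)[OF sublattice_FL u u])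
    note t = normed_lattice_diff_triangle[OF normed_lattice_extended_norm]
    note s = normed_lattice_diff_triangle[OF M_norm UNIV_I UNIV_I UNIV_I]
    have "extended_norm u \<le> e / 2 + N g" "N g \<le> e / 2 + extended_norm u"
      using t[OF u embedding_in_FL z, of g] t[OF embedding_in_FL u z, of g] 1 extended_norm_embedding[of g]
        normed_lattice_diff_commute[OF normed_lattice_extended_norm u embedding_in_FL, of g] by simp_all
    moreover have "M c \<le> e / 2 + N g" "N g \<le> e / 2 + M c"
      using s[of c 0 "\<kappa> g"] s[of "\<kappa> g" 0 c] 2 M_\<kappa>[of g]
        normed_lattice_diff_commute[OF M_norm UNIV_I UNIV_I, of c "\<kappa> g"] by simp_all
    ultimately show ?thesis by (simp add: abs_le_iff)
  qed
  have "\<bar>extended_norm u - M c\<bar> \<le> 0" by (rule field_le_epsilon) (use near in simp)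
  then show ?thesis by simp
qed

section \<open>The embedding of the norm completion as an order dense sublattice\<close>

definition J :: "'c \<Rightarrow> 'u" where "J c = (SOME u. rel c u)"

lemma rel_J: "rel c (J c)"
  unfolding J_def using rel_total by (rule someI_ex)

lemma J_eqI: "rel c u \<Longrightarrow> J c = u"
  using rel_unique[OF rel_J] .

lemma lattice_embedding_J: "lattice_embedding J"
proof -
  have add: "J (c + d) = J c + J d" for c d by (intro J_eqI rel_add rel_J)
  have sup: "J (sup c d) = sup (J c) (J d)" for c d by (intro J_eqI rel_sup rel_J)
  have scale: "J (a *\<^sub>R c) = a *\<^sub>R J c" for a c by (intro J_eqI rel_scaleR rel_J)
  have "J (inf c d) = inf (J c) (J d)" for c d
    using add[of "inf c d" "sup c d"] add[of c d] sup[of c d] add_eq_inf_sup[of c d]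
      add_eq_inf_sup[of "J c" "J d"] by (simp add: add.commute)
  then have hom: "lattice_hom UNIV UNIV J"
    unfolding lattice_hom_def linear_on_def using add sup scale by simp
  moreover have "inj J"
  proof (rule lattice_hom_injI[OF hom])
    fix c :: 'c assume c: "0 < c"
    show "J c \<noteq> 0"
    proof
      assume "J c = 0"
      then have "M c = extended_norm (\<iota> 0)"
        using rel_norm[OF rel_J[of c]] by (simp add: lattice_embeddingD[OF emb])
      then have "M c = 0" using extended_norm_embedding[of 0] ND(2)[of 0] by simp
      then show False using MD(2)[of c] c by simp
    qed
  qed
  ultimately show ?thesis unfolding lattice_embedding_def by blast
qed

lemma order_dense_range_J: "order_dense_sublattice (range J) UNIV"
proof -
  note JD = lattice_embeddingD[OF lattice_embedding_J]
  have "sublattice (range J)"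
    unfolding sublattice_def
  proof (intro conjI ballI)
    show "subspace (range J)"
      by (rule subspaceI) (auto simp flip: JD(1,3) intro: range_eqI[where x = 0] simp: JD(6))
    fix x y assume "x \<in> range J" "y \<in> range J"
    then show "sup x y \<in> range J" "inf x y \<in> range J" by (auto simp flip: JD(4,5))
  qed
  moreover have "\<exists>e\<in>range J. 0 < e \<and> e \<le> h" if h: "0 < h" for h
  proof -
    obtain f where "0 < \<iota> f" "\<iota> f \<le> h" using dense h unfolding order_dense_sublattice_def by blast
    then show ?thesis using J_eqI[OF rel_\<kappa>, of f] by (metis rangeI)
  qed
  ultimately show ?thesis unfolding order_dense_sublattice_def by simp
qed

text \<open>An order dense embedding preserves the supremum, first in F^u and then in F^L, which
  contains all elements concerned; the isometry \<open>J\<close> carries over the constant of the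
  extended norm.\<close>

lemma demicontinuous_completion: "demicontinuous_with (r\<^sup>2) UNIV M"
  unfolding demicontinuous_with_def
proof (intro allI impI, elim conjE)
  fix P f assume P: "P \<subseteq> pos_ball UNIV M 1" "increases_to UNIV P f"
  have JF: "J c \<in> FL" "extended_norm (J c) = M c" for c
    using rel_J[of c] rel_norm[OF rel_J[of c]] unfolding rel_def by auto
  have "increases_to UNIV (J ` P) (J f)"
    by (rule increases_to_lattice_embedding[OF lattice_embedding_J sublattice_UNIV order_dense_range_J P(2)])
  then have "increases_to FL (J ` P) (J f)"
    using JF(1) unfolding increases_to_def is_sup_in_def by auto
  moreover have "J ` P \<subseteq> pos_ball FL extended_norm 1"
    using P(1) JF unfolding pos_ball_def by (auto simp: lattice_embeddingD[OF lattice_embedding_J])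
  ultimately have "extended_norm (J f) \<le> r\<^sup>2"
    using demicontinuous_extended_norm JF(1) unfolding demicontinuous_with_def by blast
  then show "M f \<le> r\<^sup>2" unfolding JF(2) .
qed

end

section \<open>Extension of homomorphisms\<close>

context demicontinuous_lattice
begin

lemma order_dense_in_FL: "order_dense_sublattice (range \<iota>) FL"
  using dense embedding_in_FL unfolding order_dense_sublattice_def by auto

lemma arch_FL: "archimedean_on FL"
  using arch by (rule archimedean_on_subset) simp

text \<open>Supplies the hypothesis \<open>bounded\<close> of the extension. The lattice fixed by
  the context is the codomain of \<open>T\<close>: a contractive homomorphism carries the norm
  bounded directed set of minorants to one in the codomain, which is order bounded in its universal
  completion.\<close>

lemma bounded_image_minorants:
  fixes M :: "'e::vector_lattice \<Rightarrow> real" and T :: "'e \<Rightarrow> 'f" and \<kappa> :: "'e \<Rightarrow> 'w::vector_lattice"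
  assumes T: "lattice_hom UNIV UNIV T" "contractive UNIV M N T" and \<kappa>: "lattice_embedding \<kappa>"
    and w: "0 \<le> w" "\<And>f. f \<in> minorants \<kappa> {w} \<Longrightarrow> M f \<le> s"
  shows "\<exists>v. \<forall>f\<in>minorants \<kappa> {w}. \<iota> (T f) \<le> v"
proof -
  have "directed_up (T ` minorants \<kappa> {w})"
  proof (rule directed_up_image)
    show "directed_up (minorants \<kappa> {w})"
      using w(1) by (intro directed_up_minorants[OF \<kappa>]) (auto simp: directed_up_def)
  qed (use lattice_hom_mono[OF T(1)] in simp)
  \<comment> \<open>The radius \<open>\<bar>s\<bar> + 1\<close> is positive whatever the sign of
    \<open>s\<close>.\<close>
  moreover have "T ` minorants \<kappa> {w} \<subseteq> pos_ball UNIV N (\<bar>s\<bar> + 1)"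
  proof
    fix x assume "x \<in> T ` minorants \<kappa> {w}"
    then obtain f where f: "x = T f" "f \<in> minorants \<kappa> {w}" by blast
    have "N x \<le> M f" using T(2) f(1) unfolding contractive_def by simp
    also have "\<dots> \<le> \<bar>s\<bar> + 1" using w(2)[OF f(2)] by simp
    finally have "N x \<le> \<bar>s\<bar> + 1" .
    moreover have "0 \<le> x"
      using f lattice_hom_mono[OF T(1), of 0 f] lattice_hom_0[OF T(1) sublattice_UNIV]
      unfolding minorants_def by simp
    ultimately show "x \<in> pos_ball UNIV N (\<bar>s\<bar> + 1)" unfolding pos_ball_def by simp
  qed
  moreover have "0 < \<bar>s\<bar> + 1" by simp
  ultimately obtain w' where "\<And>p. p \<in> T ` minorants \<kappa> {w} \<Longrightarrow> \<iota> p \<le> w'"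
    using bounded_in_universal_completion by metis
  then show ?thesis by blast
qed

text \<open>Since \<open>\<kappa>\<close> is bounded below by \<open>c\<close>, minorants of
  \<open>w\<close> in F have norm at most \<open>M w / c\<close>. This bounds them in F^u and also
  places the extension in F^L, as the images of the minorants of \<open>\<bar>g\<bar>\<close>
  increase to its modulus. Injectivity holds because every \<open>g > 0\<close> dominates some
  \<open>\<kappa> f > 0\<close>.\<close>

lemma order_dense_embedding_extension:
  fixes M :: "'g::vector_lattice \<Rightarrow> real" and \<kappa> :: "'f \<Rightarrow> 'g"
  assumes M: "normed_lattice UNIV M" and iso: "isomorphic_order_dense_embedding N \<kappa> M"
  shows "\<exists>!J. lattice_hom UNIV FL J \<and> inj J \<and> order_continuous UNIV FL J \<and> (\<forall>f. J (\<kappa> f) = \<iota> f)"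
proof -
  have \<kappa>: "lattice_embedding \<kappa>" and \<kappa>_dense: "order_dense_sublattice (range \<kappa>) UNIV"
    using iso unfolding isomorphic_order_dense_embedding_def by auto
  obtain c where c: "0 < c" "\<And>f. c * N f \<le> M (\<kappa> f)"
    using iso unfolding isomorphic_order_dense_embedding_def by auto
  have archG: "archimedean_on (UNIV :: 'g set)" by (rule archimedean_on_normed_lattice[OF M])
  have small: "N f \<le> M w / c" if f: "f \<in> minorants \<kappa> {w}" for f w
  proof -
    have "0 \<le> \<kappa> f" "\<kappa> f \<le> w" using f unfolding minorants_def by (auto simp: lattice_embeddingD[OF \<kappa>])
    then have "c * N f \<le> M w" using c(2)[of f] normed_latticeD(6)[OF M, of "\<kappa> f" w] by simp
    then show ?thesis using c(1) by (simp add: field_simps)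
  qed
  interpret G: dense_extension \<kappa> UNIV \<iota>
  proof
    show "lattice_hom UNIV UNIV \<iota>" using emb unfolding lattice_embedding_def by blast
    show "is_sup_in UNIV (\<iota> ` P) (\<iota> f)" if "increases_to UNIV P f" for P f
      using increases_to_lattice_embedding[OF emb sublattice_UNIV dense that] unfolding increases_to_def by blast
    show "\<exists>v. \<forall>f\<in>minorants \<kappa> {w}. \<iota> f \<le> v" if "0 \<le> w" for w
    proof -
      have "lattice_hom UNIV UNIV (\<lambda>x::'f. x)" unfolding lattice_hom_def linear_on_def by simp
      moreover have "contractive UNIV N N (\<lambda>x. x)" unfolding contractive_def by simp
      ultimately show ?thesis using bounded_image_minorants[where T = "\<lambda>x. x" and M = N, OF _ _ \<kappa> that small] by blast
    qed
  qed (fact \<kappa> sublattice_UNIV archG \<kappa>_dense complete)+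
  have ext_FL: "G.ext g \<in> FL" for g
  proof -
    have hom: "lattice_hom UNIV UNIV G.ext" by (rule G.lattice_hom_ext) simp
    have "\<bar>G.ext g\<bar> = G.pos_ext \<bar>g\<bar>"
      using lattice_hom_abs[OF hom sublattice_UNIV UNIV_I, of g] G.ext_eq_pos_ext[of "\<bar>g\<bar>"] by simp
    then have sup: "is_sup_in UNIV (\<iota> ` minorants \<kappa> {\<bar>g\<bar>}) \<bar>G.ext g\<bar>"
      using G.is_sup_in_pos_ext[of "\<bar>g\<bar>"] by simp
    have "directed_up (minorants \<kappa> {\<bar>g\<bar>})"
      by (intro directed_up_minorants[OF \<kappa>]) (auto simp: directed_up_def)
    then have "increases_to UNIV (\<iota> ` minorants \<kappa> {\<bar>g\<bar>}) \<bar>G.ext g\<bar>"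
      using sup unfolding increases_to_def by (simp add: directed_up_lattice_embedding_iff[OF emb])
    moreover have "minorants \<kappa> {\<bar>g\<bar>} \<subseteq> pos_ball UNIV N (\<bar>M \<bar>g\<bar> / c\<bar> + 1)"
      using small[of _ "\<bar>g\<bar>"] abs_ge_self[of "M \<bar>g\<bar> / c"] unfolding pos_ball_def by (fastforce simp: minorants_def)
    ultimately have "approx (\<bar>M \<bar>g\<bar> / c\<bar> + 1) (G.ext g)" unfolding approx_def by blast
    moreover have "0 < \<bar>M \<bar>g\<bar> / c\<bar> + 1" by (rule add_nonneg_pos) simp_all
    ultimately show ?thesis unfolding lorentz_space_iff by blast
  qed
  then have sub: "G.ext ` UNIV \<subseteq> FL" by blast
  show ?thesis
  proof (rule ex1I)
    show "lattice_hom UNIV FL G.ext \<and> inj G.ext \<and> order_continuous UNIV FL G.ext \<and> (\<forall>f. G.ext (\<kappa> f) = \<iota> f)"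
    proof (intro conjI allI)
      show hom: "lattice_hom UNIV FL G.ext" by (rule G.lattice_hom_ext[OF sub])
      show "order_continuous UNIV FL G.ext" by (rule G.order_continuous_ext[OF sublattice_FL sub])
      show "G.ext (\<kappa> f) = \<iota> f" for f by (rule G.ext_embedding)
      show "inj G.ext"
      proof (rule lattice_hom_injI[OF hom])
        fix g :: 'g assume "0 < g"
        then obtain f where f: "0 < \<kappa> f" "\<kappa> f \<le> g"
          using \<kappa>_dense unfolding order_dense_sublattice_def by blast
        then have "\<iota> f \<le> G.ext g" using lattice_hom_mono[OF hom, of "\<kappa> f" g] by (simp add: G.ext_embedding)
        moreover have "0 < \<iota> f" using f(1) by (simp add: lattice_embeddingD[OF \<kappa>] lattice_embeddingD[OF emb])
        ultimately show "G.ext g \<noteq> 0" by auto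
      qed
    qed
    fix J assume J: "lattice_hom UNIV FL J \<and> inj J \<and> order_continuous UNIV FL J \<and> (\<forall>f. J (\<kappa> f) = \<iota> f)"
    show "J = G.ext"
    proof
      fix x
      show "J x = G.ext x"
        by (rule order_continuous_unique[OF \<kappa> sublattice_UNIV archG \<kappa>_dense sublattice_FL _
              G.order_continuous_ext[OF sublattice_FL sub]]) (simp_all add: J G.ext_embedding)
    qed
  qed
qed

end

text \<open>The extension is first built with values in the universal completion of the codomain,
  which is order complete; that it maps into the Lorentz completion is read off from approximating
  sets.\<close>

lemma lorentz_extension:
  fixes N :: "'f::vector_lattice \<Rightarrow> real" and \<iota> :: "'f \<Rightarrow> 'u::vector_lattice"
    and M :: "'e::vector_lattice \<Rightarrow> real" and \<iota>' :: "'e \<Rightarrow> 'v::vector_lattice"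
  assumes F: "demicontinuous_lattice r N \<iota>" and E: "demicontinuous_lattice r' M \<iota>'"
    and T: "lattice_hom UNIV UNIV T" "order_continuous UNIV UNIV T" "contractive UNIV N M T"
  defines "H \<equiv> lorentz_space N \<iota>" and "K \<equiv> lorentz_space M \<iota>'"
  shows "\<exists>TL. order_continuous_extension \<iota> H \<iota>' K T TL \<and>
     (\<forall>S. order_continuous_extension \<iota> H \<iota>' K T S \<longrightarrow> (\<forall>u\<in>H. S u = TL u)) \<and>
     lattice_hom H K TL \<and> contractive H (lorentz_norm N \<iota>) (lorentz_norm M \<iota>') TL"
proof -
  interpret F: demicontinuous_lattice r N \<iota> by (rule F)
  interpret E: demicontinuous_lattice r' M \<iota>' by (rule E)
  have T_mono: "T x \<le> T y" if "x \<le> y" for x y using lattice_hom_mono[OF T(1) _ _ that] by simp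
  have T_inc: "increases_to UNIV (\<iota>' ` T ` P) (\<iota>' (T f))" if P: "increases_to UNIV P f" for P f
  proof -
    have "increases_to UNIV (T ` P) (T f)"
      using order_continuous_is_sup_in[OF sublattice_UNIV sublattice_UNIV T(1,2) P] P
      unfolding increases_to_def by (auto intro: directed_up_image T_mono)
    then show ?thesis by (rule increases_to_lattice_embedding[OF E.emb sublattice_UNIV E.dense])
  qed
  interpret X: dense_extension \<iota> H "\<lambda>f. \<iota>' (T f)"
  proof
    show "sublattice H" unfolding H_def by (rule F.sublattice_FL)
    show "archimedean_on H" unfolding H_def by (rule F.arch_FL)
    show "order_dense_sublattice (range \<iota>) H" unfolding H_def by (rule F.order_dense_in_FL)
    show "lattice_hom UNIV UNIV (\<lambda>f. \<iota>' (T f))"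
      using lattice_homD[OF T(1)] unfolding lattice_hom_def linear_on_def
      by (simp add: lattice_embeddingD[OF E.emb])
    show "is_sup_in UNIV ((\<lambda>f. \<iota>' (T f)) ` P) (\<iota>' (T f))" if "increases_to UNIV P f" for P f
      using T_inc[OF that] unfolding increases_to_def by (simp add: image_image)
    show "\<exists>v. \<forall>f\<in>minorants \<iota> {w}. \<iota>' (T f) \<le> v" if w: "w \<in> H" "0 \<le> w" for w
    proof (rule E.bounded_image_minorants[OF T(1,3) F.emb w(2)])
      show "N f \<le> r * lorentz_norm N \<iota> w" if "f \<in> minorants \<iota> {w}" for f
        using that w unfolding minorants_def H_def
        by (intro F.norm_le_lorentz_norm) (auto simp: lattice_embeddingD[OF F.emb])
    qed
  qed (fact F.emb E.complete)+
  have hom: "lattice_hom H UNIV X.ext" by (rule X.lattice_hom_ext) simp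
  \<comment> \<open>The image under \<open>T\<close> of a set approximating \<open>u\<close>
    approximates the image of \<open>u\<close> with the same \<open>s\<close>. This gives both
    membership in \<open>K\<close> and contractivity.\<close>
  have approx: "E.approx s (X.ext u)" if s: "F.approx s u" "u \<in> H" for s u
  proof -
    obtain P where P: "P \<subseteq> pos_ball UNIV N s" "increases_to UNIV (\<iota> ` P) \<bar>u\<bar>"
      using s(1) unfolding F.approx_def by blast
    have uH: "\<bar>u\<bar> \<in> H" by (rule sublatticeD(8)[OF X.H(1) s(2) s(2)])
    have inc: "increases_to H (\<iota> ` P) \<bar>u\<bar>"
      using P(2) uH X.range_subset unfolding increases_to_def is_sup_in_def by auto
    have "is_sup_in UNIV ((\<lambda>f. \<iota>' (T f)) ` P) (X.pos_ext \<bar>u\<bar>)"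
      using P(1) by (intro X.is_sup_in_pos_ext_of_increases_to uH inc) (auto simp: pos_ball_def)
    moreover have "X.pos_ext \<bar>u\<bar> = \<bar>X.ext u\<bar>"
      using lattice_hom_abs[OF hom X.H(1) s(2)] X.ext_eq_pos_ext[OF uH] by simp
    moreover have "directed_up ((\<lambda>f. \<iota>' (T f)) ` P)"
    proof (rule directed_up_image)
      show "directed_up P" using P(2) unfolding increases_to_def by (simp add: directed_up_lattice_embedding_iff[OF F.emb])
    qed (simp add: T_mono lattice_embedding_le_iff[OF E.emb])
    ultimately have "increases_to UNIV (\<iota>' ` T ` P) \<bar>X.ext u\<bar>"
      unfolding increases_to_def by (simp add: image_image)
    moreover have "T ` P \<subseteq> pos_ball UNIV M s"
    proof
      fix x assume "x \<in> T ` P"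
      then obtain p where p: "x = T p" "0 \<le> p" "N p \<le> s" using P(1) unfolding pos_ball_def by blast
      then have "0 \<le> x" using T_mono[of 0 p] lattice_hom_0[OF T(1) sublattice_UNIV] by simp
      moreover have "M x \<le> s" using T(3) p unfolding contractive_def by (auto intro: order_trans)
      ultimately show "x \<in> pos_ball UNIV M s" unfolding pos_ball_def by simp
    qed
    ultimately show ?thesis unfolding E.approx_def by blast
  qed
  have sub: "X.ext ` H \<subseteq> K"
  proof
    fix v assume "v \<in> X.ext ` H"
    then obtain u where u: "v = X.ext u" "u \<in> H" by blast
    then obtain s where "0 < s" "F.approx s u" unfolding H_def F.lorentz_space_iff by blast
    then show "v \<in> K" using approx[OF _ u(2)] u(1) unfolding K_def E.lorentz_space_iff by blast
  qed
  have K: "sublattice K" unfolding K_def by (rule E.sublattice_FL)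
  have oc: "order_continuous H K X.ext" by (rule X.order_continuous_ext[OF K sub])
  show ?thesis
  proof (intro exI[of _ X.ext] conjI allI impI ballI)
    show "order_continuous_extension \<iota> H \<iota>' K T X.ext"
      unfolding order_continuous_extension_def using oc X.range_subset X.ext_embedding by blast
    show "S u = X.ext u" if S: "order_continuous_extension \<iota> H \<iota>' K T S" and u: "u \<in> H" for S u
    proof (rule order_continuous_unique[OF F.emb X.H X.dense K _ oc _ u])
      show "order_continuous H K S" using S unfolding order_continuous_extension_def by blast
      show "S (\<iota> f) = X.ext (\<iota> f)" for f
        using S X.ext_embedding unfolding order_continuous_extension_def by simp
    qed
    show "lattice_hom H K X.ext" by (rule X.lattice_hom_ext[OF sub])
    show "contractive H (lorentz_norm N \<iota>) (lorentz_norm M \<iota>') X.ext"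
      unfolding contractive_def
    proof
      fix u assume u: "u \<in> H"
      show "lorentz_norm M \<iota>' (X.ext u) \<le> lorentz_norm N \<iota> u"
      proof (rule dense_ge)
        fix t assume t: "lorentz_norm N \<iota> u < t"
        have uF: "u \<in> F.FL" using u unfolding H_def .
        show "lorentz_norm M \<iota>' (X.ext u) \<le> t"
          using F.lorentz_norm_nonneg[OF uF] t
          by (intro E.lorentz_norm_le approx[OF F.approx_of_lorentz_norm_less[OF uF t] u]) simp
      qed
    qed
  qed
qed

section \<open>Equivalent norms\<close>

text \<open>The positive ball of radius \<open>s\<close> for \<open>N\<close> is contained in that
  of radius \<open>C * s\<close> for \<open>M\<close>, so the same approximating sets serve both
  norms.\<close>

lemma lorentz_norm_compare:
  assumes F: "demicontinuous_lattice r N \<iota>" and E: "demicontinuous_lattice r' M \<iota>"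
    and C: "0 < C" "\<And>f. M f \<le> C * N f" and u: "u \<in> lorentz_space N \<iota>"
  shows "u \<in> lorentz_space M \<iota>" "lorentz_norm M \<iota> u \<le> C * lorentz_norm N \<iota> u"
proof -
  interpret F: demicontinuous_lattice r N \<iota> by (rule F)
  interpret E: demicontinuous_lattice r' M \<iota> by (rule E)
  have ap: "E.approx (C * s) v" if s: "F.approx s v" for s v
  proof -
    have "M f \<le> C * s" if "N f \<le> s" for f
      using C(2)[of f] mult_left_mono[OF that less_imp_le[OF C(1)]] by (rule order_trans)
    then have "pos_ball UNIV N s \<subseteq> pos_ball UNIV M (C * s)" unfolding pos_ball_def by blast
    then show ?thesis using s unfolding F.approx_def E.approx_def by blast
  qed
  obtain s where "0 < s" "F.approx s u" using u unfolding F.lorentz_space_iff by blast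
  then show "u \<in> lorentz_space M \<iota>"
    unfolding E.lorentz_space_iff using ap C(1) by (intro exI[of _ "C * s"]) simp
  have "lorentz_norm M \<iota> u / C \<le> t" if t: "lorentz_norm N \<iota> u < t" for t
  proof -
    have "0 < t" using F.lorentz_norm_nonneg[OF u] t by simp
    then have "lorentz_norm M \<iota> u \<le> C * t"
      using C(1) by (intro E.lorentz_norm_le ap F.approx_of_lorentz_norm_less u t) simp
    then show ?thesis using C(1) by (simp add: field_simps)
  qed
  then have "lorentz_norm M \<iota> u / C \<le> lorentz_norm N \<iota> u" by (rule dense_ge)
  then show "lorentz_norm M \<iota> u \<le> C * lorentz_norm N \<iota> u" using C(1) by (simp add: field_simps)
qed

text \<open>\<open>M\<close> has demicontinuity constant 1, so its Lorentz norm is monotonically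
  complete, and hence demicontinuous, with constant 1 again. The comparison in both directions makes
  the two Lorentz spaces the same set.\<close>

lemma semicontinuous_lorentz_norm:
  assumes F: "demicontinuous_lattice r N \<iota>" and M: "semicontinuous_norm UNIV M"
    and c: "0 < c" "\<And>f. N f \<le> c * M f" and C: "0 < C" "\<And>f. M f \<le> C * N f"
  shows "semicontinuous_norm (lorentz_space N \<iota>) (lorentz_norm M \<iota>)"
    "u \<in> lorentz_space N \<iota> \<Longrightarrow> lorentz_norm N \<iota> u \<le> c * lorentz_norm M \<iota> u"
    "u \<in> lorentz_space N \<iota> \<Longrightarrow> lorentz_norm M \<iota> u \<le> C * lorentz_norm N \<iota> u"
proof -
  have E: "demicontinuous_lattice 1 M \<iota>"
    using M F unfolding semicontinuous_norm_def demicontinuous_lattice_def by simp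
  interpret E: demicontinuous_lattice 1 M \<iota> by (rule E)
  have eq: "lorentz_space N \<iota> = lorentz_space M \<iota>"
    using lorentz_norm_compare(1)[OF F E C] lorentz_norm_compare(1)[OF E F c] by blast
  show "semicontinuous_norm (lorentz_space N \<iota>) (lorentz_norm M \<iota>)"
    unfolding eq semicontinuous_norm_def
    using E.normed_lattice_FL monotonically_complete_demicontinuous[OF E.monotonically_complete_FL] by blast
  show "lorentz_norm N \<iota> u \<le> c * lorentz_norm M \<iota> u" if "u \<in> lorentz_space N \<iota>"
    using lorentz_norm_compare(2)[OF E F c] that unfolding eq .
  show "lorentz_norm M \<iota> u \<le> C * lorentz_norm N \<iota> u" if "u \<in> lorentz_space N \<iota>"
    using lorentz_norm_compare(2)[OF F E C that] .
qed

lemma semicontinuous_lorentz_completion: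
  assumes F: "demicontinuous_lattice r N \<iota>" and s: "semicontinuous_with r UNIV N"
  shows "semicontinuous_with r (lorentz_space N \<iota>) (lorentz_norm N \<iota>)"
proof -
  obtain M where M: "semicontinuous_norm UNIV M" "\<And>f. N f \<le> 1 * M f" "\<And>f. M f \<le> r * N f"
    using s unfolding semicontinuous_with_def by auto
  have r: "0 < r" using demicontinuous_lattice.r[OF F] by simp
  show ?thesis
    unfolding semicontinuous_with_def
    using semicontinuous_lorentz_norm[OF F M(1) zero_less_one M(2) r M(3)] by auto
qed

lemma topologically_semicontinuous_lorentz_completion:
  assumes F: "demicontinuous_lattice r N \<iota>" and s: "topologically_semicontinuous UNIV N"
  shows "topologically_semicontinuous (lorentz_space N \<iota>) (lorentz_norm N \<iota>)"
proof -
  obtain M c C where M: "semicontinuous_norm UNIV M" "0 < c" "0 < C" "\<And>f. c * N f \<le> M f" "\<And>f. M f \<le> C * N f"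
    using s unfolding topologically_semicontinuous_def equivalent_norms_def by auto
  have c: "0 < inverse c" "\<And>f. N f \<le> inverse c * M f"
    using M(2,4) by (simp_all add: field_simps)
  note L = semicontinuous_lorentz_norm[OF F M(1) c M(3,5)]
  have "c * lorentz_norm N \<iota> u \<le> lorentz_norm M \<iota> u" if "u \<in> lorentz_space N \<iota>" for u
    using L(2)[OF that] M(2) by (simp add: field_simps)
  then show ?thesis
    unfolding topologically_semicontinuous_def equivalent_norms_def using L(1,3) M(2,3) by blast
qed

text \<open>Functions are total on the ambient type, so uniqueness of \<open>TL\<close> is stated
  for its values on the Lorentz space, whereas \<open>J\<close> is defined on a whole type and
  uniqueness is literal.\<close>

theorem theorem6p1:
  fixes r :: real
    and N :: "'f::vector_lattice \<Rightarrow> real"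
    and \<iota> :: "'f \<Rightarrow> 'u::vector_lattice"
  assumes "r \<ge> 1"
    and "normed_lattice UNIV N"
    and "demicontinuous_with r UNIV N"
    and "universal_completion \<iota>"
  shows
    "(banach_lattice (lorentz_space N \<iota>) (lorentz_norm N \<iota>) \<and>
      monotonically_complete_with r (lorentz_space N \<iota>) (lorentz_norm N \<iota>))
     \<and>
     (\<exists>M. normed_lattice (lorentz_space N \<iota>) M \<and>
        demicontinuous_with (r\<^sup>2) (lorentz_space N \<iota>) M \<and>
        (\<forall>f. \<iota> f \<in> lorentz_space N \<iota> \<and> M (\<iota> f) = N f) \<and>
        equivalent_norms (lorentz_space N \<iota>) M (lorentz_norm N \<iota>))
     \<and>
     (\<forall>(\<kappa> :: 'f \<Rightarrow> 'c::vector_lattice) M.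
        norm_completion N \<kappa> M \<longrightarrow> demicontinuous_with (r\<^sup>2) UNIV M)
     \<and>
     (\<forall>(M :: 'e::vector_lattice \<Rightarrow> real) (\<iota>' :: 'e \<Rightarrow> 'v::vector_lattice) (T :: 'f \<Rightarrow> 'e).
        normed_lattice UNIV M \<and> demicontinuous UNIV M \<and> universal_completion \<iota>' \<and>
        lattice_hom UNIV UNIV T \<and> order_continuous UNIV UNIV T \<and> contractive UNIV N M T \<longrightarrow>
        (\<exists>TL.
           order_continuous_extension \<iota> (lorentz_space N \<iota>) \<iota>' (lorentz_space M \<iota>') T TL \<and>
           (\<forall>S. order_continuous_extension \<iota> (lorentz_space N \<iota>) \<iota>' (lorentz_space M \<iota>') T S
              \<longrightarrow> (\<forall>u\<in>lorentz_space N \<iota>. S u = TL u)) \<and>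
           lattice_hom (lorentz_space N \<iota>) (lorentz_space M \<iota>') TL \<and>
           contractive (lorentz_space N \<iota>) (lorentz_norm N \<iota>) (lorentz_norm M \<iota>') TL))
     \<and>
     (\<forall>(M :: 'g::vector_lattice \<Rightarrow> real) (\<kappa> :: 'f \<Rightarrow> 'g).
        normed_lattice UNIV M \<and> isomorphic_order_dense_embedding N \<kappa> M \<longrightarrow>
        (\<exists>!J. lattice_hom UNIV (lorentz_space N \<iota>) J \<and> inj J \<and>
           order_continuous UNIV (lorentz_space N \<iota>) J \<and> (\<forall>f. J (\<kappa> f) = \<iota> f)))
     \<and>
     (semicontinuous_with r UNIV N \<longrightarrow>
        semicontinuous_with r (lorentz_space N \<iota>) (lorentz_norm N \<iota>))
     \<and>
     (topologically_semicontinuous UNIV N \<longrightarrow>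
        topologically_semicontinuous (lorentz_space N \<iota>) (lorentz_norm N \<iota>))"
proof -
  have F: "demicontinuous_lattice r N \<iota>" using assms by unfold_locales
  interpret demicontinuous_lattice r N \<iota> by (rule F)
  have iii: "demicontinuous_with (r\<^sup>2) UNIV M"
    if "norm_completion N \<kappa> M" for \<kappa> :: "'f \<Rightarrow> 'c" and M
  proof -
    interpret completed_demicontinuous_lattice r N \<iota> \<kappa> M by unfold_locales (rule that)
    show ?thesis by (rule demicontinuous_completion)
  qed
  show ?thesis
  proof (intro conjI allI impI)
    show "banach_lattice (lorentz_space N \<iota>) (lorentz_norm N \<iota>)" by (rule banach_lattice_FL)
    show "monotonically_complete_with r (lorentz_space N \<iota>) (lorentz_norm N \<iota>)"
      by (rule monotonically_complete_FL)
    show "\<exists>M. normed_lattice (lorentz_space N \<iota>) M \<and>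
        demicontinuous_with (r\<^sup>2) (lorentz_space N \<iota>) M \<and>
        (\<forall>f. \<iota> f \<in> lorentz_space N \<iota> \<and> M (\<iota> f) = N f) \<and>
        equivalent_norms (lorentz_space N \<iota>) M (lorentz_norm N \<iota>)"
      using normed_lattice_extended_norm demicontinuous_extended_norm embedding_in_FL
        extended_norm_embedding equivalent_extended_norm by (intro exI[of _ extended_norm]) simp
  next
    fix M :: "'e \<Rightarrow> real" and \<iota>' :: "'e \<Rightarrow> 'v" and T :: "'f \<Rightarrow> 'e"
    assume a: "normed_lattice UNIV M \<and> demicontinuous UNIV M \<and> universal_completion \<iota>' \<and>
        lattice_hom UNIV UNIV T \<and> order_continuous UNIV UNIV T \<and> contractive UNIV N M T"
    then obtain r' where "1 \<le> r'" "demicontinuous_with r' UNIV M" unfolding demicontinuous_def by blast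
    then have "demicontinuous_lattice r' M \<iota>'" using a by unfold_locales auto
    then show "\<exists>TL.
           order_continuous_extension \<iota> (lorentz_space N \<iota>) \<iota>' (lorentz_space M \<iota>') T TL \<and>
           (\<forall>S. order_continuous_extension \<iota> (lorentz_space N \<iota>) \<iota>' (lorentz_space M \<iota>') T S
              \<longrightarrow> (\<forall>u\<in>lorentz_space N \<iota>. S u = TL u)) \<and>
           lattice_hom (lorentz_space N \<iota>) (lorentz_space M \<iota>') TL \<and>
           contractive (lorentz_space N \<iota>) (lorentz_norm N \<iota>) (lorentz_norm M \<iota>') TL"
      using lorentz_extension[OF F] a by blast
  next
    fix M :: "'g \<Rightarrow> real" and \<kappa> :: "'f \<Rightarrow> 'g"
    assume "normed_lattice UNIV M \<and> isomorphic_order_dense_embedding N \<kappa> M"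
    then show "\<exists>!J. lattice_hom UNIV (lorentz_space N \<iota>) J \<and> inj J \<and>
           order_continuous UNIV (lorentz_space N \<iota>) J \<and> (\<forall>f. J (\<kappa> f) = \<iota> f)"
      by (intro order_dense_embedding_extension) auto
  qed (fact iii semicontinuous_lorentz_completion[OF F] topologically_semicontinuous_lorentz_completion[OF F])+
qed

end
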